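(* Let $Z$ be a real Gaussian random field on $\mathbb{R}^2$ with constant mean and isotropic autocovariance $\operatorname{cov}(Z(\mathbf{t}),Z(\mathbf{s}))=R(|\mathbf{t}-\mathbf{s}|)$, such that $R(|t|)=R(0)-|t|^\alpha+o(|t|^{\alpha+\gamma})$ as $|t|\to 0$ for some $0<\alpha<2$ and $\gamma>0$, $R$ is $C^4$ away from the origin, and there is $c_0>0$ with $|R^{(4)}(t)|\le c_0t^{\alpha-4}$ for all sufficiently small $t>0$. Let $\Omega\subset\mathbb{R}^2$ be a bounded simply connected domain, let $f$ be a $C^2$ diffeomorphism (in the sense of the context), and let $\mathbf{h}\in\mathbb{R}^2$ be nonzero. Let $K:\mathbb{R}^2\to\mathbb{R}$ have bounded, continuous first and second order (mixed) partial derivatives, with $\int\!\!\int K(\mathbf{x})\,d\mathbf{x}=1$ and $\int\!\!\int|\mathbf{x}|K(\mathbf{x})\,d\mathbf{x}<\infty$. Let $(b_n)$ be positive numbers with $b_n\to 0$ and $n^{-1}b_n^{-3}=O(n^{-\beta})$ for some $\beta>0$. Then for every compact set $\Theta\subset\Omega$, with probability one, $$\sup_{\mathbf{t}\in\Theta}|B_{n,b_n}(\mathbf{t})-g(\mathbf{t})|\longrightarrow 0\quad\text{as } n\to\infty,\qquad\text{where } g(\mathbf{t})=(8-2^{\alpha+1})\,|J_f^{\mathbf{t}}\mathbf{h}|^\alpha .$$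
   Context: A $C^r$ diffeomorphism ($r\ge1$) means an injective map $f:\mathbb{R}^2\to\mathbb{R}^2$ having continuous (mixed) partial derivatives up to order $r$, whose inverse is $C^1$ on $f(\mathbb{R}^2)$, and with Jacobian determinant $\det J_f^{\mathbf{t}}>0$ for every $\mathbf{t}\in\mathbb{R}^2$; $J_f^{\mathbf{t}}$ is the Jacobian matrix of $f$ at $\mathbf{t}$. Put $Y=Z\circ f$, $\Delta_{\mathbf{h}}Y(\mathbf{t})=Y(\mathbf{t}+\mathbf{h})-Y(\mathbf{t})$, $\Delta^2_{\mathbf{h}}=\Delta_{\mathbf{h}}\Delta_{\mathbf{h}}$, $\Omega_n=\Omega\cap(\mathbb{Z}^2/n)$, and $$B_{n,b}(\mathbf{t})=\frac{1}{n^2b^2}\sum_{\mathbf{w}\in\Omega_n}K\Big(\frac{\mathbf{w}-\mathbf{t}}{b}\Big)\frac{(\Delta^2_{\mathbf{h}/n}Y(\mathbf{w}))^2}{n^{-\alpha}},\qquad \mathbf{t}\in\Omega.$$ *)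

theory Defs
  imports "HOL-Probability.Probability" "HOL-Library.Landau_Symbols"
begin

definition partial :: "'n::finite \<Rightarrow> (real^'n \<Rightarrow> 'b::real_normed_vector) \<Rightarrow> real^'n \<Rightarrow> 'b" where
  "partial i F x = vector_derivative (\<lambda>s. F (x + s *\<^sub>R axis i 1)) (at 0)"

(* Continuous mixed partial derivatives up to order r, in every order of differentiation.
   The partials are two-sided, so S is meant to be open. *)
primrec Cr_on :: "nat \<Rightarrow> (real^'n::finite) set \<Rightarrow> (real^'n \<Rightarrow> 'b::real_normed_vector) \<Rightarrow> bool" where
  "Cr_on 0 S F \<longleftrightarrow> continuous_on S F"
| "Cr_on (Suc r) S F \<longleftrightarrow> continuous_on S F \<and>
     (\<forall>i. (\<forall>x\<in>S. (\<lambda>s. F (x + s *\<^sub>R axis i 1)) differentiable (at 0)) \<and> Cr_on r S (partial i F))"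

(* The image range f is open by invariance of domain, so Cr_on applies to the inverse. *)
definition Cr_diffeo :: "nat \<Rightarrow> (real^2 \<Rightarrow> real^2) \<Rightarrow> bool" where
  "Cr_diffeo r f \<longleftrightarrow> r \<ge> 1 \<and> inj f \<and> Cr_on r UNIV f \<and> Cr_on 1 (range f) (inv f) \<and>
     (\<forall>t. det (jacobian f (at t)) > 0)"

definition Ck_on_real :: "nat \<Rightarrow> real set \<Rightarrow> (real \<Rightarrow> real) \<Rightarrow> bool" where
  "Ck_on_real k S F \<longleftrightarrow>
     (\<forall>j<k. \<forall>t\<in>S. (deriv ^^ j) F field_differentiable (at t)) \<and>
     (\<forall>j\<le>k. continuous_on S ((deriv ^^ j) F))"

(* Degenerate (almost surely constant) variables count as Gaussian. *)
definition gaussian_rv :: "'w measure \<Rightarrow> ('w \<Rightarrow> real) \<Rightarrow> bool" where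
  "gaussian_rv M X \<longleftrightarrow> X \<in> borel_measurable M \<and>
     ((\<exists>\<mu>. AE \<omega> in M. X \<omega> = \<mu>) \<or>
      (\<exists>\<mu> \<sigma>. \<sigma> > 0 \<and> distributed M lborel X (normal_density \<mu> \<sigma>)))"

definition gaussian_field :: "'w measure \<Rightarrow> ('i \<Rightarrow> 'w \<Rightarrow> real) \<Rightarrow> bool" where
  "gaussian_field M Z \<longleftrightarrow>
     (\<forall>I c. finite I \<longrightarrow> gaussian_rv M (\<lambda>\<omega>. \<Sum>t\<in>I. c t * Z t \<omega>))"

definition covariance :: "'w measure \<Rightarrow> ('w \<Rightarrow> real) \<Rightarrow> ('w \<Rightarrow> real) \<Rightarrow> real" where
  "covariance M X Y =
     (LINT \<omega>|M. (X \<omega> - (LINT \<omega>'|M. X \<omega>')) * (Y \<omega> - (LINT \<omega>'|M. Y \<omega>')))"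

definition increment :: "'a::plus \<Rightarrow> ('a \<Rightarrow> real) \<Rightarrow> 'a \<Rightarrow> real" where
  "increment h Y t = Y (t + h) - Y t"

definition scaled_lattice :: "nat \<Rightarrow> (real^2) set" where
  "scaled_lattice n = {w. \<forall>i. \<exists>k::int. w $ i = of_int k / of_nat n}"

definition kernel_qv ::
  "real \<Rightarrow> (real^2) set \<Rightarrow> (real^2 \<Rightarrow> real) \<Rightarrow> real^2 \<Rightarrow> (real^2 \<Rightarrow> real) \<Rightarrow> nat \<Rightarrow> real \<Rightarrow> real^2 \<Rightarrow> real"
where
  "kernel_qv \<alpha> \<Omega> K h Y n b t =
     1 / ((real n)\<^sup>2 * b\<^sup>2) *
     (\<Sum>w\<in>\<Omega> \<inter> scaled_lattice n.
        K ((w - t) /\<^sub>R b) *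
        ((increment (h /\<^sub>R real n) (increment (h /\<^sub>R real n) Y) w)\<^sup>2 / real n powr (- \<alpha>)))"

end

(* With X_w = n^(alpha/2) D_w, where D_w is the second-order increment of Y = Z o f at w, the
   estimator is the quadratic form B(t) = sum_w a_w(t) X_w^2 with a_w(t) = K((w-t)/b) / (n^2 b^2).

   Mean. E X_w^2 tends to g(w) uniformly, because R(r) = R(0) - r^alpha + o(r^alpha), so E B(t) is a
   Riemann sum of the convolution of g with the rescaled kernel; the error is of order 1/(n b^3).

   Fluctuation. For nonnegative weights (split K into K^+ and K^-), let U = S - E S with
   S = sum_w a_w X_w^2 and let c_vw be the covariance of sqrt(a_v) X_v and sqrt(a_w) X_w. Gaussian
   integration by parts gives E U^(k+1) = 2k E (sum_vw c_vw sqrt(a_v a_w) X_v X_w) U^(k-1), and the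
   inner form is at most rho S, where rho is the largest absolute row sum of (c_vw). Hence
   E U^(2p) = O((rho (rho + E S))^p). Estimating the covariances by a mixed difference of order 2 in
   one point and order 1 in the other (f being C^2, order 2 in both is available, but order 3 in total
   suffices because alpha < 2) yields rho = O(1/(n b^3)) = O(n^(-beta)). For large p these moments are summable over
   n and over a grid of O(n^6) points t, and the Lipschitz continuity of K passes from the grid to
   all t. *)

theory Submission
  imports Defs
begin

text \<open>The hypothesis on the field says only that every finite linear combination is a normal
  variable, possibly degenerate; joint densities and Wick's formula are avoided. Everything
  distributional enters through the scalar recursion E X^(k+2) = (k+1) E X^2 E X^k on a set of
  variables closed under X + s Y. Inserting Y + s a and differentiating at s = 0 polarises it to
  integration by parts. All expectations involved are polynomials in s, so no limit is exchanged
  with an expectation. In rho, the weights contribute n^(-2) b^(-2) and the row sums of the scaled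
  covariances contribute n. The third factor b^(-1) arises because the kernel is bounded by its
  Lipschitz growth, k(x) <= k(0) + L |x|, at arguments of size O(1/b). The n^6 grid points come from
  the mesh n^(-3): moving t by that much changes the estimator by at most a constant times (n
  b^3)^(-1) n^(-4) sum_w X_w^2, which vanishes almost surely because the means of n^(-4) sum_w X_w^2
  are O(n^(-2)). Against n^6 points, moments of size O(n^(-8)) suffice.\<close>

section \<open>Variables with moments of all orders\<close>

definition all_moments :: "'w measure \<Rightarrow> ('w \<Rightarrow> real) \<Rightarrow> bool" where
  "all_moments M X \<longleftrightarrow> X \<in> borel_measurable M \<and> (\<forall>k::nat. integrable M (\<lambda>\<omega>. X \<omega> ^ k))"

lemma all_moments_integrable:
  assumes "all_moments M X" shows "integrable M X"
proof -
  have "integrable M (\<lambda>\<omega>. X \<omega> ^ 1)" using assms unfolding all_moments_def by blast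
  thus ?thesis by simp
qed

text \<open>The k-th power of the product is dominated, through
  \<open>\<bar>x * y\<bar> \<le> x\<^sup>2 + y\<^sup>2\<close>, by moments of order
  \<open>2 * k\<close>. Closure under products is what makes the class an algebra: every polynomial
  in Gaussian variables is then integrable without further estimates.\<close>

lemma all_moments_mult:
  assumes "all_moments M X" "all_moments M Y"
  shows "all_moments M (\<lambda>\<omega>. X \<omega> * Y \<omega>)"
proof -
  have m [measurable]: "X \<in> borel_measurable M" "Y \<in> borel_measurable M"
    using assms unfolding all_moments_def by auto
  have "integrable M (\<lambda>\<omega>. (X \<omega> * Y \<omega>) ^ k)" for k :: nat
  proof (rule Bochner_Integration.integrable_bound)
    show "integrable M (\<lambda>\<omega>. X \<omega> ^ (2*k) + Y \<omega> ^ (2*k))"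
      using assms unfolding all_moments_def by auto
    have "\<bar>x * y\<bar> \<le> x\<^sup>2 + y\<^sup>2" for x y :: real
    proof -
      have "2 * \<bar>x * y\<bar> \<le> x\<^sup>2 + y\<^sup>2"
        using sum_squares_bound[of "\<bar>x\<bar>" "\<bar>y\<bar>"] by (simp add: abs_mult mult.assoc)
      thus ?thesis by (smt (verit) abs_ge_zero)
    qed
    from this[of "X _ ^ k" "Y _ ^ k"]
    show "AE \<omega> in M. norm ((X \<omega> * Y \<omega>) ^ k) \<le> norm (X \<omega> ^ (2*k) + Y \<omega> ^ (2*k))"
      by (intro AE_I2, subst real_norm_def, intro order_trans[OF _ abs_ge_self])
         (simp add: power_mult_distrib power_mult[symmetric] mult.commute)
  qed measurable
  thus ?thesis unfolding all_moments_def by auto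
qed

lemma (in prob_space) all_moments_const [simp]: "all_moments M (\<lambda>\<omega>. c)"
  by (simp add: all_moments_def)

lemma (in prob_space) all_moments_power:
  assumes "all_moments M X" shows "all_moments M (\<lambda>\<omega>. X \<omega> ^ k)"
  by (induction k) (auto intro: all_moments_mult assms)

lemma (in prob_space) all_moments_add:
  assumes "all_moments M X" "all_moments M Y"
  shows "all_moments M (\<lambda>\<omega>. X \<omega> + Y \<omega>)"
proof -
  have [measurable]: "X \<in> borel_measurable M" "Y \<in> borel_measurable M"
    using assms unfolding all_moments_def by auto
  have "integrable M (\<lambda>\<omega>. (X \<omega> + Y \<omega>) ^ k)" for k :: nat
    unfolding binomial_ring
    by (intro Bochner_Integration.integrable_sum all_moments_integrable all_moments_mult
        all_moments_power all_moments_const assms)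
  thus ?thesis unfolding all_moments_def by auto
qed

lemma (in prob_space) all_moments_cmult:
  "all_moments M X \<Longrightarrow> all_moments M (\<lambda>\<omega>. c * X \<omega>)"
  by (intro all_moments_mult all_moments_const)

lemma (in prob_space) all_moments_sum:
  assumes "\<And>i. i \<in> I \<Longrightarrow> all_moments M (X i)"
  shows "all_moments M (\<lambda>\<omega>. \<Sum>i\<in>I. X i \<omega>)"
  using assms by (induction I rule: infinite_finite_induct) (auto intro: all_moments_add)

lemma (in prob_space) all_moments_diff:
  assumes "all_moments M X" "all_moments M Y"
  shows "all_moments M (\<lambda>\<omega>. X \<omega> - Y \<omega>)"
  using all_moments_add[OF assms(1) all_moments_cmult[OF assms(2), of "-1"]] by simp

lemma (in prob_space) all_moments_prod_list:
  assumes "\<And>X. X \<in> set Zs \<Longrightarrow> all_moments M X"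
  shows "all_moments M (\<lambda>\<omega>. \<Prod>Z\<leftarrow>Zs. Z \<omega>)"
  using assms by (induction Zs) (auto intro: all_moments_mult)

lemmas (in prob_space) all_moments_intros =
  all_moments_mult all_moments_const all_moments_power all_moments_add all_moments_cmult
  all_moments_sum all_moments_diff all_moments_prod_list

text \<open>The binomial theorem makes the expectation a polynomial in \<open>s\<close>, so
  differentiating it is reading off the linear coefficient and needs no exchange of derivative and
  integral.\<close>

lemma (in prob_space) expectation_line_has_derivative:
  assumes "all_moments M G" "all_moments M Y" "all_moments M Z"
  shows "((\<lambda>s. expectation (\<lambda>\<omega>. G \<omega> * (Y \<omega> + s * Z \<omega>) ^ m)) has_real_derivative
           real m * expectation (\<lambda>\<omega>. G \<omega> * Z \<omega> * Y \<omega> ^ (m - 1))) (at 0)"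
proof -
  define e where "e i = real (m choose i) * expectation (\<lambda>\<omega>. G \<omega> * (Z \<omega> ^ i * Y \<omega> ^ (m - i)))" for i
  have "expectation (\<lambda>\<omega>. G \<omega> * (Y \<omega> + s * Z \<omega>) ^ m) = (\<Sum>i\<le>m. e i * s ^ i)" for s
  proof -
    have "expectation (\<lambda>\<omega>. G \<omega> * (Y \<omega> + s * Z \<omega>) ^ m) =
        expectation (\<lambda>\<omega>. \<Sum>i\<le>m. (real (m choose i) * s ^ i) * (G \<omega> * (Z \<omega> ^ i * Y \<omega> ^ (m - i))))"
      unfolding add.commute[of "Y _"] binomial_ring
      by (intro Bochner_Integration.integral_cong refl)
         (simp add: sum_distrib_left power_mult_distrib mult_ac)
    also have "\<dots> = (\<Sum>i\<le>m. expectation (\<lambda>\<omega>. (real (m choose i) * s ^ i) * (G \<omega> * (Z \<omega> ^ i * Y \<omega> ^ (m - i)))))"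
      by (intro Bochner_Integration.integral_sum all_moments_integrable all_moments_intros assms)
    also have "\<dots> = (\<Sum>i\<le>m. e i * s ^ i)"
      by (simp only: Bochner_Integration.integral_mult_right_zero e_def) (simp add: mult_ac)
    finally show ?thesis .
  qed
  moreover have "((\<lambda>s. \<Sum>i\<le>m. e i * s ^ i) has_real_derivative
      (\<Sum>i\<le>m. e i * (real i * 0 ^ (i - 1)))) (at 0)"
    by (auto intro!: derivative_eq_intros simp: mult_ac)
  \<comment> \<open>At s = 0 only the linear term is left: \<open>real i\<close> kills i = 0, and
    \<open>0 ^ (i - 1)\<close> kills i > 1.\<close>
  moreover have "(\<Sum>i\<le>m. e i * (real i * 0 ^ (i - 1))) = real m * expectation (\<lambda>\<omega>. G \<omega> * Z \<omega> * Y \<omega> ^ (m - 1))"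
  proof (cases "m = 0")
    case False
    have "(\<Sum>i\<le>m. e i * (real i * 0 ^ (i - 1))) = (\<Sum>i\<in>{1}. e i * (real i * 0 ^ (i - 1)))"
      using False by (intro sum.mono_neutral_right) auto
    thus ?thesis by (simp add: e_def mult.assoc)
  qed simp
  ultimately show ?thesis by simp
qed

section \<open>Moments of quadratic forms in Gaussian variables\<close>

definition quad_form :: "'i set \<Rightarrow> ('i \<Rightarrow> 'w \<Rightarrow> real) \<Rightarrow> 'w \<Rightarrow> real" where
  "quad_form I X \<omega> = (\<Sum>i\<in>I. (X i \<omega>)\<^sup>2)"

text \<open>A centred Gaussian linear space reduced to what the moment computation uses.
  \<open>moment_rec\<close> is the one-dimensional normal moment recursion; closure under lines
  carries it over to joint moments by polarisation. Degenerate variables satisfy it as well, so the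
  covariances may be singular.\<close>

locale gaussian_space = prob_space M for M :: "'w measure" +
  fixes V :: "('w \<Rightarrow> real) set"
  assumes line_closed: "\<And>X Y s. X \<in> V \<Longrightarrow> Y \<in> V \<Longrightarrow> (\<lambda>\<omega>. X \<omega> + s * Y \<omega>) \<in> V"
    and moments: "\<And>X. X \<in> V \<Longrightarrow> all_moments M X"
    and centered: "\<And>X. X \<in> V \<Longrightarrow> expectation X = 0"
    and moment_rec: "\<And>X k. X \<in> V \<Longrightarrow> expectation (\<lambda>\<omega>. X \<omega> ^ (k + 2)) =
          real (k + 1) * expectation (\<lambda>\<omega>. X \<omega> ^ 2) * expectation (\<lambda>\<omega>. X \<omega> ^ k)"
begin

text \<open>Polarisation of \<open>moment_rec\<close>: both sides are taken at
  \<open>Y + s * a\<close> with exponent i + 2, where j = i + 1, and their derivatives at s = 0 are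
  compared. The lower mixed moment that appears is known by strong induction.\<close>

lemma stein_power:
  assumes a: "a \<in> V" and Y: "Y \<in> V"
  shows "expectation (\<lambda>\<omega>. a \<omega> * Y \<omega> ^ j) =
    real j * expectation (\<lambda>\<omega>. a \<omega> * Y \<omega>) * expectation (\<lambda>\<omega>. Y \<omega> ^ (j - 1))"
proof (induction j rule: less_induct)
  case (less j)
  let ?E = expectation
  have ma: "all_moments M a" and mY: "all_moments M Y" using a Y moments by auto
  show ?case
  proof (cases j)
    case 0
    thus ?thesis using centered[OF a] by simp
  next
    case (Suc i)
    define L where "L m s = ?E (\<lambda>\<omega>. 1 * (Y \<omega> + s * a \<omega>) ^ m)" for m :: nat and s :: real
    have dL: "(L m has_real_derivative real m * ?E (\<lambda>\<omega>. 1 * a \<omega> * Y \<omega> ^ (m - 1))) (at 0)" for m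
      unfolding L_def by (intro expectation_line_has_derivative ma mY) simp
    have "L (i + 2) s = real (i + 1) * L 2 s * L i s" for s
      unfolding L_def using moment_rec[OF line_closed[OF Y a, of s], of i] by simp
    hence eq: "L (i + 2) = (\<lambda>s. real (i + 1) * L 2 s * L i s)" by auto
    have "real (i + 2) * ?E (\<lambda>\<omega>. 1 * a \<omega> * Y \<omega> ^ (i + 2 - 1)) =
      real (i + 1) * (real 2 * ?E (\<lambda>\<omega>. 1 * a \<omega> * Y \<omega> ^ (2 - 1))) * L i 0 +
      (real i * ?E (\<lambda>\<omega>. 1 * a \<omega> * Y \<omega> ^ (i - 1))) * (real (i + 1) * L 2 0)"
    proof (rule DERIV_unique[OF dL])
      show "(L (i + 2) has_real_derivative real (i + 1) * (real 2 * ?E (\<lambda>\<omega>. 1 * a \<omega> * Y \<omega> ^ (2 - 1))) * L i 0 +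
          (real i * ?E (\<lambda>\<omega>. 1 * a \<omega> * Y \<omega> ^ (i - 1))) * (real (i + 1) * L 2 0)) (at 0)"
        unfolding eq by (rule DERIV_mult[OF DERIV_cmult[OF dL] dL])
    qed
    hence A: "real (i + 2) * ?E (\<lambda>\<omega>. a \<omega> * Y \<omega> ^ (i + 1)) =
      2 * real (i + 1) * ?E (\<lambda>\<omega>. a \<omega> * Y \<omega>) * ?E (\<lambda>\<omega>. Y \<omega> ^ i) +
      real (i + 1) * (real i * ?E (\<lambda>\<omega>. a \<omega> * Y \<omega> ^ (i - 1)) * ?E (\<lambda>\<omega>. Y \<omega> ^ 2))"
      by (simp add: L_def algebra_simps)
    \<comment> \<open>The induction hypothesis at i - 1 turns the mixed moment into a pure one, and
      \<open>moment_rec\<close> absorbs the variance into \<open>Y \<omega> ^ i\<close>. For i = 1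
      both sides vanish by centring.\<close>
    have B: "real i * ?E (\<lambda>\<omega>. a \<omega> * Y \<omega> ^ (i - 1)) * ?E (\<lambda>\<omega>. Y \<omega> ^ 2) =
      real i * ?E (\<lambda>\<omega>. a \<omega> * Y \<omega>) * ?E (\<lambda>\<omega>. Y \<omega> ^ i)"
    proof -
      consider "i = 0" | "i = 1" | k where "i = k + 2"
        by (metis One_nat_def add_2_eq_Suc' not0_implies_Suc)
      thus ?thesis
      proof cases
        case 2
        thus ?thesis using centered[OF a] centered[OF Y] by simp
      next
        case 3
        have "?E (\<lambda>\<omega>. a \<omega> * Y \<omega> ^ (k + 1)) = real (k + 1) * ?E (\<lambda>\<omega>. a \<omega> * Y \<omega>) * ?E (\<lambda>\<omega>. Y \<omega> ^ k)"
          using less.IH[of "k + 1"] Suc 3 by simp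
        thus ?thesis using moment_rec[OF Y, of k] 3 by simp
      qed simp
    qed
    \<comment> \<open>The coefficients add up to 2 (i + 1) + (i + 1) i = (i + 2) (i + 1), and then i
      + 2 cancels.\<close>
    have "real (i + 2) * ?E (\<lambda>\<omega>. a \<omega> * Y \<omega> ^ (i + 1)) =
       real (i + 2) * (real (i + 1) * ?E (\<lambda>\<omega>. a \<omega> * Y \<omega>) * ?E (\<lambda>\<omega>. Y \<omega> ^ i))"
      unfolding A B by (simp add: algebra_simps)
    hence "?E (\<lambda>\<omega>. a \<omega> * Y \<omega> ^ (i + 1)) = real (i + 1) * ?E (\<lambda>\<omega>. a \<omega> * Y \<omega>) * ?E (\<lambda>\<omega>. Y \<omega> ^ i)"
      by (subst (asm) mult_left_cancel) auto
    thus ?thesis using Suc by simp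
  qed
qed

text \<open>\<open>dprod a Zs\<close> is the derivative of the monomial \<open>\<Prod> Zs\<close> along the derivation of
  the polynomial algebra over \<open>V\<close> that maps \<open>Z\<close> to the covariance of \<open>a\<close> and \<open>Z\<close>.\<close>

fun dprod :: "('w \<Rightarrow> real) \<Rightarrow> ('w \<Rightarrow> real) list \<Rightarrow> 'w \<Rightarrow> real" where
  "dprod a [] = (\<lambda>\<omega>. 0)"
| "dprod a (Z # Zs) = (\<lambda>\<omega>. expectation (\<lambda>\<omega>. a \<omega> * Z \<omega>) * (\<Prod>Z\<leftarrow>Zs. Z \<omega>) + Z \<omega> * dprod a Zs \<omega>)"

lemma all_moments_dprod: "set Zs \<subseteq> V \<Longrightarrow> all_moments M (dprod a Zs)"
  by (induction Zs) (auto intro!: all_moments_intros dest: moments)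

text \<open>Polarisation again: the induction hypothesis at \<open>Y + s * Z\<close> with exponent j
  + 1 is differentiated at s = 0, which splits one factor \<open>Z\<close> off the power. The
  covariance of \<open>a\<close> with \<open>Y + s * Z\<close> depends on s too; its derivative
  produces the new summand of \<open>dprod a (Z # Zs)\<close>.\<close>

lemma stein_monomial:
  assumes a: "a \<in> V" and "set Zs \<subseteq> V" and "Y \<in> V"
  shows "expectation (\<lambda>\<omega>. a \<omega> * (\<Prod>Z\<leftarrow>Zs. Z \<omega>) * Y \<omega> ^ j) =
    expectation (\<lambda>\<omega>. dprod a Zs \<omega> * Y \<omega> ^ j) +
    real j * expectation (\<lambda>\<omega>. a \<omega> * Y \<omega>) * expectation (\<lambda>\<omega>. (\<Prod>Z\<leftarrow>Zs. Z \<omega>) * Y \<omega> ^ (j - 1))"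
  using assms(2,3)
proof (induction Zs arbitrary: Y j)
  case Nil
  thus ?case using stein_power[OF a, of Y j] by simp
next
  case (Cons Z Zs)
  let ?E = expectation
  let ?P = "\<lambda>\<omega>. \<Prod>Z\<leftarrow>Zs. Z \<omega>"
  have Z: "Z \<in> V" and Zs: "set Zs \<subseteq> V" using Cons.prems by auto
  have mm: "all_moments M a" "all_moments M Z" "all_moments M Y" "all_moments M ?P" "all_moments M (dprod a Zs)"
    using a Z Zs Cons.prems moments by (auto intro!: all_moments_prod_list all_moments_dprod)
  define L where "L G m s = ?E (\<lambda>\<omega>. G \<omega> * (Y \<omega> + s * Z \<omega>) ^ m)" for G and m :: nat and s :: real
  have dL: "(L G m has_real_derivative real m * ?E (\<lambda>\<omega>. G \<omega> * Z \<omega> * Y \<omega> ^ (m - 1))) (at 0)"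
    if "all_moments M G" for m G
    unfolding L_def by (intro expectation_line_has_derivative mm that)
  have "L (\<lambda>\<omega>. a \<omega> * ?P \<omega>) (j + 1) s = L (dprod a Zs) (j + 1) s +
      real (j + 1) * (L a 1 s * L ?P j s)" for s
    unfolding L_def using Cons.IH[OF Zs line_closed[OF \<open>Y \<in> V\<close> Z, of s], of "j + 1"] by (simp add: mult.assoc)
  hence eq: "L (\<lambda>\<omega>. a \<omega> * ?P \<omega>) (j + 1) = (\<lambda>s. L (dprod a Zs) (j + 1) s + real (j + 1) * (L a 1 s * L ?P j s))"
    by auto
  let ?D1 = "\<lambda>G. real (j + 1) * ?E (\<lambda>\<omega>. G \<omega> * Z \<omega> * Y \<omega> ^ (j + 1 - 1))"
  have "?D1 (\<lambda>\<omega>. a \<omega> * ?P \<omega>) = ?D1 (dprod a Zs) + real (j + 1) *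
     (real 1 * ?E (\<lambda>\<omega>. a \<omega> * Z \<omega> * Y \<omega> ^ (1 - 1)) * L ?P j 0 +
      real j * ?E (\<lambda>\<omega>. ?P \<omega> * Z \<omega> * Y \<omega> ^ (j - 1)) * L a 1 0)"
  proof (rule DERIV_unique[OF dL])
    show "all_moments M (\<lambda>\<omega>. a \<omega> * ?P \<omega>)" by (intro all_moments_mult mm)
    show "(L (\<lambda>\<omega>. a \<omega> * ?P \<omega>) (j + 1) has_real_derivative ?D1 (dprod a Zs) + real (j + 1) *
     (real 1 * ?E (\<lambda>\<omega>. a \<omega> * Z \<omega> * Y \<omega> ^ (1 - 1)) * L ?P j 0 +
      real j * ?E (\<lambda>\<omega>. ?P \<omega> * Z \<omega> * Y \<omega> ^ (j - 1)) * L a 1 0)) (at 0)"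
      unfolding eq by (intro DERIV_add dL DERIV_cmult DERIV_mult mm)
  qed
  hence "real (j + 1) * ?E (\<lambda>\<omega>. a \<omega> * ?P \<omega> * Z \<omega> * Y \<omega> ^ j) = real (j + 1) * (?E (\<lambda>\<omega>. dprod a Zs \<omega> * Z \<omega> * Y \<omega> ^ j) +
     ?E (\<lambda>\<omega>. a \<omega> * Z \<omega>) * ?E (\<lambda>\<omega>. ?P \<omega> * Y \<omega> ^ j) +
     real j * ?E (\<lambda>\<omega>. ?P \<omega> * Z \<omega> * Y \<omega> ^ (j - 1)) * ?E (\<lambda>\<omega>. a \<omega> * Y \<omega>))"
    by (simp add: L_def algebra_simps)
  hence *: "?E (\<lambda>\<omega>. a \<omega> * ?P \<omega> * Z \<omega> * Y \<omega> ^ j) = ?E (\<lambda>\<omega>. dprod a Zs \<omega> * Z \<omega> * Y \<omega> ^ j) +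
     ?E (\<lambda>\<omega>. a \<omega> * Z \<omega>) * ?E (\<lambda>\<omega>. ?P \<omega> * Y \<omega> ^ j) +
     real j * ?E (\<lambda>\<omega>. ?P \<omega> * Z \<omega> * Y \<omega> ^ (j - 1)) * ?E (\<lambda>\<omega>. a \<omega> * Y \<omega>)"
    by (subst (asm) mult_left_cancel) auto
  have "?E (\<lambda>\<omega>. dprod a (Z # Zs) \<omega> * Y \<omega> ^ j) =
    ?E (\<lambda>\<omega>. ?E (\<lambda>\<omega>. a \<omega> * Z \<omega>) * (?P \<omega> * Y \<omega> ^ j) + dprod a Zs \<omega> * Z \<omega> * Y \<omega> ^ j)"
    by (simp add: algebra_simps)
  also have "\<dots> = ?E (\<lambda>\<omega>. ?E (\<lambda>\<omega>. a \<omega> * Z \<omega>) * (?P \<omega> * Y \<omega> ^ j)) + ?E (\<lambda>\<omega>. dprod a Zs \<omega> * Z \<omega> * Y \<omega> ^ j)"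
    by (intro Bochner_Integration.integral_add all_moments_integrable all_moments_intros mm)
       (use Zs moments in auto)
  also have "?E (\<lambda>\<omega>. ?E (\<lambda>\<omega>. a \<omega> * Z \<omega>) * (?P \<omega> * Y \<omega> ^ j)) = ?E (\<lambda>\<omega>. a \<omega> * Z \<omega>) * ?E (\<lambda>\<omega>. ?P \<omega> * Y \<omega> ^ j)"
    by (rule Bochner_Integration.integral_mult_right_zero)
  finally show ?case using * by (simp add: mult_ac)
qed

text \<open>\<open>D\<close> acts as the derivative of \<open>P\<close> in the direction
  \<open>a\<close>. Testing against all monomials over the space lets the product rule be proved for
  random variables, without a polynomial ring and without asking whether \<open>D\<close> is
  determined by \<open>P\<close>.\<close>

definition stein_pair :: "('w \<Rightarrow> real) \<Rightarrow> ('w \<Rightarrow> real) \<Rightarrow> ('w \<Rightarrow> real) \<Rightarrow> bool" where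
  "stein_pair a P D \<longleftrightarrow> all_moments M P \<and> all_moments M D \<and>
     (\<forall>Zs. set Zs \<subseteq> V \<longrightarrow> expectation (\<lambda>\<omega>. a \<omega> * P \<omega> * (\<Prod>Z\<leftarrow>Zs. Z \<omega>)) =
        expectation (\<lambda>\<omega>. D \<omega> * (\<Prod>Z\<leftarrow>Zs. Z \<omega>) + P \<omega> * dprod a Zs \<omega>))"

lemma stein_pair_const:
  assumes "a \<in> V" shows "stein_pair a (\<lambda>\<omega>. c) (\<lambda>\<omega>. 0)"
  unfolding stein_pair_def
proof (intro conjI allI impI)
  fix Zs assume Zs: "set Zs \<subseteq> V"
  show "expectation (\<lambda>\<omega>. a \<omega> * c * (\<Prod>Z\<leftarrow>Zs. Z \<omega>)) =
        expectation (\<lambda>\<omega>. 0 * (\<Prod>Z\<leftarrow>Zs. Z \<omega>) + c * dprod a Zs \<omega>)"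
    using stein_monomial[OF assms Zs assms, of 0] by (simp add: mult_ac)
qed auto

text \<open>The identity for \<open>P * Z\<close> against \<open>Zs\<close> is the one for
  \<open>P\<close> against \<open>Z # Zs\<close>: the recursion of \<open>dprod\<close> supplies the
  product rule.\<close>

lemma stein_pair_mult:
  assumes "stein_pair a P D" "Z \<in> V"
  shows "stein_pair a (\<lambda>\<omega>. P \<omega> * Z \<omega>) (\<lambda>\<omega>. D \<omega> * Z \<omega> + P \<omega> * expectation (\<lambda>\<omega>. a \<omega> * Z \<omega>))"
  unfolding stein_pair_def
proof (intro conjI allI impI)
  fix Zs assume Zs: "set Zs \<subseteq> V"
  have "expectation (\<lambda>\<omega>. a \<omega> * P \<omega> * (\<Prod>Z\<leftarrow>(Z#Zs). Z \<omega>)) =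
        expectation (\<lambda>\<omega>. D \<omega> * (\<Prod>Z\<leftarrow>(Z#Zs). Z \<omega>) + P \<omega> * dprod a (Z#Zs) \<omega>)"
    using assms Zs unfolding stein_pair_def by (intro assms(1)[unfolded stein_pair_def, THEN conjunct2, THEN conjunct2, rule_format]) auto
  thus "expectation (\<lambda>\<omega>. a \<omega> * (P \<omega> * Z \<omega>) * (\<Prod>Z\<leftarrow>Zs. Z \<omega>)) =
        expectation (\<lambda>\<omega>. (D \<omega> * Z \<omega> + P \<omega> * expectation (\<lambda>\<omega>. a \<omega> * Z \<omega>)) * (\<Prod>Z\<leftarrow>Zs. Z \<omega>) +
          P \<omega> * Z \<omega> * dprod a Zs \<omega>)"
    by (simp add: algebra_simps)
qed (use assms in \<open>auto simp: stein_pair_def intro!: all_moments_intros dest: moments\<close>)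

lemma stein_pair_add:
  assumes "a \<in> V" "stein_pair a P D" "stein_pair a P' D'"
  shows "stein_pair a (\<lambda>\<omega>. P \<omega> + P' \<omega>) (\<lambda>\<omega>. D \<omega> + D' \<omega>)"
  unfolding stein_pair_def
proof (intro conjI allI impI)
  have mm: "all_moments M P" "all_moments M P'" "all_moments M D" "all_moments M D'" "all_moments M a"
    using assms moments by (auto simp: stein_pair_def)
  show "all_moments M (\<lambda>\<omega>. P \<omega> + P' \<omega>)" "all_moments M (\<lambda>\<omega>. D \<omega> + D' \<omega>)"
    by (intro all_moments_add mm)+
  fix Zs assume Zs: "set Zs \<subseteq> V"
  let ?E = expectation
  let ?Z = "\<lambda>\<omega>. \<Prod>Z\<leftarrow>Zs. Z \<omega>"
  have mZ: "all_moments M ?Z" "all_moments M (dprod a Zs)"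
    using Zs moments by (auto intro!: all_moments_prod_list all_moments_dprod)
  have "?E (\<lambda>\<omega>. a \<omega> * (P \<omega> + P' \<omega>) * ?Z \<omega>) = ?E (\<lambda>\<omega>. a \<omega> * P \<omega> * ?Z \<omega> + a \<omega> * P' \<omega> * ?Z \<omega>)"
    by (simp add: algebra_simps)
  also have "\<dots> = ?E (\<lambda>\<omega>. a \<omega> * P \<omega> * ?Z \<omega>) + ?E (\<lambda>\<omega>. a \<omega> * P' \<omega> * ?Z \<omega>)"
    by (intro Bochner_Integration.integral_add all_moments_integrable all_moments_mult mm mZ)
  also have "\<dots> = ?E (\<lambda>\<omega>. D \<omega> * ?Z \<omega> + P \<omega> * dprod a Zs \<omega>) + ?E (\<lambda>\<omega>. D' \<omega> * ?Z \<omega> + P' \<omega> * dprod a Zs \<omega>)"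
    using assms Zs unfolding stein_pair_def by simp
  also have "\<dots> = ?E (\<lambda>\<omega>. (D \<omega> * ?Z \<omega> + P \<omega> * dprod a Zs \<omega>) + (D' \<omega> * ?Z \<omega> + P' \<omega> * dprod a Zs \<omega>))"
    by (intro Bochner_Integration.integral_add[symmetric] all_moments_integrable all_moments_add all_moments_mult mm mZ)
  also have "\<dots> = ?E (\<lambda>\<omega>. (D \<omega> + D' \<omega>) * ?Z \<omega> + (P \<omega> + P' \<omega>) * dprod a Zs \<omega>)"
    by (simp add: algebra_simps)
  finally show "?E (\<lambda>\<omega>. a \<omega> * (P \<omega> + P' \<omega>) * ?Z \<omega>) =
     ?E (\<lambda>\<omega>. (D \<omega> + D' \<omega>) * ?Z \<omega> + (P \<omega> + P' \<omega>) * dprod a Zs \<omega>)" .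
qed

lemma stein_pair_cmult:
  assumes "stein_pair a P D"
  shows "stein_pair a (\<lambda>\<omega>. c * P \<omega>) (\<lambda>\<omega>. c * D \<omega>)"
  unfolding stein_pair_def
proof (intro conjI allI impI)
  fix Zs assume Zs: "set Zs \<subseteq> V"
  let ?E = expectation
  let ?Z = "\<lambda>\<omega>. \<Prod>Z\<leftarrow>Zs. Z \<omega>"
  have "?E (\<lambda>\<omega>. a \<omega> * (c * P \<omega>) * ?Z \<omega>) = c * ?E (\<lambda>\<omega>. a \<omega> * P \<omega> * ?Z \<omega>)"
    by (subst Bochner_Integration.integral_mult_right_zero[symmetric]) (simp add: mult_ac)
  also have "\<dots> = c * ?E (\<lambda>\<omega>. D \<omega> * ?Z \<omega> + P \<omega> * dprod a Zs \<omega>)"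
    using assms Zs unfolding stein_pair_def by simp
  also have "\<dots> = ?E (\<lambda>\<omega>. c * D \<omega> * ?Z \<omega> + c * P \<omega> * dprod a Zs \<omega>)"
    by (subst Bochner_Integration.integral_mult_right_zero[symmetric]) (simp add: algebra_simps)
  finally show "?E (\<lambda>\<omega>. a \<omega> * (c * P \<omega>) * ?Z \<omega>) = ?E (\<lambda>\<omega>. c * D \<omega> * ?Z \<omega> + c * P \<omega> * dprod a Zs \<omega>)" .
qed (use assms in \<open>auto simp: stein_pair_def intro!: all_moments_cmult\<close>)

lemma stein_pair_sum:
  assumes "a \<in> V" "\<And>i. i \<in> I \<Longrightarrow> stein_pair a (P i) (D i)"
  shows "stein_pair a (\<lambda>\<omega>. \<Sum>i\<in>I. P i \<omega>) (\<lambda>\<omega>. \<Sum>i\<in>I. D i \<omega>)"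
  using assms(2)
  by (induction I rule: infinite_finite_induct) (auto intro!: stein_pair_const stein_pair_add assms(1))

definition quad_dev :: "'i set \<Rightarrow> ('i \<Rightarrow> 'w \<Rightarrow> real) \<Rightarrow> 'w \<Rightarrow> real" where
  "quad_dev I X \<omega> = quad_form I X \<omega> - expectation (quad_form I X)"

definition cross_moment :: "('i \<Rightarrow> 'w \<Rightarrow> real) \<Rightarrow> 'i \<Rightarrow> 'i \<Rightarrow> real" where
  "cross_moment X i j = expectation (\<lambda>\<omega>. X i \<omega> * X j \<omega>)"

context
  fixes I :: "'i set" and X :: "'i \<Rightarrow> 'w \<Rightarrow> real"
  assumes fin: "finite I" and X: "\<And>i. i \<in> I \<Longrightarrow> X i \<in> V"
begin

lemma all_moments_quad_form: "all_moments M (quad_form I X)"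
  unfolding quad_form_def[abs_def] using X moments by (auto intro!: all_moments_intros)

lemma all_moments_quad_dev: "all_moments M (quad_dev I X)"
  unfolding quad_dev_def[abs_def] by (intro all_moments_intros all_moments_quad_form)

text \<open>The chain rule for powers of the centred form. Power k + 1 is rebuilt as the sum of
  \<open>quad_dev I X \<omega> ^ k * X i \<omega> * X i \<omega>\<close> minus the mean times the
  k-th power, so that the product rule for single variables suffices.\<close>

lemma stein_pair_quad_dev_power:
  assumes a: "a \<in> V"
  shows "stein_pair a (\<lambda>\<omega>. quad_dev I X \<omega> ^ k)
    (\<lambda>\<omega>. \<Sum>i\<in>I. 2 * real k * expectation (\<lambda>\<omega>. a \<omega> * X i \<omega>) * (quad_dev I X \<omega> ^ (k - 1) * X i \<omega>))"
proof (induction k)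
  case 0
  show ?case using stein_pair_const[OF a, of 1] by simp
next
  case (Suc k)
  define c where "c i = expectation (\<lambda>\<omega>. a \<omega> * X i \<omega>)" for i
  define e where "e = expectation (quad_form I X)"
  define D where "D \<omega> = (\<Sum>i\<in>I. 2 * real k * c i * (quad_dev I X \<omega> ^ (k - 1) * X i \<omega>))" for \<omega>
  have IH: "stein_pair a (\<lambda>\<omega>. quad_dev I X \<omega> ^ k) D"
    using Suc unfolding D_def[abs_def] c_def .
  have "stein_pair a (\<lambda>\<omega>. (\<Sum>i\<in>I. quad_dev I X \<omega> ^ k * X i \<omega> * X i \<omega>) + (- e) * quad_dev I X \<omega> ^ k)
     (\<lambda>\<omega>. (\<Sum>i\<in>I. (D \<omega> * X i \<omega> + quad_dev I X \<omega> ^ k * c i) * X i \<omega> + quad_dev I X \<omega> ^ k * X i \<omega> * c i) + (- e) * D \<omega>)"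
    unfolding c_def by (intro stein_pair_add stein_pair_sum stein_pair_mult stein_pair_cmult IH a X)
  moreover have "(\<Sum>i\<in>I. quad_dev I X \<omega> ^ k * X i \<omega> * X i \<omega>) + (- e) * quad_dev I X \<omega> ^ k = quad_dev I X \<omega> ^ Suc k" for \<omega>
  proof -
    have "(\<Sum>i\<in>I. quad_dev I X \<omega> ^ k * X i \<omega> * X i \<omega>) = quad_dev I X \<omega> ^ k * quad_form I X \<omega>"
      by (simp only: quad_form_def sum_distrib_left power2_eq_square mult.assoc)
    thus ?thesis by (simp add: quad_dev_def e_def algebra_simps)
  qed
  moreover have "(\<Sum>i\<in>I. (D \<omega> * X i \<omega> + quad_dev I X \<omega> ^ k * c i) * X i \<omega> + quad_dev I X \<omega> ^ k * X i \<omega> * c i) + (- e) * D \<omega>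
     = (\<Sum>i\<in>I. 2 * real (Suc k) * c i * (quad_dev I X \<omega> ^ (Suc k - 1) * X i \<omega>))" for \<omega>
  proof -
    have "(\<Sum>i\<in>I. (D \<omega> * X i \<omega> + quad_dev I X \<omega> ^ k * c i) * X i \<omega> + quad_dev I X \<omega> ^ k * X i \<omega> * c i) + (- e) * D \<omega>
      = D \<omega> * quad_dev I X \<omega> + (\<Sum>i\<in>I. 2 * c i * (quad_dev I X \<omega> ^ k * X i \<omega>))"
    proof -
      have "(\<Sum>i\<in>I. (D \<omega> * X i \<omega> + quad_dev I X \<omega> ^ k * c i) * X i \<omega> + quad_dev I X \<omega> ^ k * X i \<omega> * c i) =
        D \<omega> * quad_form I X \<omega> + (\<Sum>i\<in>I. 2 * c i * (quad_dev I X \<omega> ^ k * X i \<omega>))"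
        by (simp add: quad_form_def sum_distrib_left power2_eq_square sum.distrib[symmetric] algebra_simps)
      thus ?thesis by (simp add: quad_dev_def e_def algebra_simps)
    qed
    \<comment> \<open>The case split is for the truncated exponent \<open>k - 1\<close>: for k = 0
      the factor \<open>real k\<close> makes both sides zero.\<close>
    also have "D \<omega> * quad_dev I X \<omega> = (\<Sum>i\<in>I. 2 * real k * c i * (quad_dev I X \<omega> ^ k * X i \<omega>))"
      by (cases k) (simp_all add: D_def sum_distrib_left sum_distrib_right mult_ac)
    finally show ?thesis by (simp add: sum.distrib[symmetric] algebra_simps)
  qed
  ultimately show ?case unfolding c_def[symmetric] by simp
qed

text \<open>Integration by parts in one factor of each square, with the other factor as test
  monomial. It yields the form weighted by the covariances plus \<open>cross_moment X i i\<close>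
  times the k-th moment; these diagonal terms sum to the mean of the form and cancel against the
  centring.\<close>

lemma expectation_quad_dev_power_Suc:
  "expectation (\<lambda>\<omega>. quad_dev I X \<omega> ^ Suc k) =
    2 * real k * expectation (\<lambda>\<omega>. (\<Sum>i\<in>I. \<Sum>j\<in>I. cross_moment X i j * (X i \<omega> * X j \<omega>)) * quad_dev I X \<omega> ^ (k - 1))"
proof -
  let ?E = expectation
  note mm = all_moments_quad_dev all_moments_quad_form moments[OF X]
  have 1: "?E (\<lambda>\<omega>. X i \<omega> * quad_dev I X \<omega> ^ k * X i \<omega>) =
     ?E (\<lambda>\<omega>. 2 * real k * (\<Sum>j\<in>I. cross_moment X i j * (X i \<omega> * X j \<omega>)) * quad_dev I X \<omega> ^ (k - 1)) + cross_moment X i i * ?E (\<lambda>\<omega>. quad_dev I X \<omega> ^ k)"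
    if i: "i \<in> I" for i
  proof -
    have "?E (\<lambda>\<omega>. X i \<omega> * quad_dev I X \<omega> ^ k * (\<Prod>Z\<leftarrow>[X i]. Z \<omega>)) =
       ?E (\<lambda>\<omega>. (\<Sum>j\<in>I. 2 * real k * expectation (\<lambda>\<omega>. X i \<omega> * X j \<omega>) * (quad_dev I X \<omega> ^ (k - 1) * X j \<omega>)) * (\<Prod>Z\<leftarrow>[X i]. Z \<omega>)
          + quad_dev I X \<omega> ^ k * dprod (X i) [X i] \<omega>)"
      using i by (intro stein_pair_quad_dev_power[OF X[OF i], of k, unfolded stein_pair_def, THEN conjunct2, THEN conjunct2, rule_format]) (auto intro: X)
    also have "\<dots> = ?E (\<lambda>\<omega>. 2 * real k * (\<Sum>j\<in>I. cross_moment X i j * (X i \<omega> * X j \<omega>)) * quad_dev I X \<omega> ^ (k - 1) + cross_moment X i i * quad_dev I X \<omega> ^ k)"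
      by (intro Bochner_Integration.integral_cong refl) (simp add: cross_moment_def sum_distrib_left sum_distrib_right mult_ac)
    also have "\<dots> = ?E (\<lambda>\<omega>. 2 * real k * (\<Sum>j\<in>I. cross_moment X i j * (X i \<omega> * X j \<omega>)) * quad_dev I X \<omega> ^ (k - 1)) + ?E (\<lambda>\<omega>. cross_moment X i i * quad_dev I X \<omega> ^ k)"
      using i by (intro Bochner_Integration.integral_add all_moments_integrable all_moments_intros mm)
    finally show ?thesis by simp
  qed
  have e: "?E (quad_form I X) = (\<Sum>i\<in>I. cross_moment X i i)"
    unfolding quad_form_def[abs_def] cross_moment_def power2_eq_square
    by (intro Bochner_Integration.integral_sum all_moments_integrable all_moments_intros mm)
  have "?E (\<lambda>\<omega>. quad_dev I X \<omega> ^ Suc k) = ?E (\<lambda>\<omega>. (\<Sum>i\<in>I. X i \<omega> * quad_dev I X \<omega> ^ k * X i \<omega>) - ?E (quad_form I X) * quad_dev I X \<omega> ^ k)"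
  proof (intro Bochner_Integration.integral_cong refl)
    fix \<omega>
    have "(\<Sum>i\<in>I. X i \<omega> * quad_dev I X \<omega> ^ k * X i \<omega>) = quad_form I X \<omega> * quad_dev I X \<omega> ^ k"
      by (simp only: quad_form_def sum_distrib_right power2_eq_square) (simp add: mult_ac)
    thus "quad_dev I X \<omega> ^ Suc k = (\<Sum>i\<in>I. X i \<omega> * quad_dev I X \<omega> ^ k * X i \<omega>) - ?E (quad_form I X) * quad_dev I X \<omega> ^ k"
      by (simp add: quad_dev_def algebra_simps)
  qed
  also have "\<dots> = (\<Sum>i\<in>I. ?E (\<lambda>\<omega>. X i \<omega> * quad_dev I X \<omega> ^ k * X i \<omega>)) - ?E (quad_form I X) * ?E (\<lambda>\<omega>. quad_dev I X \<omega> ^ k)"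
    by (subst Bochner_Integration.integral_diff, (intro all_moments_integrable all_moments_intros mm; assumption?)+,
        subst Bochner_Integration.integral_sum, (intro all_moments_integrable all_moments_intros mm; assumption?)+, simp)
  also have "\<dots> = (\<Sum>i\<in>I. ?E (\<lambda>\<omega>. 2 * real k * (\<Sum>j\<in>I. cross_moment X i j * (X i \<omega> * X j \<omega>)) * quad_dev I X \<omega> ^ (k - 1)))"
    by (simp add: 1 sum.distrib e sum_distrib_right)
  also have "\<dots> = ?E (\<lambda>\<omega>. \<Sum>i\<in>I. 2 * real k * (\<Sum>j\<in>I. cross_moment X i j * (X i \<omega> * X j \<omega>)) * quad_dev I X \<omega> ^ (k - 1))"
    by (rule Bochner_Integration.integral_sum[symmetric], intro all_moments_integrable all_moments_intros mm)
  also have "\<dots> = ?E (\<lambda>\<omega>. 2 * real k * ((\<Sum>i\<in>I. \<Sum>j\<in>I. cross_moment X i j * (X i \<omega> * X j \<omega>)) * quad_dev I X \<omega> ^ (k - 1)))"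
    by (intro Bochner_Integration.integral_cong refl) (simp add: sum_distrib_left sum_distrib_right mult_ac)
  finally show ?thesis by simp
qed

text \<open>Schur's test: each product is split by the arithmetic-geometric mean inequality, and
  symmetry of the covariances turns column sums into row sums.\<close>

lemma cov_form_le:
  assumes \<rho>: "\<And>i. i \<in> I \<Longrightarrow> (\<Sum>j\<in>I. \<bar>cross_moment X i j\<bar>) \<le> \<rho>"
  shows "(\<Sum>i\<in>I. \<Sum>j\<in>I. cross_moment X i j * (X i \<omega> * X j \<omega>)) \<le> \<rho> * quad_form I X \<omega>"
proof -
  have "cross_moment X i j * (X i \<omega> * X j \<omega>) \<le> \<bar>cross_moment X i j\<bar> * (X i \<omega>)\<^sup>2 / 2 + \<bar>cross_moment X j i\<bar> * (X j \<omega>)\<^sup>2 / 2" for i j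
  proof -
    have "cross_moment X i j * (X i \<omega> * X j \<omega>) \<le> \<bar>cross_moment X i j\<bar> * \<bar>X i \<omega> * X j \<omega>\<bar>"
      by (metis abs_ge_self abs_mult)
    also have "\<dots> \<le> \<bar>cross_moment X i j\<bar> * (((X i \<omega>)\<^sup>2 + (X j \<omega>)\<^sup>2) / 2)"
    proof (intro mult_left_mono)
      show "\<bar>X i \<omega> * X j \<omega>\<bar> \<le> ((X i \<omega>)\<^sup>2 + (X j \<omega>)\<^sup>2) / 2"
        using sum_squares_bound[of "\<bar>X i \<omega>\<bar>" "\<bar>X j \<omega>\<bar>"] by (simp add: abs_mult mult.assoc)
    qed simp
    also have "\<dots> = \<bar>cross_moment X i j\<bar> * (X i \<omega>)\<^sup>2 / 2 + \<bar>cross_moment X i j\<bar> * (X j \<omega>)\<^sup>2 / 2"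
      by (simp add: algebra_simps add_divide_distrib)
    also have "cross_moment X i j = cross_moment X j i"
      unfolding cross_moment_def by (simp only: mult.commute)
    finally show ?thesis
      by (simp only: \<open>cross_moment X i j = cross_moment X j i\<close>)
  qed
  hence "(\<Sum>i\<in>I. \<Sum>j\<in>I. cross_moment X i j * (X i \<omega> * X j \<omega>)) \<le>
     (\<Sum>i\<in>I. \<Sum>j\<in>I. \<bar>cross_moment X i j\<bar> * (X i \<omega>)\<^sup>2 / 2 + \<bar>cross_moment X j i\<bar> * (X j \<omega>)\<^sup>2 / 2)"
    by (intro sum_mono)
  also have "\<dots> = (\<Sum>i\<in>I. \<Sum>j\<in>I. \<bar>cross_moment X i j\<bar> * (X i \<omega>)\<^sup>2 / 2) + (\<Sum>i\<in>I. \<Sum>j\<in>I. \<bar>cross_moment X j i\<bar> * (X j \<omega>)\<^sup>2 / 2)"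
    by (simp add: sum.distrib)
  also have "(\<Sum>i\<in>I. \<Sum>j\<in>I. \<bar>cross_moment X j i\<bar> * (X j \<omega>)\<^sup>2 / 2) = (\<Sum>i\<in>I. \<Sum>j\<in>I. \<bar>cross_moment X i j\<bar> * (X i \<omega>)\<^sup>2 / 2)"
    by (rule sum.swap)
  also have "(\<Sum>i\<in>I. \<Sum>j\<in>I. \<bar>cross_moment X i j\<bar> * (X i \<omega>)\<^sup>2 / 2) + (\<Sum>i\<in>I. \<Sum>j\<in>I. \<bar>cross_moment X i j\<bar> * (X i \<omega>)\<^sup>2 / 2) =
    (\<Sum>i\<in>I. (\<Sum>j\<in>I. \<bar>cross_moment X i j\<bar>) * (X i \<omega>)\<^sup>2)"
    by (simp add: sum_distrib_right sum.distrib[symmetric])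
  also have "\<dots> \<le> (\<Sum>i\<in>I. \<rho> * (X i \<omega>)\<^sup>2)"
    by (intro sum_mono mult_right_mono \<rho>) auto
  finally show ?thesis by (simp add: quad_form_def sum_distrib_left)
qed

text \<open>The odd moment in the recursion is absorbed by the two neighbouring even ones through
  \<open>x ^ (2 * p + 1) \<le> x ^ (2 * p + 2) / (2 * A) + A * x ^ (2 * p) / 2\<close>.\<close>

lemma quad_dev_moment_step:
  assumes \<rho>: "\<And>i. i \<in> I \<Longrightarrow> (\<Sum>j\<in>I. \<bar>cross_moment X i j\<bar>) \<le> \<rho>" and "\<rho> > 0"
    and \<tau>: "expectation (quad_form I X) \<le> \<tau>"
  shows "expectation (\<lambda>\<omega>. quad_dev I X \<omega> ^ (2 * Suc p)) \<le>
    16 * real (Suc p) ^ 2 * \<rho> * (\<rho> + \<tau>) * expectation (\<lambda>\<omega>. quad_dev I X \<omega> ^ (2 * p))"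
proof -
  let ?E = expectation
  define q where "q = real (2 * p + 1)"
  have q: "q > 0" by (simp add: q_def)
  note mm = all_moments_quad_dev all_moments_quad_form moments[OF X]
  \<comment> \<open>With this value the coefficient \<open>2 * q * (\<rho> / (2 * A))\<close> of the
    higher moment is 1/2, so that moment moves to the left-hand side at the cost of a factor
    2.\<close>
  define A where "A = 2 * q * \<rho>"
  have A: "A > 0" using q \<open>\<rho> > 0\<close> by (simp add: A_def)
  have pw: "0 \<le> x ^ (2 * p)" for x :: real by simp
  have pt: "(\<Sum>i\<in>I. \<Sum>j\<in>I. cross_moment X i j * (X i \<omega> * X j \<omega>)) * quad_dev I X \<omega> ^ (2 * p) \<le>
       \<rho> / (2 * A) * quad_dev I X \<omega> ^ (2 * Suc p) + \<rho> * (A / 2 + \<tau>) * quad_dev I X \<omega> ^ (2 * p)" for \<omega>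
  proof -
    have "(\<Sum>i\<in>I. \<Sum>j\<in>I. cross_moment X i j * (X i \<omega> * X j \<omega>)) * quad_dev I X \<omega> ^ (2 * p) \<le> \<rho> * quad_form I X \<omega> * quad_dev I X \<omega> ^ (2 * p)"
      by (intro mult_right_mono cov_form_le \<rho> pw)
    also have "\<rho> * quad_form I X \<omega> \<le> \<rho> * ((quad_dev I X \<omega>)\<^sup>2 / (2 * A) + A / 2 + \<tau>)"
    proof (intro mult_left_mono)
      have "2 * (quad_dev I X \<omega> * A) \<le> (quad_dev I X \<omega>)\<^sup>2 + A\<^sup>2"
        using sum_squares_bound[of "quad_dev I X \<omega>" A] by simp
      hence "quad_dev I X \<omega> \<le> (quad_dev I X \<omega>)\<^sup>2 / (2 * A) + A / 2"
        using A by (simp add: field_simps power2_eq_square)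
      thus "quad_form I X \<omega> \<le> (quad_dev I X \<omega>)\<^sup>2 / (2 * A) + A / 2 + \<tau>"
        using \<tau> by (simp add: quad_dev_def)
    qed (use \<open>\<rho> > 0\<close> in auto)
    hence "\<rho> * quad_form I X \<omega> * quad_dev I X \<omega> ^ (2 * p) \<le> \<rho> * ((quad_dev I X \<omega>)\<^sup>2 / (2 * A) + A / 2 + \<tau>) * quad_dev I X \<omega> ^ (2 * p)"
      by (intro mult_right_mono pw)
    also have "\<dots> = \<rho> / (2 * A) * quad_dev I X \<omega> ^ (2 * Suc p) + \<rho> * (A / 2 + \<tau>) * quad_dev I X \<omega> ^ (2 * p)"
      by (simp add: field_simps power2_eq_square)
    finally show ?thesis by simp
  qed
  have "?E (\<lambda>\<omega>. quad_dev I X \<omega> ^ (2 * Suc p)) =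
     2 * q * ?E (\<lambda>\<omega>. (\<Sum>i\<in>I. \<Sum>j\<in>I. cross_moment X i j * (X i \<omega> * X j \<omega>)) * quad_dev I X \<omega> ^ (2 * p))"
    using expectation_quad_dev_power_Suc[of "2 * p + 1"] by (simp add: q_def)
  also have "\<dots> \<le> 2 * q * ?E (\<lambda>\<omega>. \<rho> / (2 * A) * quad_dev I X \<omega> ^ (2 * Suc p) + \<rho> * (A / 2 + \<tau>) * quad_dev I X \<omega> ^ (2 * p))"
    using q pt by (intro mult_left_mono integral_mono all_moments_integrable all_moments_intros mm) auto
  also have "?E (\<lambda>\<omega>. \<rho> / (2 * A) * quad_dev I X \<omega> ^ (2 * Suc p) + \<rho> * (A / 2 + \<tau>) * quad_dev I X \<omega> ^ (2 * p)) =
     \<rho> / (2 * A) * ?E (\<lambda>\<omega>. quad_dev I X \<omega> ^ (2 * Suc p)) + \<rho> * (A / 2 + \<tau>) * ?E (\<lambda>\<omega>. quad_dev I X \<omega> ^ (2 * p))"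
    by (subst Bochner_Integration.integral_add, (intro all_moments_integrable all_moments_intros mm)+) simp
  finally have "?E (\<lambda>\<omega>. quad_dev I X \<omega> ^ (2 * Suc p)) \<le> 1/2 * ?E (\<lambda>\<omega>. quad_dev I X \<omega> ^ (2 * Suc p)) +
     2 * q * (\<rho> * (q * \<rho> + \<tau>) * ?E (\<lambda>\<omega>. quad_dev I X \<omega> ^ (2 * p)))"
  proof -
    have "2 * q * (\<rho> / (2 * A)) = 1 / 2" "A / 2 = q * \<rho>"
      using q \<open>\<rho> > 0\<close> by (simp_all add: A_def)
    moreover assume "?E (\<lambda>\<omega>. quad_dev I X \<omega> ^ (2 * Suc p)) \<le> 2 * q * (\<rho> / (2 * A) * ?E (\<lambda>\<omega>. quad_dev I X \<omega> ^ (2 * Suc p)) +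
       \<rho> * (A / 2 + \<tau>) * ?E (\<lambda>\<omega>. quad_dev I X \<omega> ^ (2 * p)))"
    ultimately show ?thesis by (simp only: distrib_left mult.assoc[symmetric])
  qed
  hence 1: "?E (\<lambda>\<omega>. quad_dev I X \<omega> ^ (2 * Suc p)) \<le> 4 * q * \<rho> * (q * \<rho> + \<tau>) * ?E (\<lambda>\<omega>. quad_dev I X \<omega> ^ (2 * p))"
    by simp
  have "\<tau> \<ge> 0" using \<tau> by (rule order_trans[rotated]) (simp add: quad_form_def sum_nonneg)
  have q1: "q \<ge> 1" "q \<le> 2 * real (Suc p)" by (auto simp: q_def)
  have "4 * q * \<rho> * (q * \<rho> + \<tau>) \<le> 4 * q * \<rho> * (q * (\<rho> + \<tau>))"
    using q1 \<open>\<tau> \<ge> 0\<close> \<open>\<rho> > 0\<close> by (intro mult_left_mono) (auto simp: algebra_simps intro: mult_left_mono[of 1 q \<tau>, simplified])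
  also have "\<dots> = 4 * q\<^sup>2 * \<rho> * (\<rho> + \<tau>)" by (simp add: power2_eq_square)
  also have "\<dots> \<le> 4 * (2 * real (Suc p))\<^sup>2 * \<rho> * (\<rho> + \<tau>)"
    using q1 \<open>\<tau> \<ge> 0\<close> \<open>\<rho> > 0\<close> by (intro mult_right_mono mult_left_mono power_mono) auto
  finally have "4 * q * \<rho> * (q * \<rho> + \<tau>) \<le> 16 * real (Suc p) ^ 2 * \<rho> * (\<rho> + \<tau>)"
    by (simp add: power2_eq_square algebra_simps)
  hence "4 * q * \<rho> * (q * \<rho> + \<tau>) * ?E (\<lambda>\<omega>. quad_dev I X \<omega> ^ (2 * p)) \<le>
     16 * real (Suc p) ^ 2 * \<rho> * (\<rho> + \<tau>) * ?E (\<lambda>\<omega>. quad_dev I X \<omega> ^ (2 * p))"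
    by (intro mult_right_mono Bochner_Integration.integral_nonneg pw)
  with 1 show ?thesis by linarith
qed

text \<open>Iterates the step from the zeroth moment; the factor \<open>real (Suc k) ^ 2\<close> of
  each step is replaced by \<open>real p ^ 2\<close>, so that the product is a p-th power.\<close>

lemma quad_dev_moment_bound:
  assumes \<rho>: "\<And>i. i \<in> I \<Longrightarrow> (\<Sum>j\<in>I. \<bar>cross_moment X i j\<bar>) \<le> \<rho>" and "\<rho> > 0"
    and \<tau>: "expectation (quad_form I X) \<le> \<tau>"
  shows "expectation (\<lambda>\<omega>. quad_dev I X \<omega> ^ (2 * p)) \<le> (16 * real p ^ 2 * \<rho> * (\<rho> + \<tau>)) ^ p"
proof -
  have "\<tau> \<ge> 0" using \<tau> by (rule order_trans[rotated]) (simp add: quad_form_def sum_nonneg)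
  have "expectation (\<lambda>\<omega>. quad_dev I X \<omega> ^ (2 * k)) \<le> (16 * real p ^ 2 * \<rho> * (\<rho> + \<tau>)) ^ k" if "k \<le> p" for k
    using that
  proof (induction k)
    case 0 thus ?case by (simp add: prob_space)
  next
    case (Suc k)
    have "expectation (\<lambda>\<omega>. quad_dev I X \<omega> ^ (2 * Suc k)) \<le>
      16 * real (Suc k) ^ 2 * \<rho> * (\<rho> + \<tau>) * expectation (\<lambda>\<omega>. quad_dev I X \<omega> ^ (2 * k))"
      by (rule quad_dev_moment_step[OF assms])
    also have "\<dots> \<le> 16 * real p ^ 2 * \<rho> * (\<rho> + \<tau>) * expectation (\<lambda>\<omega>. quad_dev I X \<omega> ^ (2 * k))"
      using \<open>\<rho> > 0\<close> \<open>\<tau> \<ge> 0\<close> Suc.prems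
      by (intro mult_right_mono mult_left_mono power_mono Bochner_Integration.integral_nonneg) auto
    also have "\<dots> \<le> 16 * real p ^ 2 * \<rho> * (\<rho> + \<tau>) * (16 * real p ^ 2 * \<rho> * (\<rho> + \<tau>)) ^ k"
      using \<open>\<rho> > 0\<close> \<open>\<tau> \<ge> 0\<close> Suc by (intro mult_left_mono) auto
    finally show ?case by simp
  qed
  thus ?thesis by simp
qed

end

end

section \<open>Almost sure convergence from summable means\<close>

text \<open>Summing under the integral shows that the series of all \<open>F n\<close> is almost
  surely finite, hence its terms tend to 0. This serves in place of Markov's inequality combined
  with the Borel-Cantelli lemma.\<close>

lemma AE_tendsto_zero_if_summable_integral:
  fixes F :: "nat \<Rightarrow> 'w \<Rightarrow> real"
  assumes int: "\<And>n. integrable M (F n)" and nn: "\<And>n \<omega>. F n \<omega> \<ge> 0"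
    and le: "\<forall>\<^sub>F n in sequentially. (LINT \<omega>|M. F n \<omega>) \<le> e n" and sm: "summable e"
  shows "AE \<omega> in M. (\<lambda>n. F n \<omega>) \<longlonglongrightarrow> 0"
proof -
  have [measurable]: "F n \<in> borel_measurable M" for n using int by auto
  have "summable (\<lambda>n. LINT \<omega>|M. F n \<omega>)"
  proof (rule summable_comparison_test_ev[OF _ sm])
    show "\<forall>\<^sub>F n in sequentially. norm (LINT \<omega>|M. F n \<omega>) \<le> e n"
      using le by eventually_elim (simp add: nn)
  qed
  moreover have "(\<integral>\<^sup>+\<omega>. (\<Sum>n. ennreal (F n \<omega>)) \<partial>M) = (\<Sum>n. ennreal (LINT \<omega>|M. F n \<omega>))"
    by (subst nn_integral_suminf) (auto simp: nn_integral_eq_integral int nn)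
  ultimately have "(\<integral>\<^sup>+\<omega>. (\<Sum>n. ennreal (F n \<omega>)) \<partial>M) \<noteq> \<infinity>"
    by (simp add: nn ennreal_suminf_neq_top)
  hence "AE \<omega> in M. (\<Sum>n. ennreal (F n \<omega>)) \<noteq> \<infinity>"
    by (intro nn_integral_noteq_infinite) auto
  thus ?thesis
  proof eventually_elim
    case (elim \<omega>)
    hence "summable (\<lambda>n. F n \<omega>)" using nn by (intro summable_suminf_not_top) auto
    thus ?case by (rule summable_LIMSEQ_zero)
  qed
qed

section \<open>Gaussian variables and the linear span of the field\<close>

text \<open>A degenerate variable of mean zero vanishes almost surely, so its moments are
  \<open>0 ^ k\<close> and both sides of the recursion are 0. In the normal case the odd moments
  vanish, and the recursion is the ratio of consecutive even moments
  \<open>fact (2 * j) / ((2 / \<sigma>\<^sup>2) ^ j * fact j)\<close>.\<close>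

lemma (in prob_space) gaussian_rv_moments:
  assumes "gaussian_rv M X" "expectation X = 0"
  shows "all_moments M X"
    and "expectation (\<lambda>\<omega>. X \<omega> ^ (k + 2)) =
          real (k + 1) * expectation (\<lambda>\<omega>. X \<omega> ^ 2) * expectation (\<lambda>\<omega>. X \<omega> ^ k)"
proof -
  have [measurable]: "X \<in> borel_measurable M" using assms by (simp add: gaussian_rv_def)
  have "all_moments M X \<and> (\<forall>k. expectation (\<lambda>\<omega>. X \<omega> ^ (k + 2)) =
          real (k + 1) * expectation (\<lambda>\<omega>. X \<omega> ^ 2) * expectation (\<lambda>\<omega>. X \<omega> ^ k))"
    using assms(1) unfolding gaussian_rv_def
  proof (elim conjE disjE exE)
    fix \<mu> assume AE: "AE \<omega> in M. X \<omega> = \<mu>"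
    have "expectation X = expectation (\<lambda>_. \<mu>)" by (rule integral_cong_AE) (use AE in auto)
    hence "\<mu> = 0" using assms(2) by (simp add: prob_space)
    hence X0: "AE \<omega> in M. X \<omega> = 0" using AE by simp
    have AEk: "AE \<omega> in M. X \<omega> ^ k = 0 ^ k" for k :: nat using X0 by eventually_elim simp
    have "integrable M (\<lambda>\<omega>. X \<omega> ^ k)" for k
      by (subst integrable_cong_AE[OF _ _ AEk]) auto
    moreover have "expectation (\<lambda>\<omega>. X \<omega> ^ k) = 0 ^ k" for k
      by (subst integral_cong_AE[OF _ _ AEk]) (auto simp: prob_space)
    moreover from calculation(2)[of "k + 2" for k] have "expectation (\<lambda>\<omega>. X \<omega> ^ (k + 2)) = 0" for k
      by simp
    ultimately show ?thesis by (simp add: all_moments_def del: power_Suc add_2_eq_Suc')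
  next
    fix \<mu> \<sigma> :: real assume \<sigma>: "\<sigma> > 0" and D: "distributed M lborel X (normal_density \<mu> \<sigma>)"
    have "\<mu> = 0" using normal_distributed_expectation[OF \<sigma> D] assms(2) by simp
    note D = D[unfolded this]
    have "integrable M (\<lambda>\<omega>. X \<omega> ^ k)" for k
      using distributed_integrable[OF D, of "\<lambda>x. x ^ k"] integrable_normal_moment[OF \<sigma>, of 0 k] by simp
    moreover have ev: "expectation (\<lambda>\<omega>. X \<omega> ^ (2 * k)) = fact (2 * k) / ((2 / \<sigma>\<^sup>2) ^ k * fact k)" for k
      using distributed_integral[OF D, of "\<lambda>x. x ^ (2 * k)"] integral_normal_moment_even[OF \<sigma>, of 0 k] by simp
    moreover have od: "expectation (\<lambda>\<omega>. X \<omega> ^ (2 * k + 1)) = 0" for k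
      using distributed_integral[OF D, of "\<lambda>x. x ^ (2 * k + 1)"] integral_normal_moment_odd[OF \<sigma>, of 0 k] by simp
    have v: "expectation (\<lambda>\<omega>. X \<omega> ^ 2) = \<sigma>\<^sup>2"
      using ev[of 1] by (simp add: power2_eq_square field_simps)
    have "expectation (\<lambda>\<omega>. X \<omega> ^ (k + 2)) =
          real (k + 1) * expectation (\<lambda>\<omega>. X \<omega> ^ 2) * expectation (\<lambda>\<omega>. X \<omega> ^ k)" for k
    proof (cases "even k")
      case True
      then obtain j where j: "k = 2 * j" by (auto elim: evenE)
      have f: "fact (2 * j + 2) = (2 * real j + 2) * (2 * real j + 1) * fact (2 * j)"
        by (simp add: algebra_simps)
      have "expectation (\<lambda>\<omega>. X \<omega> ^ (2 * j + 2)) = expectation (\<lambda>\<omega>. X \<omega> ^ (2 * (j + 1)))"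
        by (simp only: distrib_left mult_1_right)
      also have "\<dots> = fact (2 * j + 2) / ((2 / \<sigma>\<^sup>2) ^ (j + 1) * fact (j + 1))"
        by (subst ev) simp
      also have "\<dots> = (2 * real j + 1) * \<sigma>\<^sup>2 * (fact (2 * j) / ((2 / \<sigma>\<^sup>2) ^ j * fact j))"
      proof -
        have "(2 * real j + 2) * (2 * real j + 1) * F / ((2 / \<sigma>\<^sup>2) ^ (j + 1) * ((real j + 1) * G)) =
           (2 * real j + 1) * \<sigma>\<^sup>2 * (F / ((2 / \<sigma>\<^sup>2) ^ j * G))" if "G > 0" for F G :: real
          using \<sigma> that by (simp add: divide_simps)
        from this[of "fact j" "fact (2 * j)"] show ?thesis unfolding f by (simp add: algebra_simps)
      qed
      finally have e2: "expectation (\<lambda>\<omega>. X \<omega> ^ (2 * j + 2)) =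
        (2 * real j + 1) * \<sigma>\<^sup>2 * (fact (2 * j) / ((2 / \<sigma>\<^sup>2) ^ j * fact j))" .
      show ?thesis by (simp only: j v ev e2) simp
    next
      case False
      then obtain j where j: "k = 2 * j + 1" by (auto elim: oddE)
      show ?thesis using od[of j] od[of "j + 1"] unfolding j by simp
    qed
    ultimately show ?thesis by (simp add: all_moments_def)
  qed
  thus "all_moments M X" "expectation (\<lambda>\<omega>. X \<omega> ^ (k + 2)) =
          real (k + 1) * expectation (\<lambda>\<omega>. X \<omega> ^ 2) * expectation (\<lambda>\<omega>. X \<omega> ^ k)" by auto
qed

definition field_span :: "('i \<Rightarrow> 'w \<Rightarrow> real) \<Rightarrow> ('w \<Rightarrow> real) set" where
  "field_span Z = {\<lambda>\<omega>. \<Sum>t\<in>I. c t * Z t \<omega> | I c. finite I}"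

lemma field_span_base: "Z t \<in> field_span Z"
  unfolding field_span_def by (rule CollectI, rule exI[of _ "{t}"], rule exI[of _ "\<lambda>_. 1"]) auto

lemma field_span_line:
  assumes "X \<in> field_span Z" "Y \<in> field_span Z"
  shows "(\<lambda>\<omega>. X \<omega> + s * Y \<omega>) \<in> field_span Z"
proof -
  obtain I c J d where I: "finite I" "X = (\<lambda>\<omega>. \<Sum>t\<in>I. c t * Z t \<omega>)"
    and J: "finite J" "Y = (\<lambda>\<omega>. \<Sum>t\<in>J. d t * Z t \<omega>)"
    using assms unfolding field_span_def by blast
  define e where "e t = (if t \<in> I then c t else 0) + s * (if t \<in> J then d t else 0)" for t
  have "X \<omega> + s * Y \<omega> = (\<Sum>t\<in>I\<union>J. e t * Z t \<omega>)" for \<omega>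
  proof -
    have "X \<omega> = (\<Sum>t\<in>I\<union>J. (if t \<in> I then c t else 0) * Z t \<omega>)"
      unfolding I(2) by (rule sum.mono_neutral_cong_left) (use I J in auto)
    moreover have "Y \<omega> = (\<Sum>t\<in>I\<union>J. (if t \<in> J then d t else 0) * Z t \<omega>)"
      unfolding J(2) by (rule sum.mono_neutral_cong_left) (use I J in auto)
    ultimately show ?thesis
      by (simp only: e_def sum_distrib_left sum.distrib[symmetric]) (simp add: algebra_simps)
  qed
  thus ?thesis unfolding field_span_def using I(1) J(1) by blast
qed

lemma gaussian_field_span: "gaussian_field M Z \<Longrightarrow> X \<in> field_span Z \<Longrightarrow> gaussian_rv M X"
  unfolding gaussian_field_def field_span_def by blast

text \<open>Centring selects instead of subtracting: constants need not belong to the span, and the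
  second-order increments lie in this set because their coefficients 1, -2, 1 annihilate the
  constant mean.\<close>

definition centered_span :: "'w measure \<Rightarrow> ('i \<Rightarrow> 'w \<Rightarrow> real) \<Rightarrow> ('w \<Rightarrow> real) set" where
  "centered_span M Z = {X \<in> field_span Z. (LINT \<omega>|M. X \<omega>) = 0}"

text \<open>Variables of the span may have a nonzero mean here; their integrability makes the mean
  additive along lines and so keeps \<open>centered_span\<close> closed.\<close>

lemma (in prob_space) gaussian_field_integrable:
  assumes G: "gaussian_field M Z" and X: "X \<in> field_span Z"
  shows "integrable M (\<lambda>\<omega>. X \<omega>)"
proof -
  have "gaussian_rv M X" using G X by (rule gaussian_field_span)
  hence [measurable]: "X \<in> borel_measurable M" and
    "(\<exists>\<mu>. AE \<omega> in M. X \<omega> = \<mu>) \<or> (\<exists>\<mu> \<sigma>. \<sigma> > 0 \<and> distributed M lborel X (normal_density \<mu> \<sigma>))"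
    by (auto simp: gaussian_rv_def)
  from this(2) show ?thesis
  proof (elim disjE exE conjE)
    fix \<mu> assume "AE \<omega> in M. X \<omega> = \<mu>"
    thus ?thesis by (subst integrable_cong_AE[where g = "\<lambda>_. \<mu>"]) auto
  next
    fix \<mu> \<sigma> :: real assume \<sigma>: "\<sigma> > 0" and D: "distributed M lborel X (normal_density \<mu> \<sigma>)"
    show ?thesis
      using distributed_integrable[OF D, of "\<lambda>x. x"] integrable_normal_moment_nz_1[OF \<sigma>, of \<mu>] by simp
  qed
qed

lemma (in prob_space) gaussian_space_centered_span:
  assumes G: "gaussian_field M Z"
  shows "gaussian_space M (centered_span M Z)"
proof
  fix X Y :: "'a \<Rightarrow> real" and s :: real
  assume XY: "X \<in> centered_span M Z" "Y \<in> centered_span M Z"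
  hence i: "integrable M X" "integrable M Y"
    using gaussian_field_integrable[OF G] by (auto simp: centered_span_def)
  have "(\<lambda>\<omega>. X \<omega> + s * Y \<omega>) \<in> field_span Z"
    using XY by (auto simp: centered_span_def intro: field_span_line)
  thus "(\<lambda>\<omega>. X \<omega> + s * Y \<omega>) \<in> centered_span M Z"
    using XY i by (simp add: centered_span_def)
next
  fix X assume "X \<in> centered_span M Z"
  hence g: "gaussian_rv M X" and e: "expectation X = 0"
    using G unfolding gaussian_field_def field_span_def centered_span_def by auto
  show "all_moments M X" "expectation X = 0" by (rule gaussian_rv_moments[OF g e]) (rule e)
  show "expectation (\<lambda>\<omega>. X \<omega> ^ (k + 2)) =
          real (k + 1) * expectation (\<lambda>\<omega>. X \<omega> ^ 2) * expectation (\<lambda>\<omega>. X \<omega> ^ k)" for k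
    by (rule gaussian_rv_moments[OF g e])
qed

section \<open>Radial covariances\<close>

text \<open>Near 0 the bound is the hypothesis; on the remaining interval, which is compact and away
  from 0, \<open>F t * t powr (-e)\<close> is continuous and hence bounded.\<close>

lemma powr_bound_extend:
  fixes F :: "real \<Rightarrow> real"
  assumes cont: "continuous_on {0<..} F"
    and ev: "\<forall>\<^sub>F t in at_right 0. \<bar>F t\<bar> \<le> c * t powr e"
  shows "\<exists>C>0. \<forall>t\<in>{0<..T}. \<bar>F t\<bar> \<le> C * t powr e"
proof -
  obtain \<delta> where \<delta>: "\<delta> > 0" "\<And>t. 0 < t \<Longrightarrow> t < \<delta> \<Longrightarrow> \<bar>F t\<bar> \<le> c * t powr e"
    using ev unfolding eventually_at_right_field by auto
  have "continuous_on {\<delta>/2..T} (\<lambda>t. F t * t powr (-e))"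
    using \<delta>(1) by (intro continuous_intros continuous_on_subset[OF cont]) auto
  hence "bounded ((\<lambda>t. F t * t powr (-e)) ` {\<delta>/2..T})"
    by (intro compact_imp_bounded compact_continuous_image) auto
  then obtain B where "\<forall>y\<in>(\<lambda>t. F t * t powr (-e)) ` {\<delta>/2..T}. norm y \<le> B"
    unfolding bounded_iff by blast
  hence B: "\<bar>F t * t powr (-e)\<bar> \<le> B" if "t \<in> {\<delta>/2..T}" for t
    using that by auto
  define C where "C = \<bar>c\<bar> + \<bar>B\<bar> + 1"
  have "\<bar>F t\<bar> \<le> C * t powr e" if t: "t \<in> {0<..T}" for t
  proof (cases "t < \<delta>")
    case True
    hence "\<bar>F t\<bar> \<le> c * t powr e" using \<delta> t by auto
    also have "\<dots> \<le> C * t powr e" by (intro mult_right_mono) (auto simp: C_def)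
    finally show ?thesis .
  next
    case False
    hence "\<bar>F t * t powr (-e)\<bar> \<le> B" using t \<delta> by (intro B) auto
    hence "\<bar>F t\<bar> * t powr (-e) \<le> C" by (simp add: abs_mult C_def)
    hence "\<bar>F t\<bar> * t powr (-e) * t powr e \<le> C * t powr e" by (intro mult_right_mono) auto
    thus ?thesis using t by (simp add: mult.assoc powr_add[symmetric])
  qed
  moreover have "C > 0" by (simp add: C_def)
  ultimately show ?thesis by blast
qed

text \<open>Comparison with \<open>C / q * s powr (- q)\<close>, whose derivative has the size of
  the bound on \<open>F'\<close>: adding it to \<open>F\<close> gives a nonincreasing function,
  subtracting it a nondecreasing one. The boundary value at \<open>T\<close> is absorbed because
  \<open>T powr (- q) \<le> t powr (- q)\<close>, where q > 0 enters.\<close>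

lemma powr_bound_antiderivative:
  fixes F F' :: "real \<Rightarrow> real"
  assumes deriv: "\<And>t. t > 0 \<Longrightarrow> (F has_real_derivative F' t) (at t)"
    and bd: "\<And>t. t \<in> {0<..T} \<Longrightarrow> \<bar>F' t\<bar> \<le> C * t powr (- q - 1)"
    and "q > 0" "C > 0" "T > 0"
  shows "\<exists>C>0. \<forall>t\<in>{0<..T}. \<bar>F t\<bar> \<le> C * t powr (- q)"
proof -
  have dp: "((\<lambda>s. C / q * s powr (- q)) has_real_derivative - C * s powr (- q - 1)) (at s)" if "s > 0" for s
    using that \<open>q > 0\<close> by (auto intro!: derivative_eq_intros)
  define C' where "C' = C / q + \<bar>F T\<bar> * T powr q"
  have "\<bar>F t\<bar> \<le> C' * t powr (- q)" if t: "t \<in> {0<..T}" for t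
  proof -
    have "F t + C / q * t powr (- q) \<ge> F T + C / q * T powr (- q)"
    proof (rule DERIV_nonpos_imp_nonincreasing[where f = "\<lambda>s. F s + C / q * s powr (- q)"])
      fix s assume s: "t \<le> s" "s \<le> T"
      have "((\<lambda>s. F s + C / q * s powr (- q)) has_real_derivative F' s + (- C * s powr (- q - 1))) (at s)"
        using s t by (intro DERIV_add deriv dp) auto
      moreover have "F' s + (- C * s powr (- q - 1)) \<le> 0"
        using bd[of s] s t by auto
      ultimately show "\<exists>y. ((\<lambda>s. F s + C / q * s powr (- q)) has_real_derivative y) (at s) \<and> y \<le> 0" by blast
    qed (use t in auto)
    moreover have "F t - C / q * t powr (- q) \<le> F T - C / q * T powr (- q)"
    proof (rule DERIV_nonneg_imp_nondecreasing[where f = "\<lambda>s. F s - C / q * s powr (- q)"])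
      fix s assume s: "t \<le> s" "s \<le> T"
      have "((\<lambda>s. F s - C / q * s powr (- q)) has_real_derivative F' s - (- C * s powr (- q - 1))) (at s)"
        using s t by (intro DERIV_diff deriv dp) auto
      moreover have "F' s - (- C * s powr (- q - 1)) \<ge> 0"
        using bd[of s] s t by auto
      ultimately show "\<exists>y. ((\<lambda>s. F s - C / q * s powr (- q)) has_real_derivative y) (at s) \<and> 0 \<le> y" by blast
    qed (use t in auto)
    moreover have "C / q * T powr (- q) \<ge> 0" using \<open>q > 0\<close> \<open>C > 0\<close> by simp
    ultimately have "\<bar>F t\<bar> \<le> C / q * t powr (- q) + \<bar>F T\<bar>" by linarith
    also have "\<bar>F T\<bar> = \<bar>F T\<bar> * T powr q * T powr (- q)"
      using \<open>T > 0\<close> by (simp add: powr_minus field_simps)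
    also have "\<dots> \<le> \<bar>F T\<bar> * T powr q * t powr (- q)"
      using t \<open>q > 0\<close> by (intro mult_left_mono powr_mono2') auto
    finally show ?thesis by (simp add: C'_def algebra_simps)
  qed
  moreover have "C' > 0" using \<open>q > 0\<close> \<open>C > 0\<close> by (simp add: C'_def add_pos_nonneg)
  ultimately show ?thesis by blast
qed

lemma powr_bound_weaken:
  fixes F :: "real \<Rightarrow> real"
  assumes "\<exists>C>0. \<forall>t\<in>{0<..T}. \<bar>F t\<bar> \<le> C * t powr e" "T > 0"
  shows "\<exists>C>0. \<forall>t\<in>{0<..T}. \<bar>F t\<bar> \<le> C * t powr (e - 1)"
proof -
  obtain C where C: "C > 0" "\<And>t. t\<in>{0<..T} \<Longrightarrow> \<bar>F t\<bar> \<le> C * t powr e" using assms by auto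
  have "\<bar>F t\<bar> \<le> (C * T) * t powr (e - 1)" if t: "t \<in> {0<..T}" for t
  proof -
    have "\<bar>F t\<bar> \<le> C * t powr e" using C t by auto
    also have "t powr e = t * t powr (e - 1)" using t by (simp add: powr_diff)
    also have "C * (t * t powr (e - 1)) \<le> C * (T * t powr (e - 1))"
      using t C by (intro mult_left_mono mult_right_mono) auto
    finally show ?thesis by (simp add: mult_ac)
  qed
  thus ?thesis using C(1) \<open>T > 0\<close> by (intro exI[of _ "C * T"]) auto
qed

text \<open>\<open>S\<^sub>1, S\<^sub>2, S\<^sub>3\<close> are the derivatives of \<open>x \<mapsto> R (\<surd>x)\<close>. The exponents are one short of the
  scaling-sharp ones, which lets the bound on \<open>R'\<close> hold for every \<open>\<alpha> < 2\<close> without case distinction.\<close>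

lemma radial_derivative_bounds:
  fixes R :: "real \<Rightarrow> real"
  assumes Ck: "Ck_on_real 4 {0<..} R"
    and ev: "\<forall>\<^sub>F t in at_right 0. \<bar>(deriv ^^ 4) R t\<bar> \<le> c0 * t powr (\<alpha> - 4)"
    and "\<alpha> < 2" "T > 0"
  obtains S1 S2 S3 C where "C > 0"
    "\<And>x. x > 0 \<Longrightarrow> ((\<lambda>x. R (sqrt x)) has_real_derivative S1 x) (at x)"
    "\<And>x. x > 0 \<Longrightarrow> (S1 has_real_derivative S2 x) (at x)"
    "\<And>x. x > 0 \<Longrightarrow> (S2 has_real_derivative S3 x) (at x)"
    "\<And>r. 0 < r \<Longrightarrow> r \<le> T \<Longrightarrow> \<bar>S1 (r\<^sup>2)\<bar> \<le> C * r powr (\<alpha> - 3)"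
    "\<And>r. 0 < r \<Longrightarrow> r \<le> T \<Longrightarrow> \<bar>S2 (r\<^sup>2)\<bar> \<le> C * r powr (\<alpha> - 5)"
    "\<And>r. 0 < r \<Longrightarrow> r \<le> T \<Longrightarrow> \<bar>S3 (r\<^sup>2)\<bar> \<le> C * r powr (\<alpha> - 7)"
proof -
  define D where "D j = (deriv ^^ j) R" for j
  have dD: "(D j has_real_derivative D (Suc j) t) (at t)" if "j < 4" "t > 0" for j t
  proof -
    have "D j field_differentiable (at t)" using Ck that unfolding Ck_on_real_def D_def by auto
    thus ?thesis by (simp add: D_def DERIV_deriv_iff_field_differentiable)
  qed
  have c4: "continuous_on {0<..} (D 4)" using Ck unfolding Ck_on_real_def D_def by auto
  have b4: "\<exists>C>0. \<forall>t\<in>{0<..T}. \<bar>D 4 t\<bar> \<le> C * t powr (\<alpha> - 4)"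
    using powr_bound_extend[OF c4] ev unfolding D_def by blast
  have b3: "\<exists>C>0. \<forall>t\<in>{0<..T}. \<bar>D 3 t\<bar> \<le> C * t powr (\<alpha> - 3)"
  proof -
    obtain C where "C > 0" "\<And>t. t\<in>{0<..T} \<Longrightarrow> \<bar>D 4 t\<bar> \<le> C * t powr (\<alpha> - 4)" using b4 by auto
    thus ?thesis using powr_bound_antiderivative[of "D 3" "D 4" T C "3 - \<alpha>"] dD[of 3] \<open>\<alpha> < 2\<close> \<open>T > 0\<close>
      by (simp add: algebra_simps)
  qed
  have b2: "\<exists>C>0. \<forall>t\<in>{0<..T}. \<bar>D 2 t\<bar> \<le> C * t powr (\<alpha> - 2)"
  proof -
    obtain C where "C > 0" "\<And>t. t\<in>{0<..T} \<Longrightarrow> \<bar>D 3 t\<bar> \<le> C * t powr (\<alpha> - 3)" using b3 by auto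
    thus ?thesis using powr_bound_antiderivative[of "D 2" "D 3" T C "2 - \<alpha>"] dD[of 2] \<open>\<alpha> < 2\<close> \<open>T > 0\<close>
      by (simp add: algebra_simps)
  qed
  have b2': "\<exists>C>0. \<forall>t\<in>{0<..T}. \<bar>D 2 t\<bar> \<le> C * t powr (\<alpha> - 3)"
    using powr_bound_weaken[OF b2 \<open>T > 0\<close>] by (simp add: algebra_simps)
  have b3': "\<exists>C>0. \<forall>t\<in>{0<..T}. \<bar>D 3 t\<bar> \<le> C * t powr (\<alpha> - 4)"
    using powr_bound_weaken[OF b3 \<open>T > 0\<close>] by (simp add: algebra_simps)
  have b1: "\<exists>C>0. \<forall>t\<in>{0<..T}. \<bar>D 1 t\<bar> \<le> C * t powr (\<alpha> - 2)"
  proof -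
    obtain C where "C > 0" "\<And>t. t\<in>{0<..T} \<Longrightarrow> \<bar>D 2 t\<bar> \<le> C * t powr (\<alpha> - 3)" using b2' by auto
    thus ?thesis using powr_bound_antiderivative[of "D 1" "D 2" T C "2 - \<alpha>"] dD[of 1] \<open>\<alpha> < 2\<close> \<open>T > 0\<close>
      by (simp add: algebra_simps numeral_2_eq_2)
  qed
  obtain C1 where C1: "C1 > 0" "\<And>t. 0 < t \<Longrightarrow> t \<le> T \<Longrightarrow> \<bar>D 1 t\<bar> \<le> C1 * t powr (\<alpha> - 2)" using b1 by auto
  obtain C2 where C2: "C2 > 0" "\<And>t. 0 < t \<Longrightarrow> t \<le> T \<Longrightarrow> \<bar>D 2 t\<bar> \<le> C2 * t powr (\<alpha> - 3)" using b2' by auto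
  obtain C3 where C3: "C3 > 0" "\<And>t. 0 < t \<Longrightarrow> t \<le> T \<Longrightarrow> \<bar>D 3 t\<bar> \<le> C3 * t powr (\<alpha> - 4)" using b3' by auto
  define C where "C = C1 + C2 + C3"
  have "C > 0" using C1 C2 C3 by (simp add: C_def)
  have B: "\<bar>D 1 r / r\<bar> \<le> C1 * r powr (\<alpha> - 3)" "\<bar>D 1 r / r ^ 3\<bar> \<le> C1 * r powr (\<alpha> - 5)"
    "\<bar>D 1 r / r ^ 5\<bar> \<le> C1 * r powr (\<alpha> - 7)" "\<bar>D 2 r / r ^ 2\<bar> \<le> C2 * r powr (\<alpha> - 5)"
    "\<bar>D 2 r / r ^ 4\<bar> \<le> C2 * r powr (\<alpha> - 7)" "\<bar>D 3 r / r ^ 3\<bar> \<le> C3 * r powr (\<alpha> - 7)"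
    if r: "0 < r" "r \<le> T" for r
  proof -
    have *: "\<bar>x / r ^ k\<bar> \<le> c * r powr (e - real k)" if "\<bar>x\<bar> \<le> c * r powr e" for x c e k
    proof -
      have "\<bar>x / r ^ k\<bar> \<le> c * r powr e / r ^ k" using that r by (simp add: divide_right_mono)
      thus ?thesis using r by (simp add: powr_diff powr_realpow)
    qed
    show "\<bar>D 1 r / r\<bar> \<le> C1 * r powr (\<alpha> - 3)" using *[OF C1(2)[OF r], of 1] by simp
    show "\<bar>D 1 r / r ^ 3\<bar> \<le> C1 * r powr (\<alpha> - 5)" using *[OF C1(2)[OF r], of 3] by simp
    show "\<bar>D 1 r / r ^ 5\<bar> \<le> C1 * r powr (\<alpha> - 7)" using *[OF C1(2)[OF r], of 5] by simp
    show "\<bar>D 2 r / r ^ 2\<bar> \<le> C2 * r powr (\<alpha> - 5)" using *[OF C2(2)[OF r], of 2] by simp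
    show "\<bar>D 2 r / r ^ 4\<bar> \<le> C2 * r powr (\<alpha> - 7)" using *[OF C2(2)[OF r], of 4] by simp
    show "\<bar>D 3 r / r ^ 3\<bar> \<le> C3 * r powr (\<alpha> - 7)" using *[OF C3(2)[OF r], of 3] by simp
  qed
  define S1 where "S1 x = D 1 (sqrt x) / (2 * sqrt x)" for x
  define S2 where "S2 x = D 2 (sqrt x) / (4 * sqrt x ^ 2) - D 1 (sqrt x) / (4 * sqrt x ^ 3)" for x
  define S3 where "S3 x = D 3 (sqrt x) / (8 * sqrt x ^ 3) - 3 * D 2 (sqrt x) / (8 * sqrt x ^ 4)
     + 3 * D 1 (sqrt x) / (8 * sqrt x ^ 5)" for x
  \<comment> \<open>\<open>S1\<close> and \<open>S2\<close> are linear combinations of such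
    quotients, so this one rule differentiates every term.\<close>
  have dDs: "((\<lambda>x. D j (sqrt x) / sqrt x ^ k) has_real_derivative
      D (Suc j) (sqrt x) / (2 * sqrt x ^ (k + 1)) - real k * D j (sqrt x) / (2 * sqrt x ^ (k + 2))) (at x)"
    if "j < 4" "x > 0" for j k x
  proof -
    define r where "r = sqrt x"
    have r: "r > 0" using that by (simp add: r_def)
    have "((\<lambda>r. D j r / r ^ k) has_real_derivative
        (D (Suc j) r * r ^ k - D j r * (real k * r ^ (k - Suc 0))) / (r ^ k * r ^ k)) (at r)"
      using r by (intro DERIV_divide dD DERIV_pow that) auto
    from DERIV_chain2[OF this[unfolded r_def] DERIV_real_sqrt[OF that(2)]]
    have "((\<lambda>x. D j (sqrt x) / sqrt x ^ k) has_real_derivative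
       (D (Suc j) r * r ^ k - D j r * (real k * r ^ (k - Suc 0))) / (r ^ k * r ^ k) * (inverse r / 2)) (at x)"
      by (simp add: r_def)
    also have "(D (Suc j) r * r ^ k - D j r * (real k * r ^ (k - Suc 0))) / (r ^ k * r ^ k) * (inverse r / 2)
      = D (Suc j) r / (2 * r ^ (k + 1)) - real k * D j r / (2 * r ^ (k + 2))"
      using r by (cases k) (auto simp: field_simps)
    finally show ?thesis by (simp add: r_def)
  qed
  have d1: "((\<lambda>x. R (sqrt x)) has_real_derivative S1 x) (at x)" if "x > 0" for x
    using dDs[of 0 x 0] that by (simp add: D_def S1_def)
  have d2: "(S1 has_real_derivative S2 x) (at x)" if "x > 0" for x
  proof -
    have "S1 = (\<lambda>x. 1/2 * (D 1 (sqrt x) / sqrt x ^ 1))" by (auto simp: S1_def)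
    thus ?thesis using DERIV_cmult[OF dDs[of 1 x 1], of "1/2"] that
      by (simp add: S2_def numeral_2_eq_2 numeral_3_eq_3 algebra_simps)
  qed
  have d3: "(S2 has_real_derivative S3 x) (at x)" if "x > 0" for x
  proof -
    have "S2 = (\<lambda>x. 1/4 * (D 2 (sqrt x) / sqrt x ^ 2) - 1/4 * (D 1 (sqrt x) / sqrt x ^ 3))"
      by (auto simp: S2_def)
    moreover have "S3 x = 1/4 * (D (Suc 2) (sqrt x) / (2 * sqrt x ^ (2 + 1)) - real 2 * D 2 (sqrt x) / (2 * sqrt x ^ (2 + 2))) -
       1/4 * (D (Suc 1) (sqrt x) / (2 * sqrt x ^ (3 + 1)) - real 3 * D 1 (sqrt x) / (2 * sqrt x ^ (3 + 2)))"
    proof -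
      have "Suc 2 = 3" "Suc 1 = 2" "(2::nat) + 1 = 3" "(2::nat) + 2 = 4" "(3::nat) + 1 = 4" "(3::nat) + 2 = 5" by auto
      thus ?thesis unfolding S3_def by (simp only:) (simp add: field_simps)
    qed
    ultimately show ?thesis
      using that by (simp only:) (intro DERIV_diff DERIV_cmult dDs; simp)
  qed
  show thesis
  proof (rule that[of C S1 S2 S3])
    fix r assume r: "0 < r" "r \<le> T"
    have s: "sqrt (r\<^sup>2) = r" using r by simp
    have pp: "C1 * r powr e \<ge> 0" "C2 * r powr e \<ge> 0" "C3 * r powr e \<ge> 0" for e using C1 C2 C3 by auto
    \<comment> \<open>The coefficients 1/2, 1/4, 3/8 and 1/8 from the chain rule are all at most 1,
      so the single constant \<open>C1 + C2 + C3\<close> serves the three bounds.\<close>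
    have q: "\<bar>x * u + y * v + z * w\<bar> \<le> C * e"
      if "\<bar>u\<bar> \<le> C1 * e" "\<bar>v\<bar> \<le> C2 * e" "\<bar>w\<bar> \<le> C3 * e" "\<bar>x\<bar> \<le> 1" "\<bar>y\<bar> \<le> 1" "\<bar>z\<bar> \<le> 1" for u v w x y z e
    proof -
      have "\<bar>x * u + y * v + z * w\<bar> \<le> \<bar>x\<bar> * \<bar>u\<bar> + \<bar>y\<bar> * \<bar>v\<bar> + \<bar>z\<bar> * \<bar>w\<bar>"
        unfolding abs_mult[symmetric] by linarith
      also have "\<dots> \<le> 1 * (C1 * e) + 1 * (C2 * e) + 1 * (C3 * e)"
        using that by (intro add_mono mult_mono) auto
      finally show ?thesis by (simp add: C_def algebra_simps)
    qed
    have "S1 (r\<^sup>2) = 1/2 * (D 1 r / r) + 0 * 0 + 0 * 0" unfolding S1_def s by simp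
    thus "\<bar>S1 (r\<^sup>2)\<bar> \<le> C * r powr (\<alpha> - 3)"
      by (simp only:) (rule q, use B(1)[OF r] pp in auto)
    have "S2 (r\<^sup>2) = - (1/4) * (D 1 r / r ^ 3) + 1/4 * (D 2 r / r ^ 2) + 0 * 0" unfolding S2_def s by simp
    thus "\<bar>S2 (r\<^sup>2)\<bar> \<le> C * r powr (\<alpha> - 5)"
      by (simp only:) (rule q, use B(2,4)[OF r] pp in auto)
    have "S3 (r\<^sup>2) = 3/8 * (D 1 r / r ^ 5) + (- (3/8)) * (D 2 r / r ^ 4) + 1/8 * (D 3 r / r ^ 3)" unfolding S3_def s by simp
    thus "\<bar>S3 (r\<^sup>2)\<bar> \<le> C * r powr (\<alpha> - 7)"
      by (simp only:) (rule q, use B(3,5,6)[OF r] pp in auto)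
  qed (use \<open>C > 0\<close> d1 d2 d3 in auto)
qed

text \<open>The mean value theorem, applied to \<open>\<phi> (s + 1) - \<phi> s\<close> and then to
  \<open>\<phi>'\<close>, turns the second difference into one value of
  \<open>\<phi>''\<close>.\<close>

lemma second_difference_bound:
  fixes \<phi> :: "real \<Rightarrow> real"
  assumes "\<And>s. s \<in> {0..2} \<Longrightarrow> (\<phi> has_real_derivative \<phi>' s) (at s)"
    and "\<And>s. s \<in> {0..2} \<Longrightarrow> (\<phi>' has_real_derivative \<phi>'' s) (at s)"
    and "\<And>s. s \<in> {0..2} \<Longrightarrow> \<bar>\<phi>'' s\<bar> \<le> A"
  shows "\<bar>\<phi> 2 - 2 * \<phi> 1 + \<phi> 0\<bar> \<le> A"
proof -
  have "\<exists>z>0. z < 1 \<and> (\<phi> (1 + 1) - \<phi> 1) - (\<phi> (0 + 1) - \<phi> 0) = (1 - 0) * (\<phi>' (z + 1) - \<phi>' z)"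
  proof (rule MVT2[of 0 1 "\<lambda>s. \<phi> (s + 1) - \<phi> s" "\<lambda>s. \<phi>' (s + 1) - \<phi>' s"])
    fix x :: real assume x: "0 \<le> x" "x \<le> 1"
    have "((\<lambda>s. \<phi> (s + 1)) has_real_derivative \<phi>' (x + 1)) (at x)"
      using assms(1)[of "x + 1"] x by (simp add: DERIV_shift)
    thus "((\<lambda>s. \<phi> (s + 1) - \<phi> s) has_real_derivative \<phi>' (x + 1) - \<phi>' x) (at x)"
      using assms(1)[of x] x by (intro DERIV_diff) auto
  qed simp
  then obtain z where z: "0 < z" "z < 1" "\<phi> 2 - 2 * \<phi> 1 + \<phi> 0 = \<phi>' (z + 1) - \<phi>' z" by auto
  have "\<exists>y>z. y < z + 1 \<and> \<phi>' (z + 1) - \<phi>' z = (z + 1 - z) * \<phi>'' y"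
    using z by (intro MVT2 assms(2)) auto
  then obtain y where "z < y" "y < z + 1" "\<phi>' (z + 1) - \<phi>' z = \<phi>'' y" by auto
  thus ?thesis using assms(3)[of y] z by simp
qed

text \<open>Second order in s but only first order in t: the second difference in t is a difference
  of two first differences of \<open>F2\<close>, each at most \<open>A\<close>. Hence the factor 2,
  and no second derivative in t.\<close>

lemma mixed_difference_bound:
  fixes F F1 F2 F3 :: "real \<Rightarrow> real \<Rightarrow> real"
  assumes "\<And>s t. s \<in> {0..2} \<Longrightarrow> t \<in> {0..2} \<Longrightarrow> ((\<lambda>s. F s t) has_real_derivative F1 s t) (at s)"
    and "\<And>s t. s \<in> {0..2} \<Longrightarrow> t \<in> {0..2} \<Longrightarrow> ((\<lambda>s. F1 s t) has_real_derivative F2 s t) (at s)"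
    and "\<And>s t. s \<in> {0..2} \<Longrightarrow> t \<in> {0..2} \<Longrightarrow> ((\<lambda>t. F2 s t) has_real_derivative F3 s t) (at t)"
    and A: "\<And>s t. s \<in> {0..2} \<Longrightarrow> t \<in> {0..2} \<Longrightarrow> \<bar>F3 s t\<bar> \<le> A"
  shows "\<bar>(F 2 2 - 2 * F 2 1 + F 2 0) - 2 * (F 1 2 - 2 * F 1 1 + F 1 0) + (F 0 2 - 2 * F 0 1 + F 0 0)\<bar> \<le> 2 * A"
proof (rule second_difference_bound)
  fix s :: real assume s: "s \<in> {0..2}"
  show "((\<lambda>s. F s 2 - 2 * F s 1 + F s 0) has_real_derivative F1 s 2 - 2 * F1 s 1 + F1 s 0) (at s)"
    using s by (intro DERIV_add DERIV_diff DERIV_cmult assms) auto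
  show "((\<lambda>s. F1 s 2 - 2 * F1 s 1 + F1 s 0) has_real_derivative F2 s 2 - 2 * F2 s 1 + F2 s 0) (at s)"
    using s by (intro DERIV_add DERIV_diff DERIV_cmult assms) auto
  have *: "\<bar>F2 s (t + 1) - F2 s t\<bar> \<le> A" if "t \<in> {0..1}" for t
  proof -
    have "\<exists>y>t. y < t + 1 \<and> F2 s (t + 1) - F2 s t = (t + 1 - t) * F3 s y"
      using that s by (intro MVT2 assms) auto
    then obtain y where "t < y" "y < t + 1" "F2 s (t + 1) - F2 s t = F3 s y" by auto
    thus ?thesis using A[of s y] s that by auto
  qed
  show "\<bar>F2 s 2 - 2 * F2 s 1 + F2 s 0\<bar> \<le> 2 * A" using *[of 0] *[of 1] by simp
qed

lemma has_real_derivative_inner: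
  fixes p q :: "real \<Rightarrow> 'a::real_inner"
  assumes "(p has_vector_derivative p') (at s)" "(q has_vector_derivative q') (at s)"
  shows "((\<lambda>s. p s \<bullet> q s) has_real_derivative p s \<bullet> q' + p' \<bullet> q s) (at s)"
  unfolding has_real_derivative_iff_has_vector_derivative
  by (rule bounded_bilinear.has_vector_derivative[OF bounded_bilinear_inner assms])

text \<open>\<open>p\<close> and \<open>q\<close> stand for the curves s |-> f (u + s k) and t |-> f
  (v + t k), with \<epsilon> the step 1/n. Three differentiations give \<epsilon>^3, and the
  exponent \<alpha> - 4 is inherited from the bounds on the derivatives of
  \<open>R (sqrt x)\<close>. Working with the squared distance keeps the inner derivatives
  polynomial in inner products.\<close>

lemma radial_mixed_difference_bound:
  fixes R :: "real \<Rightarrow> real"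
  assumes Ck: "Ck_on_real 4 {0<..} R"
    and ev: "\<forall>\<^sub>F t in at_right 0. \<bar>(deriv ^^ 4) R t\<bar> \<le> c0 * t powr (\<alpha> - 4)"
    and "\<alpha> < 2" "T > 0" "B > 0"
  obtains C where "C > 0"
    "\<And>(p :: real \<Rightarrow> 'a::real_inner) p1 p2 q q1 \<epsilon> r0. \<epsilon> > 0 \<Longrightarrow> r0 > 0 \<Longrightarrow>
      (\<And>s. (p has_vector_derivative p1 s) (at s)) \<Longrightarrow>
      (\<And>s. (p1 has_vector_derivative p2 s) (at s)) \<Longrightarrow>
      (\<And>s. (q has_vector_derivative q1 s) (at s)) \<Longrightarrow>
      (\<And>s. s \<in> {0..2} \<Longrightarrow> norm (p1 s) \<le> \<epsilon> * B) \<Longrightarrow>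
      (\<And>s. s \<in> {0..2} \<Longrightarrow> norm (p2 s) \<le> \<epsilon>\<^sup>2 * B) \<Longrightarrow>
      (\<And>s. s \<in> {0..2} \<Longrightarrow> norm (q1 s) \<le> \<epsilon> * B) \<Longrightarrow>
      (\<And>s t. s \<in> {0..2} \<Longrightarrow> t \<in> {0..2} \<Longrightarrow> r0 \<le> norm (p s - q t) \<and> norm (p s - q t) \<le> T) \<Longrightarrow>
      (let F = (\<lambda>s t. R (norm (p s - q t))) in
       \<bar>(F 2 2 - 2 * F 2 1 + F 2 0) - 2 * (F 1 2 - 2 * F 1 1 + F 1 0) + (F 0 2 - 2 * F 0 1 + F 0 0)\<bar>
        \<le> C * \<epsilon> ^ 3 * r0 powr (\<alpha> - 4))"
proof -
  obtain C S1 S2 S3 where C: "C > 0"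
    and dS0: "\<And>x. x > 0 \<Longrightarrow> ((\<lambda>x. R (sqrt x)) has_real_derivative S1 x) (at x)"
    and dS1: "\<And>x. x > 0 \<Longrightarrow> (S1 has_real_derivative S2 x) (at x)"
    and dS2: "\<And>x. x > 0 \<Longrightarrow> (S2 has_real_derivative S3 x) (at x)"
    and S1: "\<And>r. 0 < r \<Longrightarrow> r \<le> T \<Longrightarrow> \<bar>S1 (r\<^sup>2)\<bar> \<le> C * r powr (\<alpha> - 3)"
    and S2: "\<And>r. 0 < r \<Longrightarrow> r \<le> T \<Longrightarrow> \<bar>S2 (r\<^sup>2)\<bar> \<le> C * r powr (\<alpha> - 5)"
    and S3: "\<And>r. 0 < r \<Longrightarrow> r \<le> T \<Longrightarrow> \<bar>S3 (r\<^sup>2)\<bar> \<le> C * r powr (\<alpha> - 7)"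
    by (rule radial_derivative_bounds[OF assms(1-4)]) (rule that)
  \<comment> \<open>The summands are the contributions of the third, second and first derivative of
    \<open>R (sqrt x)\<close>. The factor \<open>T\<close> in the last one pays for replacing
    \<open>\<rho> powr (\<alpha> - 3)\<close> by \<open>\<rho> powr (\<alpha> - 4)\<close>.\<close>
  define C' where "C' = C * (8 * B ^ 3 + (12 * B ^ 3 + 4 * T * B ^ 2) + 2 * T * B ^ 2)"
  have "C' > 0" unfolding C'_def using C \<open>T > 0\<close> \<open>B > 0\<close> by (intro mult_pos_pos add_pos_pos) auto
  show thesis
  proof (rule that[of "2 * C'"])
    show "2 * C' > 0" using \<open>C' > 0\<close> by simp
    fix p p1 p2 q q1 :: "real \<Rightarrow> 'a" and \<epsilon> r0 :: real
    assume \<epsilon>: "\<epsilon> > 0" and r0: "r0 > 0"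
      and p: "\<And>s. (p has_vector_derivative p1 s) (at s)"
      and p1: "\<And>s. (p1 has_vector_derivative p2 s) (at s)"
      and q: "\<And>s. (q has_vector_derivative q1 s) (at s)"
      and np1: "\<And>s. s \<in> {0..2} \<Longrightarrow> norm (p1 s) \<le> \<epsilon> * B"
      and np2: "\<And>s. s \<in> {0..2} \<Longrightarrow> norm (p2 s) \<le> \<epsilon>\<^sup>2 * B"
      and nq1: "\<And>s. s \<in> {0..2} \<Longrightarrow> norm (q1 s) \<le> \<epsilon> * B"
      and r: "\<And>s t. s \<in> {0..2} \<Longrightarrow> t \<in> {0..2} \<Longrightarrow> r0 \<le> norm (p s - q t) \<and> norm (p s - q t) \<le> T"
    \<comment> \<open>\<open>N\<close> is the squared distance. Its partial derivatives are
      \<open>2 * u s t\<close> in s and \<open>- 2 * w s t\<close> in t, and \<open>v\<close> is the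
      derivative of \<open>u\<close> in s.\<close>
    define N where "N s t = (p s - q t) \<bullet> (p s - q t)" for s t
    define u where "u s t = (p s - q t) \<bullet> p1 s" for s t
    define v where "v s t = p1 s \<bullet> p1 s + (p s - q t) \<bullet> p2 s" for s t
    define w where "w s t = (p s - q t) \<bullet> q1 t" for s t
    have Npos: "N s t > 0" if "s \<in> {0..2}" "t \<in> {0..2}" for s t
      using r[OF that] r0 by (auto simp: N_def)
    have dNs: "((\<lambda>s. N s t) has_real_derivative 2 * u s t) (at s)" for s t
    proof -
      have 1: "((\<lambda>s. p s - q t) has_vector_derivative p1 s) (at s)"
        using has_vector_derivative_diff[OF p[of s] has_vector_derivative_const[where c = "q t"]] by simp
      show ?thesis unfolding N_def u_def using has_real_derivative_inner[OF 1 1]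
        by (simp add: inner_commute)
    qed
    have dq: "((\<lambda>t. p s - q t) has_vector_derivative - q1 t) (at t)" for s t
      using has_vector_derivative_diff[OF has_vector_derivative_const[where c = "p s"] q[of t]] by simp
    have dNt: "((\<lambda>t. N s t) has_real_derivative - 2 * w s t) (at t)" for s t
      unfolding N_def w_def using has_real_derivative_inner[OF dq[of s t] dq[of s t]]
      by (simp add: inner_commute)
    have dus: "((\<lambda>s. u s t) has_real_derivative v s t) (at s)" for s t
    proof -
      have 1: "((\<lambda>s. p s - q t) has_vector_derivative p1 s) (at s)"
        using has_vector_derivative_diff[OF p[of s] has_vector_derivative_const[where c = "q t"]] by simp
      show ?thesis unfolding u_def v_def using has_real_derivative_inner[OF 1 p1[of s]]
        by (simp add: add.commute)
    qed
    have dut: "((\<lambda>t. u s t) has_real_derivative - (q1 t \<bullet> p1 s)) (at t)" for s t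
      unfolding u_def using has_real_derivative_inner[OF dq[of s t] has_vector_derivative_const[where c = "p1 s"]] by simp
    have dvt: "((\<lambda>t. v s t) has_real_derivative - (q1 t \<bullet> p2 s)) (at t)" for s t
      unfolding v_def using DERIV_add[OF DERIV_const has_real_derivative_inner[OF dq[of s t] has_vector_derivative_const[where c = "p2 s"]]] by simp
    define F where "F s t = R (norm (p s - q t))" for s t
    define F1 where "F1 s t = S1 (N s t) * (2 * u s t)" for s t
    define F2 where "F2 s t = S2 (N s t) * (4 * (u s t)\<^sup>2) + S1 (N s t) * (2 * v s t)" for s t
    define F3 where "F3 s t = S3 (N s t) * (- 8 * w s t * (u s t)\<^sup>2) +
        S2 (N s t) * (- 8 * u s t * (q1 t \<bullet> p1 s) - 4 * w s t * v s t) +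
        S1 (N s t) * (- 2 * (q1 t \<bullet> p2 s))" for s t
    have F: "F = (\<lambda>s t. R (sqrt (N s t)))" unfolding F_def N_def by (simp add: norm_eq_sqrt_inner)
    have "\<bar>(F 2 2 - 2 * F 2 1 + F 2 0) - 2 * (F 1 2 - 2 * F 1 1 + F 1 0) + (F 0 2 - 2 * F 0 1 + F 0 0)\<bar>
        \<le> 2 * (C' * \<epsilon> ^ 3 * r0 powr (\<alpha> - 4))"
    proof (rule mixed_difference_bound)
      fix s t :: real assume st: "s \<in> {0..2}" "t \<in> {0..2}"
      show "((\<lambda>s. F s t) has_real_derivative F1 s t) (at s)"
        unfolding F F1_def by (rule DERIV_chain2[OF dS0[OF Npos[OF st]] dNs])
      show "((\<lambda>s. F1 s t) has_real_derivative F2 s t) (at s)"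
        unfolding F1_def
        using DERIV_mult[OF DERIV_chain2[OF dS1[OF Npos[OF st]] dNs] DERIV_cmult[OF dus, of 2]]
        by (rule DERIV_cong) (simp add: F2_def power2_eq_square)
      show "((\<lambda>t. F2 s t) has_real_derivative F3 s t) (at t)"
        unfolding F2_def
        using DERIV_add[OF DERIV_mult[OF DERIV_chain2[OF dS2[OF Npos[OF st]] dNt] DERIV_cmult[OF DERIV_power[OF dut, where n=2], of 4]]
            DERIV_mult[OF DERIV_chain2[OF dS1[OF Npos[OF st]] dNt] DERIV_cmult[OF dvt, of 2]]]
        by (rule DERIV_cong) (simp add: F3_def power2_eq_square algebra_simps)
      define \<rho> where "\<rho> = norm (p s - q t)"
      have \<rho>: "\<rho> > 0" "\<rho> \<ge> r0" "\<rho> \<le> T" using r[OF st] r0 by (auto simp: \<rho>_def)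
      have N: "N s t = \<rho>\<^sup>2" by (simp add: N_def \<rho>_def power2_norm_eq_inner)
      have CS: "\<bar>x \<bullet> y\<bar> \<le> a * b" if "norm x \<le> a" "norm y \<le> b" for x y :: 'a and a b
        using Cauchy_Schwarz_ineq2[of x y] mult_mono[OF that] that(1) norm_ge_zero[of x] norm_ge_zero[of y]
        by (meson order_trans)
      have bu: "\<bar>u s t\<bar> \<le> \<rho> * (\<epsilon> * B)" unfolding u_def by (rule CS) (use st np1 in \<open>auto simp: \<rho>_def\<close>)
      have bw: "\<bar>w s t\<bar> \<le> \<rho> * (\<epsilon> * B)" unfolding w_def by (rule CS) (use st nq1 in \<open>auto simp: \<rho>_def\<close>)
      have bqp1: "\<bar>q1 t \<bullet> p1 s\<bar> \<le> (\<epsilon> * B) * (\<epsilon> * B)" by (rule CS[OF nq1 np1]) (use st in auto)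
      have bqp2: "\<bar>q1 t \<bullet> p2 s\<bar> \<le> (\<epsilon> * B) * (\<epsilon>\<^sup>2 * B)" by (rule CS[OF nq1 np2]) (use st in auto)
      have bv: "\<bar>v s t\<bar> \<le> (\<epsilon> * B) * (\<epsilon> * B) + T * (\<epsilon>\<^sup>2 * B)"
      proof -
        have "\<bar>p1 s \<bullet> p1 s\<bar> \<le> (\<epsilon> * B) * (\<epsilon> * B)" by (rule CS[OF np1 np1]) (use st in auto)
        moreover have "\<bar>(p s - q t) \<bullet> p2 s\<bar> \<le> T * (\<epsilon>\<^sup>2 * B)"
          by (rule CS) (use st np2 \<rho> in \<open>auto simp: \<rho>_def\<close>)
        ultimately show ?thesis unfolding v_def by linarith
      qed
      have eB: "\<epsilon> * B \<ge> 0" using \<epsilon> \<open>B > 0\<close> by simp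
      have m1: "\<bar>- 8 * w s t * (u s t)\<^sup>2\<bar> \<le> 8 * (\<rho> * (\<epsilon> * B)) * (\<rho> * (\<epsilon> * B))\<^sup>2"
        unfolding abs_mult power_abs using bu bw eB \<rho> by (intro mult_mono power_mono) auto
      have m2: "\<bar>- 8 * u s t * (q1 t \<bullet> p1 s) - 4 * w s t * v s t\<bar> \<le>
         8 * (\<rho> * (\<epsilon> * B)) * ((\<epsilon> * B) * (\<epsilon> * B)) + 4 * (\<rho> * (\<epsilon> * B)) * ((\<epsilon> * B) * (\<epsilon> * B) + T * (\<epsilon>\<^sup>2 * B))"
      proof -
        have "\<bar>8 * u s t * (q1 t \<bullet> p1 s)\<bar> \<le> 8 * (\<rho> * (\<epsilon> * B)) * ((\<epsilon> * B) * (\<epsilon> * B))"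
          unfolding abs_mult using bu bqp1 eB \<rho> by (intro mult_mono) auto
        moreover have "\<bar>4 * w s t * v s t\<bar> \<le> 4 * (\<rho> * (\<epsilon> * B)) * ((\<epsilon> * B) * (\<epsilon> * B) + T * (\<epsilon>\<^sup>2 * B))"
          unfolding abs_mult using bw bv eB \<rho> by (intro mult_mono) auto
        ultimately show ?thesis by linarith
      qed
      have m3: "\<bar>- 2 * (q1 t \<bullet> p2 s)\<bar> \<le> 2 * ((\<epsilon> * B) * (\<epsilon>\<^sup>2 * B))" using bqp2 by simp
      have tri: "\<bar>x * a + y * b + z * c\<bar> \<le> x' * a' + y' * b' + z' * c'"
        if "\<bar>x\<bar> \<le> x'" "\<bar>y\<bar> \<le> y'" "\<bar>z\<bar> \<le> z'" "\<bar>a\<bar> \<le> a'" "\<bar>b\<bar> \<le> b'" "\<bar>c\<bar> \<le> c'" for x y z a b c x' y' z' a' b' c' :: real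
      proof -
        have "\<bar>x * a + y * b + z * c\<bar> \<le> \<bar>x\<bar> * \<bar>a\<bar> + \<bar>y\<bar> * \<bar>b\<bar> + \<bar>z\<bar> * \<bar>c\<bar>"
          unfolding abs_mult[symmetric] by linarith
        also have "\<dots> \<le> x' * a' + y' * b' + z' * c'"
          using that by (intro add_mono mult_mono) auto
        finally show ?thesis .
      qed
      have "\<bar>F3 s t\<bar> \<le> (C * \<rho> powr (\<alpha> - 7)) * (8 * (\<rho> * (\<epsilon> * B)) * (\<rho> * (\<epsilon> * B))\<^sup>2) +
         (C * \<rho> powr (\<alpha> - 5)) * (8 * (\<rho> * (\<epsilon> * B)) * ((\<epsilon> * B) * (\<epsilon> * B)) +
            4 * (\<rho> * (\<epsilon> * B)) * ((\<epsilon> * B) * (\<epsilon> * B) + T * (\<epsilon>\<^sup>2 * B))) +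
         (C * \<rho> powr (\<alpha> - 3)) * (2 * ((\<epsilon> * B) * (\<epsilon>\<^sup>2 * B)))"
        unfolding F3_def N by (rule tri[OF S3 S2 S1 m1 m2 m3]) (use \<rho> in auto)
      also have "\<dots> = C * \<epsilon> ^ 3 * (8 * B ^ 3 * (\<rho> powr (\<alpha> - 7) * \<rho> ^ 3) +
           (12 * B ^ 3 + 4 * T * B ^ 2) * (\<rho> powr (\<alpha> - 5) * \<rho>) + 2 * B ^ 2 * \<rho> powr (\<alpha> - 3))"
        by (simp add: algebra_simps power2_eq_square power3_eq_cube)
      also have "\<rho> powr (\<alpha> - 7) * \<rho> ^ 3 = \<rho> powr (\<alpha> - 4)"
        using \<rho> powr_add[of \<rho> "\<alpha> - 7" 3] by simp
      also have "\<rho> powr (\<alpha> - 5) * \<rho> = \<rho> powr (\<alpha> - 4)"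
        using \<rho> powr_add[of \<rho> "\<alpha> - 5" 1] by simp
      also have "\<rho> powr (\<alpha> - 3) = \<rho> powr (\<alpha> - 4) * \<rho>"
        using \<rho> powr_add[of \<rho> "\<alpha> - 4" 1] by simp
      also have "C * \<epsilon> ^ 3 * (8 * B ^ 3 * \<rho> powr (\<alpha> - 4) +
           (12 * B ^ 3 + 4 * T * B ^ 2) * \<rho> powr (\<alpha> - 4) + 2 * B ^ 2 * (\<rho> powr (\<alpha> - 4) * \<rho>)) \<le>
         C * \<epsilon> ^ 3 * (8 * B ^ 3 * \<rho> powr (\<alpha> - 4) +
           (12 * B ^ 3 + 4 * T * B ^ 2) * \<rho> powr (\<alpha> - 4) + 2 * B ^ 2 * (\<rho> powr (\<alpha> - 4) * T))"
        using C \<epsilon> \<rho> by (intro mult_left_mono add_left_mono) auto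
      also have "\<dots> = C' * \<epsilon> ^ 3 * \<rho> powr (\<alpha> - 4)" by (simp add: C'_def algebra_simps)
      also have "\<dots> \<le> C' * \<epsilon> ^ 3 * r0 powr (\<alpha> - 4)"
        using \<open>C' > 0\<close> \<epsilon> \<rho> r0 \<open>\<alpha> < 2\<close> by (intro mult_left_mono powr_mono2') auto
      finally show "\<bar>F3 s t\<bar> \<le> C' * \<epsilon> ^ 3 * r0 powr (\<alpha> - 4)" .
    qed
    thus "let F = (\<lambda>s t. R (norm (p s - q t))) in
       \<bar>(F 2 2 - 2 * F 2 1 + F 2 0) - 2 * (F 1 2 - 2 * F 1 1 + F 1 0) + (F 0 2 - 2 * F 0 1 + F 0 0)\<bar>
        \<le> 2 * C' * \<epsilon> ^ 3 * r0 powr (\<alpha> - 4)"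
      by (simp add: F_def Let_def mult.assoc)
  qed
qed

section \<open>Maps with continuous partial derivatives\<close>

text \<open>The derivative in direction \<open>h\<close>, expressed through partials because
  \<open>Cr_on\<close> speaks only of those; that it is the total derivative follows from their
  continuity.\<close>

definition dirder :: "real^2 \<Rightarrow> (real^2 \<Rightarrow> 'b::real_normed_vector) \<Rightarrow> real^2 \<Rightarrow> 'b" where
  "dirder h F x = h $ 1 *\<^sub>R partial 1 F x + h $ 2 *\<^sub>R partial 2 F x"

text \<open>The definition differentiates at parameter 0 for every base point; translating the base
  point gives the derivative at any \<open>s0\<close>.\<close>

lemma partial_has_vector_derivative:
  assumes "Cr_on (Suc r) UNIV F"
  shows "((\<lambda>s. F (x + s *\<^sub>R axis i 1)) has_vector_derivative partial i F (x + s0 *\<^sub>R axis i 1)) (at s0)"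
proof -
  have "(\<lambda>s. F ((x + s0 *\<^sub>R axis i 1) + s *\<^sub>R axis i 1)) differentiable (at 0)" using assms by auto
  hence "((\<lambda>s. F ((x + s0 *\<^sub>R axis i 1) + s *\<^sub>R axis i 1)) has_vector_derivative partial i F (x + s0 *\<^sub>R axis i 1)) (at 0)"
    unfolding partial_def by (simp add: vector_derivative_works)
  hence "((\<lambda>s. F ((x + s0 *\<^sub>R axis i 1) + s *\<^sub>R axis i 1)) has_vector_derivative partial i F (x + s0 *\<^sub>R axis i 1)) (at (s0 - s0))"
    by simp
  moreover have "((\<lambda>s. s - s0) has_vector_derivative 1) (at s0)"
    by (auto intro!: derivative_eq_intros)
  ultimately have "((\<lambda>s. F ((x + s0 *\<^sub>R axis i 1) + s *\<^sub>R axis i 1)) \<circ> (\<lambda>s. s - s0) has_vector_derivative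
      1 *\<^sub>R partial i F (x + s0 *\<^sub>R axis i 1)) (at s0)"
    by (intro vector_diff_chain_at)
  moreover have "(\<lambda>s. F ((x + s0 *\<^sub>R axis i 1) + s *\<^sub>R axis i 1)) \<circ> (\<lambda>s. s - s0) = (\<lambda>s. F (x + s *\<^sub>R axis i 1))"
    by (auto simp: scaleR_diff_left o_def)
  ultimately show ?thesis by simp
qed

lemma Cr_on_partial_continuous:
  assumes "Cr_on (Suc r) UNIV F" shows "continuous_on UNIV (partial i F)"
  using assms by (cases r) auto

text \<open>In the coordinates a, b of \<open>G\<close> this is the criterion for total
  differentiability on a product, with one partial known at the point and the other one continuous.
  Composition with the coordinate map carries it back to vectors.\<close>

lemma Cr_on_has_derivative:
  fixes F :: "real^2 \<Rightarrow> 'b::real_normed_vector"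
  assumes F: "Cr_on (Suc r) UNIV F"
  shows "(F has_derivative (\<lambda>k. dirder k F x)) (at x)"
proof -
  define e1 e2 :: "real^2" where "e1 = axis 1 1" and "e2 = axis 2 1"
  define G where "G a b = F (a *\<^sub>R e1 + b *\<^sub>R e2)" for a b
  have x: "x = x $ 1 *\<^sub>R e1 + x $ 2 *\<^sub>R e2" for x
    unfolding e1_def e2_def by (simp add: vec_eq_iff forall_2 axis_def)
  have fx: "((\<lambda>a. G a (x $ 2)) has_derivative (\<lambda>t. t *\<^sub>R partial 1 F x)) (at (x $ 1))"
    using partial_has_vector_derivative[OF F, of "x $ 2 *\<^sub>R e2" 1 "x $ 1"]
    unfolding has_vector_derivative_def G_def e1_def[symmetric] add.commute[of "_ *\<^sub>R e2"] x[symmetric] .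
  have fy: "((\<lambda>b. G a b) has_derivative blinfun_apply (blinfun_scaleR_left (partial 2 F (a *\<^sub>R e1 + b *\<^sub>R e2)))) (at b)" for a b
    using partial_has_vector_derivative[OF F, of "a *\<^sub>R e1" 2 b]
    unfolding has_vector_derivative_def G_def e2_def[symmetric] blinfun_scaleR_left.rep_eq .
  have c: "continuous_on UNIV (\<lambda>z. blinfun_scaleR_left (partial 2 F z))"
    by (intro bounded_linear.continuous_on[OF bounded_linear_blinfun_scaleR_left] Cr_on_partial_continuous[OF F])
  have "continuous_on UNIV (\<lambda>(a, b). blinfun_scaleR_left (partial 2 F (a *\<^sub>R e1 + b *\<^sub>R e2)))"
    unfolding case_prod_beta by (rule continuous_on_compose2[OF c]) (auto intro!: continuous_intros)
  hence fyc: "continuous (at (x $ 1, x $ 2) within UNIV \<times> UNIV) (\<lambda>(a, b). blinfun_scaleR_left (partial 2 F (a *\<^sub>R e1 + b *\<^sub>R e2)))"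
    by (simp add: continuous_on_eq_continuous_at)
  have "((\<lambda>(a, b). G a b) has_derivative (\<lambda>(t, u). t *\<^sub>R partial 1 F x +
      blinfun_apply (blinfun_scaleR_left (partial 2 F (x $ 1 *\<^sub>R e1 + x $ 2 *\<^sub>R e2))) u))
      (at (x $ 1, x $ 2) within UNIV \<times> UNIV)"
    by (rule has_derivative_partialsI) (use fx fy fyc in auto)
  hence "((\<lambda>(a, b). G a b) has_derivative (\<lambda>(t, u). t *\<^sub>R partial 1 F x + u *\<^sub>R partial 2 F x)) (at (x $ 1, x $ 2))"
    by (simp add: x[symmetric])
  moreover have "((\<lambda>x::real^2. (x $ 1, x $ 2)) has_derivative (\<lambda>k. (k $ 1, k $ 2))) (at x)"
    by (intro bounded_linear_imp_has_derivative bounded_linear_Pair bounded_linear_vec_nth)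
  ultimately have "((\<lambda>(a, b). G a b) \<circ> (\<lambda>x::real^2. (x $ 1, x $ 2)) has_derivative
      (\<lambda>(t, u). t *\<^sub>R partial 1 F x + u *\<^sub>R partial 2 F x) \<circ> (\<lambda>k. (k $ 1, k $ 2))) (at x)"
    by (intro diff_chain_at)
  moreover have "(\<lambda>(a, b). G a b) \<circ> (\<lambda>x::real^2. (x $ 1, x $ 2)) = F"
    by (auto simp: G_def o_def x[symmetric])
  ultimately show ?thesis by (simp add: o_def dirder_def)
qed

lemma Cr_on_line_derivative:
  fixes F :: "real^2 \<Rightarrow> 'b::real_normed_vector"
  assumes F: "Cr_on (Suc r) UNIV F"
  shows "((\<lambda>s. F (u + s *\<^sub>R h)) has_vector_derivative dirder h F (u + s *\<^sub>R h)) (at s)"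
proof -
  have "((\<lambda>s. u + s *\<^sub>R h) has_derivative (\<lambda>t. t *\<^sub>R h)) (at s)"
    by (auto intro!: derivative_eq_intros)
  from diff_chain_at[OF this Cr_on_has_derivative[OF F]]
  show ?thesis by (simp add: has_vector_derivative_def o_def dirder_def scaleR_add_right)
qed

lemma jacobian_eq_dirder:
  fixes F :: "real^2 \<Rightarrow> real^2"
  assumes F: "Cr_on (Suc r) UNIV F"
  shows "jacobian F (at x) *v h = dirder h F x"
proof -
  have "F differentiable (at x)" using Cr_on_has_derivative[OF F] by (auto simp: differentiable_def)
  hence "(F has_derivative (\<lambda>h. jacobian F (at x) *v h)) (at x)" by (simp add: jacobian_works)
  from has_derivative_unique[OF this Cr_on_has_derivative[OF F]] show ?thesis by metis
qed

lemma dirder_continuous: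
  assumes "Cr_on (Suc r) UNIV F" shows "continuous_on S (dirder h F)"
  unfolding dirder_def[abs_def]
  by (intro continuous_intros continuous_on_subset[OF Cr_on_partial_continuous[OF assms]]) auto

text \<open>\<open>f\<close> is the injective linear map \<open>A\<close> plus a remainder. Each of
  the two partials moves by at most c/4 on the ball, so the remainder has Lipschitz constant c/2 and
  cannot undo the lower bound c of \<open>A\<close>.\<close>

lemma bi_lipschitz_lower_local:
  fixes f :: "real^2 \<Rightarrow> real^2"
  assumes f: "Cr_on (Suc r) UNIV f" and det: "det (jacobian f (at x)) \<noteq> 0"
  obtains c \<delta> where "c > 0" "\<delta> > 0"
    "\<And>u v. u \<in> ball x \<delta> \<Longrightarrow> v \<in> ball x \<delta> \<Longrightarrow> c * norm (u - v) \<le> norm (f u - f v)"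
proof -
  define A where "A k = dirder k f x" for k
  have A: "A = (\<lambda>k. jacobian f (at x) *v k)" unfolding A_def by (simp add: jacobian_eq_dirder[OF f])
  have "linear A" unfolding A by (rule matrix_vector_mul_linear)
  moreover have "inj A" unfolding A using det invertible_det_nz inj_matrix_vector_mult by blast
  ultimately obtain c where c: "c > 0" "\<And>k. c * norm k \<le> norm (A k)"
    using linear_inj_bounded_below_pos by blast
  have "\<exists>\<delta>>0. \<forall>y. dist y x < \<delta> \<longrightarrow> dist (partial i f y) (partial i f x) < c / 4" for i
    using Cr_on_partial_continuous[OF f, of i] c unfolding continuous_on_iff
    by (metis UNIV_I divide_pos_pos zero_less_numeral)
  then obtain \<delta> where \<delta>: "\<And>i. \<delta> i > 0" "\<And>i y. dist y x < \<delta> i \<Longrightarrow> norm (partial i f y - partial i f x) \<le> c / 4"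
    by (metis dist_norm less_eq_real_def)
  define d where "d = min (\<delta> 1) (\<delta> 2)"
  have d: "d > 0" using \<delta> by (simp add: d_def)
  have bA: "bounded_linear A" using \<open>linear A\<close> by (simp add: linear_conv_bounded_linear)
  show thesis
  proof (rule that[of "c / 2" d])
    fix u v assume uv: "u \<in> ball x d" "v \<in> ball x d"
    have "norm ((f u - A u) - (f v - A v)) \<le> c / 2 * norm (u - v)"
    proof (rule differentiable_bound[OF convex_ball _ _ uv])
      fix y assume y: "y \<in> ball x d"
      show "((\<lambda>y. f y - A y) has_derivative (\<lambda>k. dirder k f y - A k)) (at y within ball x d)"
        by (intro has_derivative_diff has_derivative_at_withinI[OF Cr_on_has_derivative[OF f]]
            bounded_linear_imp_has_derivative bA)
      show "onorm (\<lambda>k. dirder k f y - A k) \<le> c / 2"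
      proof (rule onorm_le)
        fix k
        have "dirder k f y - A k = k $ 1 *\<^sub>R (partial 1 f y - partial 1 f x) + k $ 2 *\<^sub>R (partial 2 f y - partial 2 f x)"
          by (simp add: dirder_def A_def algebra_simps)
        also have "norm \<dots> \<le> \<bar>k $ 1\<bar> * norm (partial 1 f y - partial 1 f x) + \<bar>k $ 2\<bar> * norm (partial 2 f y - partial 2 f x)"
          by (rule norm_triangle_le) simp
        also have "\<dots> \<le> norm k * (c / 4) + norm k * (c / 4)"
          using y by (intro add_mono mult_mono component_le_norm_cart \<delta>) (auto simp: d_def dist_commute)
        finally show "norm (dirder k f y - A k) \<le> c / 2 * norm k" by simp
      qed
    qed
    moreover have "A u - A v = A (u - v)" using \<open>linear A\<close> by (simp add: linear_diff)
    hence "c * norm (u - v) \<le> norm (A u - A v)" using c by simp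
    moreover have "norm (A u - A v) \<le> norm (f u - f v) + norm ((f u - A u) - (f v - A v))"
      using norm_triangle_ineq4[of "f u - f v" "(f u - A u) - (f v - A v)"] by (simp add: algebra_simps)
    ultimately show "c / 2 * norm (u - v) \<le> norm (f u - f v)" by simp
  qed (use c d in auto)
qed

text \<open>If the ratios had no positive lower bound, pairs with ratio tending to 0 would
  accumulate at a, b with f a = f b; injectivity gives a = b, against the local bound at a. The
  result converts decay in the image distance into decay in \<open>norm (u - v)\<close>.\<close>

lemma bi_lipschitz_lower:
  fixes f :: "real^2 \<Rightarrow> real^2"
  assumes f: "Cr_on (Suc r) UNIV f" and det: "\<And>x. det (jacobian f (at x)) \<noteq> 0"
    and "inj f" and B: "compact B"
  obtains c where "c > 0" "\<And>u v. u \<in> B \<Longrightarrow> v \<in> B \<Longrightarrow> c * norm (u - v) \<le> norm (f u - f v)"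
proof -
  have cf: "continuous_on UNIV f" using f by simp
  have "\<exists>c>0. \<forall>u\<in>B. \<forall>v\<in>B. c * norm (u - v) \<le> norm (f u - f v)"
  proof (rule ccontr)
    assume neg: "\<not> ?thesis"
    have "\<exists>z. z \<in> B \<times> B \<and> norm (f (fst z) - f (snd z)) < inverse (real (Suc n)) * norm (fst z - snd z)" for n
      using neg[unfolded not_ex, rule_format, of "inverse (real (Suc n))"] by (force simp: not_le)
    then obtain z where z: "\<And>n. z n \<in> B \<times> B"
      "\<And>n. norm (f (fst (z n)) - f (snd (z n))) < inverse (real (Suc n)) * norm (fst (z n) - snd (z n))"
      by metis
    obtain l s where l: "l \<in> B \<times> B" "strict_mono (s :: nat \<Rightarrow> nat)" "(z \<circ> s) \<longlonglongrightarrow> l"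
      using compact_Times[OF B B] z(1) unfolding compact_def by blast
    define a b where "a = fst l" and "b = snd l"
    have ab: "(\<lambda>n. fst (z (s n))) \<longlonglongrightarrow> a" "(\<lambda>n. snd (z (s n))) \<longlonglongrightarrow> b"
      using tendsto_fst[OF l(3)] tendsto_snd[OF l(3)] by (auto simp: a_def b_def o_def)
    have inv: "(\<lambda>n. inverse (real (Suc (s n)))) \<longlonglongrightarrow> 0"
      using LIMSEQ_subseq_LIMSEQ[OF LIMSEQ_inverse_real_of_nat l(2)] by (simp add: o_def)
    have "(\<lambda>n. norm (f (fst (z (s n))) - f (snd (z (s n))))) \<longlonglongrightarrow> norm (f a - f b)"
      by (intro tendsto_intros continuous_on_tendsto_compose[OF cf] ab) auto
    moreover have "(\<lambda>n. inverse (real (Suc (s n))) * norm (fst (z (s n)) - snd (z (s n)))) \<longlonglongrightarrow> 0 * norm (a - b)"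
      by (intro tendsto_intros ab inv)
    ultimately have "norm (f a - f b) \<le> 0 * norm (a - b)"
      by (rule LIMSEQ_le) (use z(2) in \<open>auto intro: less_imp_le\<close>)
    hence "a = b" using \<open>inj f\<close> by (simp add: inj_eq)
    obtain c \<delta> where c: "c > 0" "\<delta> > 0"
      "\<And>u v. u \<in> ball a \<delta> \<Longrightarrow> v \<in> ball a \<delta> \<Longrightarrow> c * norm (u - v) \<le> norm (f u - f v)"
      using bi_lipschitz_lower_local[OF f det] by blast
    have "\<forall>\<^sub>F n in sequentially. dist (fst (z (s n))) a < \<delta>" "\<forall>\<^sub>F n in sequentially. dist (snd (z (s n))) b < \<delta>"
      "\<forall>\<^sub>F n in sequentially. inverse (real (Suc (s n))) < c"
      using tendstoD[OF ab(1) c(2)] tendstoD[OF ab(2) c(2)] order_tendstoD(2)[OF inv c(1)] by auto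
    hence "\<forall>\<^sub>F n in sequentially. False"
    proof eventually_elim
      case (elim n)
      hence "c * norm (fst (z (s n)) - snd (z (s n))) \<le> norm (f (fst (z (s n))) - f (snd (z (s n))))"
        using \<open>a = b\<close> by (intro c) (auto simp: dist_commute)
      also have "\<dots> < inverse (real (Suc (s n))) * norm (fst (z (s n)) - snd (z (s n)))" by (rule z(2))
      finally have "c < inverse (real (Suc (s n)))"
        by (simp add: mult_less_cancel_right)
      thus False using elim by simp
    qed
    thus False by simp
  qed
  thus thesis using that by blast
qed

text \<open>Uniform continuity of the directional derivative on a ball containing all the segments
  from \<open>w\<close> to \<open>w + (c / real n) *\<^sub>R h\<close> controls the linearisation
  error uniformly in \<open>w\<close>. The general \<open>a\<close> and \<open>c\<close> serve the
  three pairs of points of a second-order increment.\<close>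

lemma scaled_increment_uniform_limit:
  fixes f :: "real^2 \<Rightarrow> real^2"
  assumes f: "Cr_on (Suc r) UNIV f" and "bounded W" and "0 \<le> a" "a \<le> c"
  shows "uniform_limit W (\<lambda>n w. real n * norm (f (w + (c / real n) *\<^sub>R h) - f (w + (a / real n) *\<^sub>R h)))
      (\<lambda>w. (c - a) * norm (dirder h f w)) sequentially"
proof (rule uniform_limitI)
  fix e :: real assume e: "e > 0"
  obtain D where D: "\<And>w. w \<in> W \<Longrightarrow> norm w \<le> D" using \<open>bounded W\<close> unfolding bounded_iff by auto
  define K where "K = cball (0::real^2) (D + c * norm h)"
  have "uniformly_continuous_on K (dirder h f)"
    by (intro compact_uniformly_continuous dirder_continuous[OF f]) (simp add: K_def)
  moreover have "e / (c - a + 1) > 0" using e assms by simp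
  ultimately obtain \<delta> where \<delta>: "\<delta> > 0"
    "\<And>x y. x \<in> K \<Longrightarrow> y \<in> K \<Longrightarrow> dist x y < \<delta> \<Longrightarrow> dist (dirder h f x) (dirder h f y) < e / (c - a + 1)"
    unfolding uniformly_continuous_on_def by (metis dist_commute)
  have "(\<lambda>n. c * norm h / real n) \<longlonglongrightarrow> 0" by (rule lim_const_over_n)
  hence "\<forall>\<^sub>F n in sequentially. c * norm h / real n < \<delta>" using \<delta>(1) by (rule order_tendstoD)
  moreover have "\<forall>\<^sub>F n in sequentially. n \<ge> (1::nat)" by (rule eventually_ge_at_top)
  ultimately show "\<forall>\<^sub>F n in sequentially. \<forall>w\<in>W. dist (real n * norm (f (w + (c / real n) *\<^sub>R h) - f (w + (a / real n) *\<^sub>R h)))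
      ((c - a) * norm (dirder h f w)) < e"
  proof eventually_elim
    case (elim n)
    show ?case
    proof
      fix w assume w: "w \<in> W"
      have "norm (f (w + (c / real n) *\<^sub>R h) - f (w + (a / real n) *\<^sub>R h) - (c / real n - a / real n) *\<^sub>R dirder h f (w + 0 *\<^sub>R h))
         \<le> norm (c / real n - a / real n) * (e / (c - a + 1))"
      proof (rule vector_differentiable_bound_linearization[where S = "{0..c / real n}"])
        fix s assume s: "s \<in> {0..c / real n}"
        show "((\<lambda>s. f (w + s *\<^sub>R h)) has_vector_derivative dirder h f (w + s *\<^sub>R h)) (at s within {0..c / real n})"
          by (rule has_vector_derivative_at_within, rule Cr_on_line_derivative[OF f])
        have sh: "norm (s *\<^sub>R h) \<le> c * norm h / real n"
        proof -
          have "norm (s *\<^sub>R h) = s * norm h" using s by simp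
          also have "\<dots> \<le> c / real n * norm h" using s by (intro mult_right_mono) auto
          finally show ?thesis by simp
        qed
        also have "\<dots> \<le> c * norm h" 
        proof -
          have "c * norm h * 1 \<le> c * norm h * real n" using elim assms by (intro mult_left_mono) auto
          thus ?thesis using elim by (simp add: divide_le_eq)
        qed
        finally have "norm (w + s *\<^sub>R h) \<le> D + c * norm h" "norm w \<le> D + c * norm h"
          using norm_triangle_ineq[of w "s *\<^sub>R h"] D[OF w] assms by (auto intro: add_increasing2)
        hence "w + s *\<^sub>R h \<in> K" "w \<in> K" unfolding K_def mem_cball_0 .
        hence "dist (dirder h f (w + s *\<^sub>R h)) (dirder h f w) < e / (c - a + 1)"
          using sh elim by (intro \<delta>) (auto simp: dist_norm)
        thus "norm (dirder h f (w + s *\<^sub>R h) - dirder h f (w + 0 *\<^sub>R h)) \<le> e / (c - a + 1)"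
          by (simp add: dist_norm)
      qed (use assms elim in \<open>auto simp: closed_segment_eq_real_ivl divide_right_mono\<close>)
      hence "real n * norm (f (w + (c / real n) *\<^sub>R h) - f (w + (a / real n) *\<^sub>R h) - ((c - a) / real n) *\<^sub>R dirder h f w)
         \<le> real n * (((c - a) / real n) * (e / (c - a + 1)))"
        using assms by (intro mult_left_mono) (auto simp: diff_divide_distrib[symmetric])
      also have "\<dots> = (c - a) * e / (c - a + 1)" using elim by simp
      also have "\<dots> < e" using e assms by (simp add: field_simps)
      finally have 1: "real n * norm (f (w + (c / real n) *\<^sub>R h) - f (w + (a / real n) *\<^sub>R h) - ((c - a) / real n) *\<^sub>R dirder h f w) < e" .
      define x where "x = f (w + (c / real n) *\<^sub>R h) - f (w + (a / real n) *\<^sub>R h)"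
      define y where "y = ((c - a) / real n) *\<^sub>R dirder h f w"
      have "(c - a) * norm (dirder h f w) = real n * norm y"
        using elim assms by (simp add: y_def)
      hence "dist (real n * norm x) ((c - a) * norm (dirder h f w)) = real n * \<bar>norm x - norm y\<bar>"
        by (simp add: dist_real_def abs_mult right_diff_distrib[symmetric])
      also have "\<dots> \<le> real n * norm (x - y)" by (intro mult_left_mono norm_triangle_ineq3) auto
      finally show "dist (real n * norm (f (w + (c / real n) *\<^sub>R h) - f (w + (a / real n) *\<^sub>R h)))
      ((c - a) * norm (dirder h f w)) < e"
        using 1 by (simp add: x_def y_def)
    qed
  qed
qed

section \<open>Local asymptotics of the variogram\<close>

lemma variogram_ratio_tendsto:
  fixes R :: "real \<Rightarrow> real"
  assumes R: "(\<lambda>t. R t - (R 0 - t powr \<alpha>)) \<in> o[at_right 0](\<lambda>t. t powr (\<alpha> + \<gamma>))" and "\<gamma> > 0"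
  shows "((\<lambda>t. (R 0 - R t) / t powr \<alpha>) \<longlongrightarrow> 1) (at_right 0)"
proof -
  have pos: "\<forall>\<^sub>F t in at_right (0::real). 0 < t \<and> t < 1"
    by (intro eventually_conj eventually_at_right_less eventually_at_right_real[of 0 1, THEN eventually_mono]) auto
  have "(\<lambda>t. t powr (\<alpha> + \<gamma>)) \<in> O[at_right 0](\<lambda>t. t powr \<alpha>)"
  proof (rule bigoI[of _ 1])
    show "\<forall>\<^sub>F t in at_right 0. norm (t powr (\<alpha> + \<gamma>)) \<le> 1 * norm (t powr \<alpha>)"
      using pos by eventually_elim (use \<open>\<gamma> > 0\<close> in \<open>auto intro!: powr_mono'\<close>)
  qed
  with R have "(\<lambda>t. R t - (R 0 - t powr \<alpha>)) \<in> o[at_right 0](\<lambda>t. t powr \<alpha>)"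
    by (rule landau_o.small_big_trans)
  hence "((\<lambda>t. (R t - (R 0 - t powr \<alpha>)) / t powr \<alpha>) \<longlongrightarrow> 0) (at_right 0)"
    by (rule smalloD_tendsto)
  hence "((\<lambda>t. 1 - (R t - (R 0 - t powr \<alpha>)) / t powr \<alpha>) \<longlongrightarrow> 1 - 0) (at_right 0)"
    by (intro tendsto_intros)
  moreover have "\<forall>\<^sub>F t in at_right 0. 1 - (R t - (R 0 - t powr \<alpha>)) / t powr \<alpha> = (R 0 - R t) / t powr \<alpha>"
    using pos by eventually_elim (simp add: field_simps)
  ultimately have "((\<lambda>t. (R 0 - R t) / t powr \<alpha>) \<longlongrightarrow> 1 - 0) (at_right 0)"
    using tendsto_cong by fast
  thus ?thesis by simp
qed

text \<open>With d the image distance, the quantity factors into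
  \<open>(real n * d n w) powr \<alpha>\<close>, handled by the linearised increments, and the ratio
  \<open>(R 0 - R (d n w)) / d n w powr \<alpha>\<close>, which tends to 1 because d = O(1/n).
  Injectivity of \<open>f\<close> and \<open>h \<noteq> 0\<close> keep d positive.\<close>

lemma scaled_variogram_uniform_limit:
  fixes f :: "real^2 \<Rightarrow> real^2"
  assumes f: "Cr_on (Suc r) UNIV f" and "inj f" and "bounded W" and "0 \<le> a" "a < c" "h \<noteq> 0"
    and R: "(\<lambda>t. R t - (R 0 - t powr \<alpha>)) \<in> o[at_right 0](\<lambda>t. t powr (\<alpha> + \<gamma>))" and "\<gamma> > 0" "\<alpha> > 0"
  shows "uniform_limit W (\<lambda>n w. real n powr \<alpha> * (R 0 - R (norm (f (w + (c / real n) *\<^sub>R h) - f (w + (a / real n) *\<^sub>R h)))))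
      (\<lambda>w. ((c - a) * norm (dirder h f w)) powr \<alpha>) sequentially"
proof -
  define d where "d n w = norm (f (w + (c / real n) *\<^sub>R h) - f (w + (a / real n) *\<^sub>R h))" for n w
  define g where "g w = (c - a) * norm (dirder h f w)" for w
  have ul: "uniform_limit W (\<lambda>n w. real n * d n w) g sequentially"
    unfolding d_def g_def using assms by (intro scaled_increment_uniform_limit[OF f]) auto
  have "compact (closure W)" using \<open>bounded W\<close> by simp
  have "continuous_on (closure W) g"
    unfolding g_def by (intro continuous_intros dirder_continuous[OF f])
  hence bg: "bounded (g ` closure W)"
    using \<open>compact (closure W)\<close> compact_continuous_image compact_imp_bounded by blast
  then obtain G where "G > 0" "\<forall>x\<in>g ` closure W. norm x \<le> G"
    unfolding bounded_pos by blast
  hence G: "\<bar>g w\<bar> \<le> G" "G \<ge> 0" if "w \<in> W" for w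
    using closure_subset[of W] that by auto
  have ev: "\<forall>\<^sub>F n in sequentially. \<forall>w\<in>W. real n * d n w \<in> {0..G + 1}"
    using uniform_limitD[OF ul zero_less_one]
  proof eventually_elim
    case (elim n)
    show ?case
    proof
      fix w assume w: "w \<in> W"
      show "real n * d n w \<in> {0..G + 1}"
        using elim[rule_format, OF w] G(1)[OF w] by (auto simp: dist_real_def d_def)
    qed
  qed
  have ul1: "uniform_limit W (\<lambda>n w. (real n * d n w) powr \<alpha>) (\<lambda>w. g w powr \<alpha>) sequentially"
  proof (rule uniform_limit_compose_uniformly_continuous_on[OF ul _ ev])
    show "uniformly_continuous_on {0..G + 1} (\<lambda>x. x powr \<alpha>)"
      using \<open>\<alpha> > 0\<close> by (intro compact_uniformly_continuous continuous_on_powr') (auto intro!: continuous_intros)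
  qed auto
  have ul2: "uniform_limit W (\<lambda>n w. (R 0 - R (d n w)) / d n w powr \<alpha>) (\<lambda>w. 1) sequentially"
  proof (rule uniform_limitI)
    fix e :: real assume "e > 0"
    from tendstoD[OF variogram_ratio_tendsto[OF R \<open>\<gamma> > 0\<close>] this]
    obtain \<delta> where \<delta>: "\<delta> > 0" "\<And>t. 0 < t \<Longrightarrow> t < \<delta> \<Longrightarrow> dist ((R 0 - R t) / t powr \<alpha>) 1 < e"
      unfolding eventually_at_right_field by auto
    have "(\<lambda>n. (G + 1) / real n) \<longlonglongrightarrow> 0" by (rule lim_const_over_n)
    hence "\<forall>\<^sub>F n in sequentially. (G + 1) / real n < \<delta>" using \<delta>(1) by (rule order_tendstoD)
    moreover have "\<forall>\<^sub>F n in sequentially. n \<ge> (1::nat)" by (rule eventually_ge_at_top)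
    ultimately show "\<forall>\<^sub>F n in sequentially. \<forall>w\<in>W. dist ((R 0 - R (d n w)) / d n w powr \<alpha>) 1 < e"
      using ev
    proof eventually_elim
      case (elim n)
      show ?case
      proof
        fix w assume w: "w \<in> W"
        have "d n w > 0"
        proof -
          have "(c / real n) *\<^sub>R h \<noteq> (a / real n) *\<^sub>R h" using elim assms by auto
          thus ?thesis unfolding d_def using \<open>inj f\<close> by (simp add: inj_eq)
        qed
        moreover have "d n w < \<delta>"
        proof -
          have "real n * d n w \<le> G + 1" using elim w by auto
          hence "d n w \<le> (G + 1) / real n" using elim by (simp add: field_simps)
          thus ?thesis using elim by linarith
        qed
        ultimately show "dist ((R 0 - R (d n w)) / d n w powr \<alpha>) 1 < e" by (rule \<delta>)
      qed
    qed
  qed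
  have "bounded ((\<lambda>w. g w powr \<alpha>) ` W)"
  proof -
    have "\<bar>g w powr \<alpha>\<bar> \<le> G powr \<alpha>" if "w \<in> W" for w
    proof -
      have "g w \<ge> 0" using assms by (simp add: g_def)
      thus ?thesis using G(1)[OF that] \<open>\<alpha> > 0\<close> by (auto intro!: powr_mono2)
    qed
    thus ?thesis unfolding bounded_iff by auto
  qed
  hence "uniform_limit W (\<lambda>n w. (real n * d n w) powr \<alpha> * ((R 0 - R (d n w)) / d n w powr \<alpha>)) (\<lambda>w. g w powr \<alpha> * 1) sequentially"
    by (intro uniform_lim_mult ul1 ul2) (auto simp: bounded_iff)
  \<comment> \<open>The identity persists at d = 0, where both sides are 0.\<close>
  moreover have "(real n * d n w) powr \<alpha> * ((R 0 - R (d n w)) / d n w powr \<alpha>) = real n powr \<alpha> * (R 0 - R (d n w))" for n w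
    by (cases "d n w = 0") (auto simp: powr_mult d_def)
  ultimately show ?thesis by (simp add: d_def g_def)
qed

text \<open>The variance of the increment with coefficients 1, -2, 1, written in values of
  \<open>R 0 - R\<close>; this is possible because the coefficients sum to 0. The three distances
  behave like 1, 1 and 2 times |J h| / n, so the limit constant is 4 + 4 - 2 * 2^\<alpha> = 8 -
  2^(\<alpha>+1).\<close>

definition D2_variance :: "(real \<Rightarrow> real) \<Rightarrow> (real^2 \<Rightarrow> real^2) \<Rightarrow> real^2 \<Rightarrow> real^2 \<Rightarrow> real" where
  "D2_variance R f k w = 4 * (R 0 - R (norm (f (w + k) - f w))) +
     4 * (R 0 - R (norm (f (w + 2 *\<^sub>R k) - f (w + k)))) -
     2 * (R 0 - R (norm (f (w + 2 *\<^sub>R k) - f w)))"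

lemma D2_variance_uniform_limit:
  fixes f :: "real^2 \<Rightarrow> real^2"
  assumes f: "Cr_on (Suc r) UNIV f" and "inj f" and "bounded W" and "h \<noteq> 0"
    and R: "(\<lambda>t. R t - (R 0 - t powr \<alpha>)) \<in> o[at_right 0](\<lambda>t. t powr (\<alpha> + \<gamma>))" and "\<gamma> > 0" "\<alpha> > 0"
  shows "uniform_limit W (\<lambda>n w. real n powr \<alpha> * D2_variance R f (h /\<^sub>R real n) w)
      (\<lambda>w. (8 - 2 powr (\<alpha> + 1)) * norm (dirder h f w) powr \<alpha>) sequentially"
proof -
  note L = scaled_variogram_uniform_limit[OF f \<open>inj f\<close> \<open>bounded W\<close> _ _ \<open>h \<noteq> 0\<close> R \<open>\<gamma> > 0\<close> \<open>\<alpha> > 0\<close>]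
  define V where "V c a n w = real n powr \<alpha> * (R 0 - R (norm (f (w + (c / real n) *\<^sub>R h) - f (w + (a / real n) *\<^sub>R h))))" for c a n w
  define g where "g w = norm (dirder h f w)" for w
  have cm: "uniform_limit W (\<lambda>n w. k * F n w) (\<lambda>w. k * G w) sequentially"
    if "uniform_limit W F G sequentially" for k :: real and F :: "nat \<Rightarrow> real^2 \<Rightarrow> real" and G
    by (rule bounded_linear.uniform_limit[OF bounded_linear_mult_right that])
  have "uniform_limit W (\<lambda>n w. 4 * V 1 0 n w + 4 * V 2 1 n w - 2 * V 2 0 n w)
     (\<lambda>w. 4 * (1 * g w) powr \<alpha> + 4 * (1 * g w) powr \<alpha> - 2 * (2 * g w) powr \<alpha>) sequentially"
    using L[of 0 1] L[of 1 2] L[of 0 2] unfolding V_def g_def by (intro uniform_limit_add uniform_limit_minus cm) auto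
  moreover have "4 * V 1 0 n w + 4 * V 2 1 n w - 2 * V 2 0 n w = real n powr \<alpha> * D2_variance R f (h /\<^sub>R real n) w" for n w
    by (simp add: V_def D2_variance_def algebra_simps divide_inverse)
  moreover have "4 * (1 * g w) powr \<alpha> + 4 * (1 * g w) powr \<alpha> - 2 * (2 * g w) powr \<alpha> =
     (8 - 2 powr (\<alpha> + 1)) * g w powr \<alpha>" for w
    by (simp add: powr_mult powr_add g_def algebra_simps)
  ultimately show ?thesis by (simp add: g_def)
qed

section \<open>Lattice sums\<close>

lemma scaled_lattice_floor:
  assumes "w \<in> scaled_lattice n" "n \<ge> 1"
  shows "real_of_int \<lfloor>real n * w $ i\<rfloor> = real n * w $ i"
proof -
  obtain k :: int where "w $ i = of_int k / of_nat n" using assms unfolding scaled_lattice_def by blast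
  thus ?thesis using assms(2) by simp
qed

lemma scaled_lattice_inj:
  assumes "n \<ge> 1"
  shows "inj_on (\<lambda>w. (\<lfloor>real n * w $ 1\<rfloor>, \<lfloor>real n * w $ 2\<rfloor>)) (scaled_lattice n)"
proof (rule inj_onI)
  fix w v assume wv: "w \<in> scaled_lattice n" "v \<in> scaled_lattice n"
    and eq: "(\<lfloor>real n * w $ 1\<rfloor>, \<lfloor>real n * w $ 2\<rfloor>) = (\<lfloor>real n * v $ 1\<rfloor>, \<lfloor>real n * v $ 2\<rfloor>)"
  have "real n * w $ i = real n * v $ i" for i
    using eq scaled_lattice_floor[OF wv(1) assms, of i] scaled_lattice_floor[OF wv(2) assms, of i] exhaust_2[of i]
    by (metis Pair_inject)
  thus "w = v" using assms by (simp add: vec_eq_iff)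
qed

text \<open>The ball lies in a square, each side of which contains at most 2 n r + 1 multiples of
  1/n; the floors serve as integer coordinates of lattice points.\<close>

lemma scaled_lattice_cball:
  assumes n: "n \<ge> 1" and r: "r \<ge> 0"
  shows "finite (scaled_lattice n \<inter> cball x r)"
    and "real (card (scaled_lattice n \<inter> cball x r)) \<le> (2 * real n * r + 1)\<^sup>2"
proof -
  define J where "J i = {\<lceil>real n * (x $ i - r)\<rceil>..\<lfloor>real n * (x $ i + r)\<rfloor>}" for i
  let ?\<kappa> = "\<lambda>w::real^2. (\<lfloor>real n * w $ 1\<rfloor>, \<lfloor>real n * w $ 2\<rfloor>)"
  have sub: "?\<kappa> ` (scaled_lattice n \<inter> cball x r) \<subseteq> J 1 \<times> J 2"
  proof -
    have "\<lfloor>real n * w $ i\<rfloor> \<in> J i" if w: "w \<in> scaled_lattice n" "w \<in> cball x r" for w i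
    proof -
      have "\<bar>(w - x) $ i\<bar> \<le> r"
        using component_le_norm_cart[of "w - x" i] w(2) by (simp add: dist_norm norm_minus_commute)
      hence "x $ i - r \<le> w $ i" "w $ i \<le> x $ i + r" by auto
      hence h: "real n * (x $ i - r) \<le> real_of_int \<lfloor>real n * w $ i\<rfloor>"
         "real_of_int \<lfloor>real n * w $ i\<rfloor> \<le> real n * (x $ i + r)"
        unfolding scaled_lattice_floor[OF w(1) n] by (auto intro: mult_left_mono)
      show ?thesis unfolding J_def atLeastAtMost_iff
        by (intro conjI ceiling_le[OF h(1)] le_floor_iff[THEN iffD2, OF h(2)])
    qed
    thus ?thesis by auto
  qed
  have inj: "inj_on ?\<kappa> (scaled_lattice n \<inter> cball x r)"
    by (rule inj_on_subset[OF scaled_lattice_inj[OF n]]) auto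
  have fJ: "finite (J 1 \<times> J 2)" by (simp add: J_def)
  show "finite (scaled_lattice n \<inter> cball x r)"
    using finite_imageD[OF finite_subset[OF sub fJ] inj] .
  have "card (scaled_lattice n \<inter> cball x r) \<le> card (J 1 \<times> J 2)"
    using card_mono[OF fJ sub] card_image[OF inj] by simp
  hence "real (card (scaled_lattice n \<inter> cball x r)) \<le> real (card (J 1)) * real (card (J 2))"
    by (simp add: card_cartesian_product flip: of_nat_mult)
  also have "\<dots> \<le> (2 * real n * r + 1) * (2 * real n * r + 1)"
  proof -
    have "real (card (J i)) \<le> 2 * real n * r + 1" for i
    proof -
      have "real_of_int \<lfloor>real n * (x $ i + r)\<rfloor> - real_of_int \<lceil>real n * (x $ i - r)\<rceil> + 1
          \<le> real n * (x $ i + r) - real n * (x $ i - r) + 1"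
        using of_int_floor_le[of "real n * (x $ i + r)"] le_of_int_ceiling[of "real n * (x $ i - r)"] by linarith
      also have "\<dots> = 2 * real n * r + 1" by (simp add: algebra_simps)
      finally have "real_of_int (\<lfloor>real n * (x $ i + r)\<rfloor> - \<lceil>real n * (x $ i - r)\<rceil> + 1) \<le> 2 * real n * r + 1"
        by simp
      moreover have "real (nat z) \<le> B" if "real_of_int z \<le> B" "0 \<le> B" for z B
        using that by (cases "z \<ge> 0") auto
      ultimately show ?thesis using r unfolding J_def card_atLeastAtMost_int by (simp add: algebra_simps)
    qed
    thus ?thesis using r by (intro mult_mono) auto
  qed
  finally show "real (card (scaled_lattice n \<inter> cball x r)) \<le> (2 * real n * r + 1)\<^sup>2"
    by (simp add: power2_eq_square)
qed

text \<open>On the nonnegative and on the negative integers the absolute value is injective, so each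
  half is compared with one convergent p-series.\<close>

lemma finite_int_sum_bounded:
  fixes s :: real
  assumes "s > 1"
  obtains C where "C > 0" "\<And>J :: int set. finite J \<Longrightarrow> (\<Sum>j\<in>J. (1 + \<bar>real_of_int j\<bar>) powr (- s)) \<le> C"
proof -
  define a where "a i = (1 + real i) powr (- s)" for i :: nat
  have "summable (\<lambda>i. real i powr (- s))" using assms by (simp add: summable_real_powr_iff)
  hence "summable (\<lambda>i. real (Suc i) powr (- s))" by (subst summable_Suc_iff)
  hence sm: "summable a" by (simp add: a_def[abs_def])
  have a0: "a i \<ge> 0" for i by (simp add: a_def)
  have "(\<Sum>j\<in>J. (1 + \<bar>real_of_int j\<bar>) powr (- s)) \<le> 2 * suminf a + 1" if "finite J" for J :: "int set"
  proof -
    have 1: "(\<Sum>j\<in>J'. (1 + \<bar>real_of_int j\<bar>) powr (- s)) \<le> suminf a"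
      if "finite J'" "inj_on (\<lambda>j. nat \<bar>j\<bar>) J'" for J' :: "int set"
    proof -
      have "(\<Sum>j\<in>J'. (1 + \<bar>real_of_int j\<bar>) powr (- s)) = (\<Sum>j\<in>J'. a (nat \<bar>j\<bar>))"
        by (simp add: a_def)
      also have "\<dots> = sum a ((\<lambda>j. nat \<bar>j\<bar>) ` J')" using that by (simp add: sum.reindex)
      also have "\<dots> \<le> suminf a" using that by (intro sum_le_suminf sm a0) auto
      finally show ?thesis .
    qed
    have "(\<Sum>j\<in>J. (1 + \<bar>real_of_int j\<bar>) powr (- s)) =
       (\<Sum>j\<in>J \<inter> {0..}. (1 + \<bar>real_of_int j\<bar>) powr (- s)) + (\<Sum>j\<in>J - {0..}. (1 + \<bar>real_of_int j\<bar>) powr (- s))"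
      using that by (rule sum.Int_Diff)
    also have "\<dots> \<le> suminf a + suminf a"
      using that by (intro add_mono 1) (auto simp: inj_on_def)
    finally show ?thesis by simp
  qed
  moreover have "2 * suminf a + 1 > 0" using suminf_nonneg[OF sm a0] by simp
  ultimately show thesis using that by blast
qed

text \<open>The integer coordinates of v - w are at most r = n |w - v| in absolute value, and r
  \<ge> 1, so (1 + |j1|) (1 + |j2|) \<le> (2 r)^2. The sum is thus dominated by a product of two
  one-dimensional sums with exponent e/2, which converge because e > 2.\<close>

lemma scaled_lattice_power_sum:
  fixes e :: real
  assumes "e > 2"
  obtains C where "C > 0"
    "\<And>n w A. n \<ge> 1 \<Longrightarrow> w \<in> scaled_lattice n \<Longrightarrow> finite A \<Longrightarrow> A \<subseteq> scaled_lattice n - {w} \<Longrightarrow>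
       (\<Sum>v\<in>A. norm (w - v) powr (- e)) \<le> C * real n powr e"
proof -
  obtain C where C: "C > 0" "\<And>J :: int set. finite J \<Longrightarrow> (\<Sum>j\<in>J. (1 + \<bar>real_of_int j\<bar>) powr (- (e/2))) \<le> C"
    using finite_int_sum_bounded[of "e/2"] assms by auto
  have "(\<Sum>v\<in>A. norm (w - v) powr (- e)) \<le> (4 powr (e/2) * C\<^sup>2) * real n powr e"
    if n: "n \<ge> 1" and w: "w \<in> scaled_lattice n" and A: "finite A" "A \<subseteq> scaled_lattice n - {w}" for n w A
  proof -
    define \<kappa> where "\<kappa> v i = \<lfloor>real n * v $ i\<rfloor> - \<lfloor>real n * w $ i\<rfloor>" for v :: "real^2" and i
    define p where "p v = (\<kappa> v 1, \<kappa> v 2)" for v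
    define q where "q j = (1 + \<bar>real_of_int j\<bar>) powr (- (e/2))" for j
    have k: "real_of_int (\<kappa> v i) = real n * (v - w) $ i" if "v \<in> A" for v i
    proof -
      have "v \<in> scaled_lattice n" using that A by auto
      thus ?thesis unfolding \<kappa>_def
        by (simp add: scaled_lattice_floor[OF _ n] w right_diff_distrib)
    qed
    have inj: "inj_on p A"
    proof (rule inj_onI)
      fix v v' assume v: "v \<in> A" "v' \<in> A" "p v = p v'"
      have "\<kappa> v i = \<kappa> v' i" for i using v(3) exhaust_2[of i] by (auto simp: p_def)
      hence "real n * (v - w) $ i = real n * (v' - w) $ i" for i using k[OF v(1)] k[OF v(2)] by metis
      thus "v = v'" using n by (simp add: vec_eq_iff)
    qed
    have bd: "norm (w - v) powr (- e) \<le> real n powr e * 4 powr (e/2) * (q (fst (p v)) * q (snd (p v)))" if v: "v \<in> A" for v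
    proof -
      define r where "r = real n * norm (w - v)"
      have "v \<noteq> w" using v A by auto
      have ki: "\<bar>real_of_int (\<kappa> v i)\<bar> \<le> r" for i
        using component_le_norm_cart[of "v - w" i] n by (simp add: k[OF v] r_def abs_mult norm_minus_commute mult_left_mono)
      have "r \<ge> 1"
      proof -
        obtain i where i: "v $ i \<noteq> w $ i" using \<open>v \<noteq> w\<close> by (auto simp: vec_eq_iff)
        hence "real_of_int (\<kappa> v i) \<noteq> 0" using n by (simp add: k[OF v])
        hence "\<bar>\<kappa> v i\<bar> \<ge> 1" by auto
        hence "\<bar>real_of_int (\<kappa> v i)\<bar> \<ge> 1" by (metis of_int_1_le_iff of_int_abs)
        thus ?thesis using ki[of i] by linarith
      qed
      hence "(1 + \<bar>real_of_int (\<kappa> v 1)\<bar>) * (1 + \<bar>real_of_int (\<kappa> v 2)\<bar>) \<le> (2 * r) * (2 * r)"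
        using ki[of 1] ki[of 2] by (intro mult_mono) auto
      hence "(2 * r * (2 * r)) powr (- (e/2)) \<le>
          ((1 + \<bar>real_of_int (\<kappa> v 1)\<bar>) * (1 + \<bar>real_of_int (\<kappa> v 2)\<bar>)) powr (- (e/2))"
        using assms by (intro powr_mono2') (auto intro!: mult_pos_pos)
      also have "\<dots> = q (fst (p v)) * q (snd (p v))"
        by (simp add: powr_mult q_def p_def)
      finally have 1: "(2 * r * (2 * r)) powr (- (e/2)) \<le> q (fst (p v)) * q (snd (p v))" .
      have rp: "r > 0" "norm (w - v) > 0" "real n > 0" using \<open>r \<ge> 1\<close> \<open>v \<noteq> w\<close> n by auto
      have "(2 * r * (2 * r)) powr (- (e/2)) = 4 powr (- (e/2)) * (r powr (-(e/2)) * r powr (-(e/2)))"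
      proof -
        have "2 * r * (2 * r) = 4 * (r * r)" by simp
        thus ?thesis using rp by (simp only: powr_mult)
      qed
      also have "r powr (-(e/2)) * r powr (-(e/2)) = r powr (- e)"
        by (simp add: powr_add[symmetric])
      also have "r powr (- e) = real n powr (- e) * norm (w - v) powr (- e)"
        using rp by (simp add: r_def powr_mult)
      finally have 2: "4 powr (- (e/2)) * (real n powr (- e) * norm (w - v) powr (- e)) \<le> q (fst (p v)) * q (snd (p v))"
        using 1 by simp
      have "norm (w - v) powr (- e) = real n powr e * 4 powr (e/2) * (4 powr (- (e/2)) * (real n powr (- e) * norm (w - v) powr (- e)))"
        using rp by (simp add: powr_minus field_simps)
      also have "\<dots> \<le> real n powr e * 4 powr (e/2) * (q (fst (p v)) * q (snd (p v)))"
        by (intro mult_left_mono 2) auto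
      finally show ?thesis .
    qed
    have "(\<Sum>v\<in>A. norm (w - v) powr (- e)) \<le> (\<Sum>v\<in>A. real n powr e * 4 powr (e/2) * (q (fst (p v)) * q (snd (p v))))"
      by (intro sum_mono bd)
    also have "\<dots> = real n powr e * 4 powr (e/2) * (\<Sum>z\<in>p ` A. q (fst z) * q (snd z))"
      by (simp add: sum.reindex[OF inj] sum_distrib_left o_def)
    finally have S: "(\<Sum>v\<in>A. norm (w - v) powr (- e)) \<le> real n powr e * 4 powr (e/2) * (\<Sum>z\<in>p ` A. q (fst z) * q (snd z))" .
    \<comment> \<open>The index set is enlarged to the product of its projections, over which the
      sum factorises.\<close>
    have "(\<Sum>z\<in>p ` A. q (fst z) * q (snd z)) \<le> (\<Sum>z\<in>fst ` p ` A \<times> snd ` p ` A. q (fst z) * q (snd z))"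
    proof (rule sum_mono2)
      show "p ` A \<subseteq> fst ` p ` A \<times> snd ` p ` A" by (auto simp: image_iff) (metis fst_conv, metis snd_conv)
    qed (use A in \<open>auto simp: q_def\<close>)
    also have "\<dots> = (\<Sum>j\<in>fst ` p ` A. q j) * (\<Sum>j\<in>snd ` p ` A. q j)"
      by (simp add: sum_product sum.cartesian_product case_prod_beta)
    also have "\<dots> \<le> C * C"
      using C A by (intro mult_mono) (auto simp: q_def intro!: sum_nonneg)
    finally have "real n powr e * 4 powr (e/2) * (\<Sum>z\<in>p ` A. q (fst z) * q (snd z)) \<le> real n powr e * 4 powr (e/2) * (C * C)"
      by (intro mult_left_mono) auto
    with S show ?thesis by (simp add: mult_ac power2_eq_square)
  qed
  moreover have "4 powr (e/2) * C\<^sup>2 > 0" using C by simp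
  ultimately show thesis using that by blast
qed

section \<open>Riemann sums over lattice cells\<close>

definition lattice_floor :: "nat \<Rightarrow> real^2 \<Rightarrow> real^2" where
  "lattice_floor n y = (\<chi> i. of_int \<lfloor>real n * y $ i\<rfloor> / real n)"

lemma lattice_floor_in_scaled_lattice: "lattice_floor n y \<in> scaled_lattice n"
  unfolding scaled_lattice_def lattice_floor_def by auto

lemma norm_lattice_floor_diff:
  assumes "n \<ge> 1" shows "norm (lattice_floor n y - y) \<le> 2 / real n"
proof -
  have c: "\<bar>(lattice_floor n y - y) $ i\<bar> \<le> 1 / real n" for i
  proof -
    have "(lattice_floor n y - y) $ i = (of_int \<lfloor>real n * y $ i\<rfloor> - real n * y $ i) / real n"
      using assms by (simp add: lattice_floor_def field_simps)
    moreover have "\<bar>of_int \<lfloor>real n * y $ i\<rfloor> - real n * y $ i\<bar> \<le> 1" by linarith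
    ultimately show ?thesis using assms by (simp add: divide_right_mono)
  qed
  hence "(\<Sum>i\<in>UNIV. \<bar>(lattice_floor n y - y) $ i\<bar>) \<le> 1 / real n + 1 / real n"
    unfolding UNIV_2 using add_mono[OF c[of 1] c[of 2]] by simp
  thus ?thesis using norm_le_l1_cart[of "lattice_floor n y - y"] by simp
qed

text \<open>The lattice cell at \<open>w\<close>, seen in the rescaled coordinate \<open>x = (y - t) / b\<close>.\<close>

definition cell :: "nat \<Rightarrow> real \<Rightarrow> real^2 \<Rightarrow> real^2 \<Rightarrow> (real^2) set" where
  "cell n b t w = {x. lattice_floor n (t + b *\<^sub>R x) = w}"

lemma cell_eq_box:
  assumes n: "n \<ge> 1" and b: "b > 0" and w: "w \<in> scaled_lattice n"
  shows "cell n b t w = {x. \<forall>i. (w $ i - t $ i) / b \<le> x $ i \<and> x $ i < (w $ i - t $ i) / b + 1 / (real n * b)}"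
proof -
  have "lattice_floor n (t + b *\<^sub>R x) $ i = w $ i \<longleftrightarrow>
     (w $ i - t $ i) / b \<le> x $ i \<and> x $ i < (w $ i - t $ i) / b + 1 / (real n * b)" for x i
  proof -
    obtain k :: int where k: "w $ i = of_int k / real n" using w unfolding scaled_lattice_def by blast
    have "lattice_floor n (t + b *\<^sub>R x) $ i = w $ i \<longleftrightarrow> \<lfloor>real n * (t $ i + b * x $ i)\<rfloor> = k"
      using n by (simp add: lattice_floor_def k)
    also have "\<dots> \<longleftrightarrow> of_int k \<le> real n * (t $ i + b * x $ i) \<and> real n * (t $ i + b * x $ i) < of_int k + 1"
      by (rule floor_eq_iff)
    also have "of_int k = real n * w $ i" using n by (simp add: k)
    also have "real n * w $ i \<le> real n * (t $ i + b * x $ i) \<longleftrightarrow> (w $ i - t $ i) / b \<le> x $ i"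
      using n b by (simp add: pos_divide_le_eq mult_le_cancel_left_pos) (simp add: algebra_simps)
    also have "real n * (t $ i + b * x $ i) < real n * w $ i + 1 \<longleftrightarrow> x $ i < (w $ i - t $ i) / b + 1 / (real n * b)"
      using n b by (simp add: field_simps)
    finally show ?thesis .
  qed
  thus ?thesis unfolding cell_def vec_eq_iff by auto
qed

lemma cell_measurable [measurable]: "cell n b t w \<in> sets borel"
proof -
  have "(\<lambda>x::real^2. lattice_floor n (t + b *\<^sub>R x) $ i) \<in> borel_measurable borel" for i
    unfolding lattice_floor_def by simp
  note [measurable] = this
  have "{x \<in> space borel. lattice_floor n (t + b *\<^sub>R x) $ 1 = w $ 1 \<and> lattice_floor n (t + b *\<^sub>R x) $ 2 = w $ 2} \<in> sets borel"
    by measurable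
  thus ?thesis unfolding cell_def vec_eq_iff forall_2 by simp
qed

text \<open>The cell lies between an open and a closed box of the same volume.\<close>

lemma emeasure_cell:
  assumes n: "n \<ge> 1" and b: "b > 0" and w: "w \<in> scaled_lattice n"
  shows "emeasure lborel (cell n b t w) = ennreal (1 / (real n * b)\<^sup>2)"
proof -
  define l u :: "real^2" where "l = (\<chi> i. (w $ i - t $ i) / b)" and "u = (\<chi> i. (w $ i - t $ i) / b + 1 / (real n * b))"
  have d: "1 / (real n * b) > 0" using n b by simp
  have pr: "(\<Prod>v\<in>(Basis :: (real^2) set). (u - l) \<bullet> v) = 1 / (real n * b)\<^sup>2"
    by (simp add: Basis_vec_def UNIV_2 cart_eq_inner_axis[symmetric] u_def l_def axis_eq_axis power2_eq_square prod.insert)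
  have le: "l \<bullet> v \<le> u \<bullet> v" if "v \<in> Basis" for v
    using that d by (auto simp: Basis_vec_def cart_eq_inner_axis[symmetric] u_def l_def less_imp_le)
  have "box l u \<subseteq> cell n b t w" "cell n b t w \<subseteq> cbox l u"
    by (auto simp: cell_eq_box[OF assms] mem_box_cart l_def u_def less_imp_le)
  hence "emeasure lborel (box l u) \<le> emeasure lborel (cell n b t w)"
    "emeasure lborel (cell n b t w) \<le> emeasure lborel (cbox l u)"
    by (auto intro!: emeasure_mono)
  thus ?thesis using le by (simp add: emeasure_lborel_box emeasure_lborel_cbox pr)
qed

text \<open>The cell has volume 1 / (n b)^2, and its points are within 2 / (n b) of (w - t) / b,
  where 2 / n bounds the rounding error; the bound is \<open>L\<close> times the product.\<close>

lemma cell_integral_error: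
  fixes K :: "real^2 \<Rightarrow> real"
  assumes n: "n \<ge> 1" and b: "b > 0" and w: "w \<in> scaled_lattice n"
    and K: "integrable lborel K" and L: "\<And>x y. \<bar>K x - K y\<bar> \<le> L * norm (x - y)"
  shows "\<bar>(LINT x|lborel. indicator (cell n b t w) x * K x) - K ((w - t) /\<^sub>R b) / (real n * b)\<^sup>2\<bar>
     \<le> 2 * L / (real n * b) ^ 3"
proof -
  let ?c = "cell n b t w"
  have ms: "measure lborel ?c = 1 / (real n * b)\<^sup>2"
    using emeasure_cell[OF n b w, of t] by (simp add: measure_def)
  have i1: "integrable lborel (\<lambda>x. indicator ?c x * k)" for k :: real
    using emeasure_cell[OF n b w, of t] by (intro integrable_mult_left integrable_real_indicator) auto
  have i2: "integrable lborel (\<lambda>x. indicator ?c x * K x)"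
    by (rule Bochner_Integration.integrable_bound[OF K]) (use K in \<open>auto simp: indicator_def\<close>)
  \<comment> \<open>The sign of \<open>L\<close> is read off the Lipschitz inequality at two points
    at distance 1.\<close>
  have "L \<ge> 0" using L[of 0 "axis 1 1"] abs_ge_zero[of "K 0 - K (axis 1 1)"]
    by (simp add: norm_axis_1)
  have "(LINT x|lborel. indicator ?c x * k) = k / (real n * b)\<^sup>2" for k :: real
    by (simp add: ms)
  hence "(LINT x|lborel. indicator ?c x * K x) - K ((w - t) /\<^sub>R b) / (real n * b)\<^sup>2 =
     (LINT x|lborel. indicator ?c x * K x - indicator ?c x * K ((w - t) /\<^sub>R b))"
    using i1 i2 by simp
  hence "\<bar>(LINT x|lborel. indicator ?c x * K x) - K ((w - t) /\<^sub>R b) / (real n * b)\<^sup>2\<bar> =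
     \<bar>LINT x|lborel. indicator ?c x * K x - indicator ?c x * K ((w - t) /\<^sub>R b)\<bar>" by simp
  also have "\<dots> \<le> (LINT x|lborel. \<bar>indicator ?c x * K x - indicator ?c x * K ((w - t) /\<^sub>R b)\<bar>)"
    by (rule integral_abs_bound)
  also have "\<dots> \<le> (LINT x|lborel. indicator ?c x * (2 * L / (real n * b)))"
  proof (rule integral_mono)
    show "integrable lborel (\<lambda>x. \<bar>indicator ?c x * K x - indicator ?c x * K ((w - t) /\<^sub>R b)\<bar>)"
      using i1 i2 by (intro integrable_abs Bochner_Integration.integrable_diff)
    fix x
    show "\<bar>indicator ?c x * K x - indicator ?c x * K ((w - t) /\<^sub>R b)\<bar> \<le> indicator ?c x * (2 * L / (real n * b))"
    proof (cases "x \<in> ?c")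
      case True
      hence "norm (w - (t + b *\<^sub>R x)) \<le> 2 / real n"
        using norm_lattice_floor_diff[OF n, of "t + b *\<^sub>R x"] by (simp add: cell_def)
      moreover have "x - (w - t) /\<^sub>R b = - ((w - (t + b *\<^sub>R x)) /\<^sub>R b)"
        using b by (simp add: algebra_simps)
      ultimately have "norm (x - (w - t) /\<^sub>R b) \<le> 2 / real n / b"
        using b by (simp add: divide_inverse mult.commute)
      hence "L * norm (x - (w - t) /\<^sub>R b) \<le> L * (2 / real n / b)" using \<open>L \<ge> 0\<close> by (rule mult_left_mono)
      thus ?thesis using True L[of x "(w - t) /\<^sub>R b"] by (simp add: mult.commute)
    qed simp
  qed (rule i1)
  also have "\<dots> = 2 * L / (real n * b) ^ 3"
    by (simp add: ms power2_eq_square power3_eq_cube)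
  finally show ?thesis .
qed

text \<open>Cell errors are added over \<open>A\<close>. When \<open>A\<close> is the set of lattice
  points of a bounded region it has O(n^2) elements, and the total error is of order 1 / (n
  b^3).\<close>

lemma riemann_sum_error:
  fixes K :: "real^2 \<Rightarrow> real"
  assumes n: "n \<ge> 1" and b: "b > 0" and A: "finite A" "A \<subseteq> scaled_lattice n"
    and K: "integrable lborel K" and L: "\<And>x y. \<bar>K x - K y\<bar> \<le> L * norm (x - y)"
    and c: "\<And>w. w \<in> A \<Longrightarrow> \<bar>c w\<bar> \<le> B"
  shows "\<bar>1 / ((real n)\<^sup>2 * b\<^sup>2) * (\<Sum>w\<in>A. K ((w - t) /\<^sub>R b) * c w) -
      (LINT x|lborel. (\<Sum>w\<in>A. indicator (cell n b t w) x * c w) * K x)\<bar> \<le> B * real (card A) * (2 * L / (real n * b) ^ 3)"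
proof -
  have i2: "integrable lborel (\<lambda>x. c w * (indicator (cell n b t w) x * K x))" for w
    by (rule integrable_mult_right, rule Bochner_Integration.integrable_bound[OF K])
       (use K in \<open>auto simp: indicator_def\<close>)
  have "(LINT x|lborel. (\<Sum>w\<in>A. indicator (cell n b t w) x * c w) * K x) =
    (LINT x|lborel. (\<Sum>w\<in>A. c w * (indicator (cell n b t w) x * K x)))"
    by (intro Bochner_Integration.integral_cong refl) (simp only: sum_distrib_right, simp only: mult_ac)
  also have "\<dots> = (\<Sum>w\<in>A. c w * (LINT x|lborel. indicator (cell n b t w) x * K x))"
    by (subst Bochner_Integration.integral_sum[OF i2]) simp
  finally have eq: "1 / ((real n)\<^sup>2 * b\<^sup>2) * (\<Sum>w\<in>A. K ((w - t) /\<^sub>R b) * c w) -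
      (LINT x|lborel. (\<Sum>w\<in>A. indicator (cell n b t w) x * c w) * K x) =
     (\<Sum>w\<in>A. c w * (K ((w - t) /\<^sub>R b) / (real n * b)\<^sup>2 - (LINT x|lborel. indicator (cell n b t w) x * K x)))"
    by (simp add: sum_distrib_left sum_divide_distrib sum_subtractf power_mult_distrib right_diff_distrib mult_ac)
  have "\<bar>\<Sum>w\<in>A. c w * (K ((w - t) /\<^sub>R b) / (real n * b)\<^sup>2 - (LINT x|lborel. indicator (cell n b t w) x * K x))\<bar>
     \<le> (\<Sum>w\<in>A. B * (2 * L / (real n * b) ^ 3))"
  proof (rule order_trans[OF sum_abs], rule sum_mono)
    fix w assume w: "w \<in> A"
    have "\<bar>K ((w - t) /\<^sub>R b) / (real n * b)\<^sup>2 - (LINT x|lborel. indicator (cell n b t w) x * K x)\<bar> \<le> 2 * L / (real n * b) ^ 3"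
      using cell_integral_error[OF n b _ K L, of w t] A w by (subst abs_minus_commute) auto
    thus "\<bar>c w * (K ((w - t) /\<^sub>R b) / (real n * b)\<^sup>2 - (LINT x|lborel. indicator (cell n b t w) x * K x))\<bar>
       \<le> B * (2 * L / (real n * b) ^ 3)"
      unfolding abs_mult using c[OF w] by (intro mult_mono) auto
  qed
  also have "\<dots> = B * real (card A) * (2 * L / (real n * b) ^ 3)" by (simp add: mult_ac)
  finally show ?thesis unfolding eq .
qed

lemma cell_sum_eq:
  assumes "finite A"
  shows "(\<Sum>w\<in>A. indicator (cell n b t w) x * c w) =
     (if lattice_floor n (t + b *\<^sub>R x) \<in> A then c (lattice_floor n (t + b *\<^sub>R x)) else (0::real))"
proof -
  have "(\<Sum>w\<in>A. indicator (cell n b t w) x * c w) = (\<Sum>w\<in>A. if lattice_floor n (t + b *\<^sub>R x) = w then c w else 0)"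
    by (intro sum.cong refl) (auto simp: cell_def)
  thus ?thesis using assms by (simp add: sum.delta')
qed

lemma lattice_points_bound:
  assumes "bounded (W :: (real^2) set)"
  obtains C where "C > 0" "\<And>n. n \<ge> 1 \<Longrightarrow> finite (W \<inter> scaled_lattice n)"
    "\<And>n. n \<ge> 1 \<Longrightarrow> real (card (W \<inter> scaled_lattice n)) \<le> C * (real n)\<^sup>2"
proof -
  obtain D where D: "D > 0" "\<And>w. w \<in> W \<Longrightarrow> norm w \<le> D" using assms unfolding bounded_pos by auto
  have sub: "W \<inter> scaled_lattice n \<subseteq> scaled_lattice n \<inter> cball 0 D" for n using D by auto
  show thesis
  proof (rule that[of "(2 * D + 1)\<^sup>2"])
    fix n :: nat assume n: "n \<ge> 1"
    note S = scaled_lattice_cball[OF n less_imp_le[OF D(1)], of 0]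
    show "finite (W \<inter> scaled_lattice n)" using finite_subset[OF sub S(1)] .
    have "real (card (W \<inter> scaled_lattice n)) \<le> real (card (scaled_lattice n \<inter> cball 0 D))"
      using card_mono[OF S(1) sub] by simp
    also have "\<dots> \<le> (2 * real n * D + 1)\<^sup>2" by (rule S(2))
    also have "\<dots> \<le> ((2 * D + 1) * real n)\<^sup>2"
      using n D by (intro power_mono) (auto simp: algebra_simps)
    finally show "real (card (W \<inter> scaled_lattice n)) \<le> (2 * D + 1)\<^sup>2 * (real n)\<^sup>2"
      by (simp add: power_mult_distrib)
  qed (use D in auto)
qed

text \<open>The Riemann sum with unit coefficients is at most the integral of the nonnegative kernel
  plus the cell errors, uniformly in t. It serves to bound the mean of the quadratic form.\<close>

lemma kernel_sum_bound:
  fixes K :: "real^2 \<Rightarrow> real"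
  assumes "bounded W" and K: "integrable lborel K" and L: "\<And>x y. \<bar>K x - K y\<bar> \<le> L * norm (x - y)"
    and K0: "\<And>x. K x \<ge> 0"
  obtains C where "C > 0" "\<And>n b t. n \<ge> 1 \<Longrightarrow> b > 0 \<Longrightarrow>
    1 / ((real n)\<^sup>2 * b\<^sup>2) * (\<Sum>w\<in>W \<inter> scaled_lattice n. K ((w - t) /\<^sub>R b)) \<le> C * (1 + 1 / (real n * b ^ 3))"
proof -
  obtain C where C: "C > 0" "\<And>n. n \<ge> 1 \<Longrightarrow> finite (W \<inter> scaled_lattice n)"
    "\<And>n. n \<ge> 1 \<Longrightarrow> real (card (W \<inter> scaled_lattice n)) \<le> C * (real n)\<^sup>2"
    using lattice_points_bound[OF assms(1)] by blast
  have "L \<ge> 0" using L[of 0 "axis 1 1"] abs_ge_zero[of "K 0 - K (axis 1 1)"]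
    by (simp add: norm_axis_1)
  define I where "I = (LINT x|lborel. K x)"
  have I: "I \<ge> 0" unfolding I_def by (intro Bochner_Integration.integral_nonneg K0)
  have "1 / ((real n)\<^sup>2 * b\<^sup>2) * (\<Sum>w\<in>W \<inter> scaled_lattice n. K ((w - t) /\<^sub>R b))
      \<le> (I + 2 * C * L + 1) * (1 + 1 / (real n * b ^ 3))" if n: "n \<ge> 1" and b: "b > 0" for n b t
  proof -
    let ?A = "W \<inter> scaled_lattice n"
    have "1 / ((real n)\<^sup>2 * b\<^sup>2) * (\<Sum>w\<in>?A. K ((w - t) /\<^sub>R b) * 1) \<le>
       (LINT x|lborel. (\<Sum>w\<in>?A. indicator (cell n b t w) x * 1) * K x) + 1 * real (card ?A) * (2 * L / (real n * b) ^ 3)"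
      using riemann_sum_error[OF n b C(2)[OF n] _ K L, of "\<lambda>_. 1" 1 t] by force
    moreover have "(LINT x|lborel. (\<Sum>w\<in>?A. indicator (cell n b t w) x * 1) * K x) \<le> I"
      unfolding I_def cell_sum_eq[OF C(2)[OF n]]
    proof (rule integral_mono)
      have "integrable lborel (\<lambda>x. (\<Sum>w\<in>?A. indicator (cell n b t w) x * 1) * K x)"
        unfolding sum_distrib_right
        by (intro Bochner_Integration.integrable_sum Bochner_Integration.integrable_bound[OF K])
           (use K in \<open>auto simp: indicator_def\<close>)
      thus "integrable lborel (\<lambda>x. (if lattice_floor n (t + b *\<^sub>R x) \<in> ?A then 1 else 0) * K x)"
        unfolding cell_sum_eq[OF C(2)[OF n]] .
    qed (use K K0 in auto)
    moreover have "1 * real (card ?A) * (2 * L / (real n * b) ^ 3) \<le> 1 * (C * (real n)\<^sup>2) * (2 * L / (real n * b) ^ 3)"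
      using \<open>L \<ge> 0\<close> b by (intro mult_right_mono mult_left_mono C(3)[OF n]) auto
    moreover have "1 * (C * (real n)\<^sup>2) * (2 * L / (real n * b) ^ 3) = 2 * C * L * (1 / (real n * b ^ 3))"
      using n b by (simp add: power_mult_distrib power2_eq_square power3_eq_cube mult_ac)
    ultimately have "1 / ((real n)\<^sup>2 * b\<^sup>2) * (\<Sum>w\<in>?A. K ((w - t) /\<^sub>R b) * 1) \<le> I + 2 * C * L * (1 / (real n * b ^ 3))"
      by linarith
    hence 1: "1 / ((real n)\<^sup>2 * b\<^sup>2) * (\<Sum>w\<in>?A. K ((w - t) /\<^sub>R b)) \<le> I + 2 * C * L * (1 / (real n * b ^ 3))"
      by simp
    have "z \<ge> 0 \<Longrightarrow> I + 2 * C * L * z \<le> (I + 2 * C * L + 1) * (1 + z)" for z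
      using I C \<open>L \<ge> 0\<close> by (simp add: algebra_simps)
    from this[of "1 / (real n * b ^ 3)"] 1 b show ?thesis by simp
  qed
  moreover have "I + 2 * C * L + 1 > 0" using I C \<open>L \<ge> 0\<close> by (simp add: add_nonneg_pos)
  ultimately show thesis using that by blast
qed

section \<open>Lipschitz kernels and approximate identities\<close>

lemma kernel_lipschitz:
  fixes K :: "real^2 \<Rightarrow> real"
  assumes K: "Cr_on (Suc r) UNIV K" and bd: "\<And>i. bounded (range (partial i K))"
  obtains L where "L > 0" "\<And>x y. \<bar>K x - K y\<bar> \<le> L * norm (x - y)"
proof -
  have "\<exists>B. \<forall>x. \<bar>partial i K x\<bar> \<le> B" for i using bd[of i] unfolding bounded_iff by auto
  then obtain B where B: "\<And>i x. \<bar>partial i K x\<bar> \<le> B i" by metis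
  define L where "L = \<bar>B 1\<bar> + \<bar>B 2\<bar> + 1"
  have "norm (K x - K y) \<le> L * norm (x - y)" for x y
  proof (rule differentiable_bound[where S = UNIV])
    fix z
    show "(K has_derivative (\<lambda>k. dirder k K z)) (at z)" by (rule Cr_on_has_derivative[OF K])
    show "onorm (\<lambda>k. dirder k K z) \<le> L"
    proof (rule onorm_le)
      fix k
      have "norm (dirder k K z) \<le> \<bar>k $ 1\<bar> * \<bar>partial 1 K z\<bar> + \<bar>k $ 2\<bar> * \<bar>partial 2 K z\<bar>"
        unfolding dirder_def by (rule norm_triangle_le) (simp add: abs_mult)
      also have "\<dots> \<le> norm k * B 1 + norm k * B 2"
        using B by (intro add_mono mult_mono component_le_norm_cart) auto
      also have "\<dots> \<le> L * norm k"
      proof -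
        have "norm k * (B 1 + B 2) \<le> norm k * L" by (intro mult_left_mono) (auto simp: L_def)
        thus ?thesis by (simp add: algebra_simps)
      qed
      finally show "norm (dirder k K z) \<le> L * norm k" .
    qed
  qed auto
  thus thesis by (intro that[of L]) (auto simp: L_def)
qed

text \<open>Dominated convergence: for fixed x the condition
  \<open>norm (b n *\<^sub>R x) > \<rho>\<close> eventually fails.\<close>

lemma integral_tail_tendsto_zero:
  fixes K :: "'a::euclidean_space \<Rightarrow> real"
  assumes K: "integrable lborel K" and b: "\<And>n. n \<ge> 1 \<Longrightarrow> b n > 0" "b \<longlonglongrightarrow> 0" and "\<rho> > 0"
  shows "(\<lambda>n. LINT x|lborel. (if norm (b n *\<^sub>R x) > \<rho> then \<bar>K x\<bar> else 0)) \<longlonglongrightarrow> 0"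
proof -
  have [measurable]: "K \<in> borel_measurable borel" using borel_measurable_integrable[OF K] by simp
  have "(\<lambda>n. LINT x|lborel. (if norm (b n *\<^sub>R x) > \<rho> then \<bar>K x\<bar> else 0)) \<longlonglongrightarrow> (LINT x::'a|lborel. 0)"
  proof (rule integral_dominated_convergence[where w = "\<lambda>x. \<bar>K x\<bar>"])
    show "AE x in lborel. (\<lambda>n. if norm (b n *\<^sub>R x) > \<rho> then \<bar>K x\<bar> else 0) \<longlonglongrightarrow> 0"
    proof (rule AE_I2)
      fix x :: 'a
      have "(\<lambda>n. norm (b n *\<^sub>R x)) \<longlonglongrightarrow> norm (0 *\<^sub>R x)" by (intro tendsto_intros b)
      hence "\<forall>\<^sub>F n in sequentially. norm (b n *\<^sub>R x) < \<rho>" using \<open>\<rho> > 0\<close> by (intro order_tendstoD(2)) auto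
      thus "(\<lambda>n. if norm (b n *\<^sub>R x) > \<rho> then \<bar>K x\<bar> else 0) \<longlonglongrightarrow> 0"
        by (intro tendsto_eventually) (elim eventually_mono, simp)
    qed
  qed (use K in auto)
  thus ?thesis by simp
qed

text \<open>In the variable x = (w - t) / b the sum is, up to cell errors, the integral of
  \<open>K\<close> against a step function. For |b x| \<le> \<rho> the step function takes the value
  of \<open>a n\<close> at a lattice point close to t, which lies in \<Omega> since \<Theta> keeps a
  positive distance from the complement; the other x contribute a tail of |K|.\<close>

lemma kernel_smoothing_uniform_limit:
  fixes K :: "real^2 \<Rightarrow> real" and a :: "nat \<Rightarrow> real^2 \<Rightarrow> real"
  assumes "bounded \<Omega>" "open \<Omega>" "compact \<Theta>" "\<Theta> \<subseteq> \<Omega>"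
    and K: "integrable lborel K" "(LINT x|lborel. K x) = 1" and L: "\<And>x y. \<bar>K x - K y\<bar> \<le> L * norm (x - y)"
    and a: "uniform_limit \<Omega> a g sequentially" and g: "continuous_on (closure \<Omega>) g"
    and b: "\<And>n. n \<ge> 1 \<Longrightarrow> b n > 0" "b \<longlonglongrightarrow> 0" and nb: "(\<lambda>n. 1 / (real n * b n ^ 3)) \<longlonglongrightarrow> 0"
  shows "uniform_limit \<Theta> (\<lambda>n t. 1 / ((real n)\<^sup>2 * (b n)\<^sup>2) * (\<Sum>w\<in>\<Omega> \<inter> scaled_lattice n. K ((w - t) /\<^sub>R b n) * a n w)) g sequentially"
proof (rule uniform_limitI)
  fix e :: real assume e: "e > 0"
  have [measurable]: "K \<in> borel_measurable borel" using borel_measurable_integrable[OF K(1)] by simp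
  obtain C where C: "C > 0" "\<And>n. n \<ge> 1 \<Longrightarrow> finite (\<Omega> \<inter> scaled_lattice n)"
    "\<And>n. n \<ge> 1 \<Longrightarrow> real (card (\<Omega> \<inter> scaled_lattice n)) \<le> C * (real n)\<^sup>2"
    using lattice_points_bound[OF assms(1)] by blast
  have "L \<ge> 0" using L[of 0 "axis 1 1"] abs_ge_zero[of "K 0 - K (axis 1 1)"]
    by (simp add: norm_axis_1)
  have cpt: "compact (closure \<Omega>)" using \<open>bounded \<Omega>\<close> by simp
  obtain G where "G > 0" "\<forall>x\<in>g ` closure \<Omega>. norm x \<le> G"
    using compact_imp_bounded[OF compact_continuous_image[OF g cpt]] unfolding bounded_pos by blast
  hence G: "G > 0" "\<And>w. w \<in> \<Omega> \<Longrightarrow> \<bar>g w\<bar> \<le> G" using closure_subset[of \<Omega>] by auto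
  define I where "I = (LINT x|lborel. \<bar>K x\<bar>)"
  have I: "I \<ge> 0" unfolding I_def by (intro Bochner_Integration.integral_nonneg) auto
  \<comment> \<open>The cap 1 gives \<open>\<bar>a n w\<bar> \<le> G + 1\<close>; the other value
    makes the near part of the integral at most e/4.\<close>
  define e' where "e' = min 1 (e / (4 * (2 * I + 1)))"
  have e': "e' > 0" "e' \<le> 1" using e I by (auto simp: e'_def)
  have e'3: "e' * (2 * I + 1) \<le> e / 4"
  proof -
    have "e' * (2 * I + 1) \<le> e / (4 * (2 * I + 1)) * (2 * I + 1)"
      using I by (intro mult_right_mono) (auto simp: e'_def)
    also have "\<dots> = e / 4" using I by (simp add: field_simps)
    finally show ?thesis .
  qed
  obtain \<delta> where \<delta>: "\<delta> > 0" "\<And>x y. x \<in> closure \<Omega> \<Longrightarrow> y \<in> closure \<Omega> \<Longrightarrow> dist x y < \<delta> \<Longrightarrow> \<bar>g x - g y\<bar> < e'"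
    using compact_uniformly_continuous[OF g cpt] e'(1) unfolding uniformly_continuous_on_def dist_real_def by metis
  obtain \<eta> where \<eta>: "\<eta> > 0" "(\<Union>t\<in>\<Theta>. ball t \<eta>) \<subseteq> \<Omega>"
    using compact_subset_open_imp_ball_epsilon_subset[OF \<open>compact \<Theta>\<close> \<open>open \<Omega>\<close> \<open>\<Theta> \<subseteq> \<Omega>\<close>] by metis
  \<comment> \<open>Half of the margin: the other half absorbs the rounding error 2 / n of the
    lattice point.\<close>
  define \<rho> where "\<rho> = min \<delta> \<eta> / 2"
  have \<rho>: "\<rho> > 0" using \<delta> \<eta> by (simp add: \<rho>_def)
  define T where "T n = (LINT x|lborel. (if norm (b n *\<^sub>R x) > \<rho> then \<bar>K x\<bar> else 0))" for n
  have "(\<lambda>n. (2 * G + 1) * T n) \<longlonglongrightarrow> (2 * G + 1) * 0"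
    unfolding T_def by (intro tendsto_mult_left integral_tail_tendsto_zero K b \<rho>)
  hence ev1: "\<forall>\<^sub>F n in sequentially. (2 * G + 1) * T n < e / 4" using e by (intro order_tendstoD(2)) auto
  have "(\<lambda>n. (G + 1) * C * 2 * L * (1 / (real n * b n ^ 3))) \<longlonglongrightarrow> (G + 1) * C * 2 * L * 0"
    by (intro tendsto_mult_left nb)
  hence ev2: "\<forall>\<^sub>F n in sequentially. (G + 1) * C * 2 * L * (1 / (real n * b n ^ 3)) < e / 4"
    using e by (intro order_tendstoD(2)) auto
  have "(\<lambda>n. 2 / real n) \<longlonglongrightarrow> 0" by (rule lim_const_over_n)
  hence ev3: "\<forall>\<^sub>F n in sequentially. 2 / real n < \<rho>" using \<rho> by (rule order_tendstoD(2))
  have ev4: "\<forall>\<^sub>F n in sequentially. \<forall>w\<in>\<Omega>. dist (a n w) (g w) < e'" by (rule uniform_limitD[OF a e'(1)])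
  have ev5: "\<forall>\<^sub>F n in sequentially. n \<ge> (1::nat)" by (rule eventually_ge_at_top)
  show "\<forall>\<^sub>F n in sequentially. \<forall>t\<in>\<Theta>. dist (1 / ((real n)\<^sup>2 * (b n)\<^sup>2) * (\<Sum>w\<in>\<Omega> \<inter> scaled_lattice n. K ((w - t) /\<^sub>R b n) * a n w)) (g t) < e"
    using ev1 ev2 ev3 ev4 ev5
  proof eventually_elim
    case (elim n)
    have n: "n \<ge> 1" and bn: "b n > 0" using elim b by auto
    let ?A = "\<Omega> \<inter> scaled_lattice n"
    have an: "\<bar>a n w\<bar> \<le> G + 1" if "w \<in> \<Omega>" for w
      using elim(4) that G(2)[OF that] e'(2) by (fastforce simp: dist_real_def)
    show ?case
    proof
      fix t assume t: "t \<in> \<Theta>"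
      define H where "H x = (\<Sum>w\<in>?A. indicator (cell n (b n) t w) x * a n w)" for x
      have H: "H x = (if lattice_floor n (t + b n *\<^sub>R x) \<in> ?A then a n (lattice_floor n (t + b n *\<^sub>R x)) else 0)" for x
        unfolding H_def by (rule cell_sum_eq[OF C(2)[OF n]])
      have Hm [measurable]: "H \<in> borel_measurable borel" unfolding H_def by measurable
      have Hb: "\<bar>H x\<bar> \<le> G + 1" for x unfolding H using an G by auto
      have iHK: "integrable lborel (\<lambda>x. H x * K x)"
      proof (rule Bochner_Integration.integrable_bound)
        show "integrable lborel (\<lambda>x. (G + 1) * K x)" using K by simp
        show "AE x in lborel. norm (H x * K x) \<le> norm ((G + 1) * K x)"
          using Hb G by (intro AE_I2) (simp add: abs_mult mult_right_mono)
      qed simp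
      have 1: "\<bar>1 / ((real n)\<^sup>2 * (b n)\<^sup>2) * (\<Sum>w\<in>?A. K ((w - t) /\<^sub>R b n) * a n w) - (LINT x|lborel. H x * K x)\<bar>
          \<le> (G + 1) * real (card ?A) * (2 * L / (real n * b n) ^ 3)"
        unfolding H_def by (rule riemann_sum_error[OF n bn C(2)[OF n] _ K(1) L]) (use an in auto)
      have 2: "(G + 1) * real (card ?A) * (2 * L / (real n * b n) ^ 3) \<le> (G + 1) * (C * (real n)\<^sup>2) * (2 * L / (real n * b n) ^ 3)"
        using \<open>L \<ge> 0\<close> bn G by (intro mult_right_mono mult_left_mono C(3)[OF n]) auto
      have 3: "(G + 1) * (C * (real n)\<^sup>2) * (2 * L / (real n * b n) ^ 3) = (G + 1) * C * 2 * L * (1 / (real n * b n ^ 3))"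
        using n bn by (simp add: power_mult_distrib power2_eq_square power3_eq_cube mult_ac)
      have pt: "\<bar>H x * K x - g t * K x\<bar> \<le> 2 * e' * \<bar>K x\<bar> + (2 * G + 1) * (if norm (b n *\<^sub>R x) > \<rho> then \<bar>K x\<bar> else 0)" for x
      proof -
        have "\<bar>H x - g t\<bar> \<le> 2 * e' + (2 * G + 1) * (if norm (b n *\<^sub>R x) > \<rho> then 1 else 0)"
        proof (cases "norm (b n *\<^sub>R x) > \<rho>")
          case True
          thus ?thesis using Hb[of x] G(2)[of t] t \<open>\<Theta> \<subseteq> \<Omega>\<close> e'(1) by (auto simp: subset_iff)
        next
          case False
          define w where "w = lattice_floor n (t + b n *\<^sub>R x)"
          have "norm (w - t) \<le> norm (w - (t + b n *\<^sub>R x)) + norm (b n *\<^sub>R x)"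
            using norm_triangle_ineq[of "w - (t + b n *\<^sub>R x)" "b n *\<^sub>R x"] by simp
          also have "\<dots> \<le> 2 / real n + \<rho>"
            using norm_lattice_floor_diff[OF n, of "t + b n *\<^sub>R x"] False unfolding w_def by linarith
          also have "\<dots> < min \<delta> \<eta>" using elim(3) unfolding \<rho>_def by linarith
          finally have d: "norm (w - t) < min \<delta> \<eta>" .
          hence "w \<in> ball t \<eta>" by (simp add: dist_norm norm_minus_commute)
          hence w: "w \<in> \<Omega>" using \<eta>(2) t by blast
          have "\<bar>g w - g t\<bar> < e'" using w t \<open>\<Theta> \<subseteq> \<Omega>\<close> closure_subset[of \<Omega>] d by (intro \<delta>) (auto simp: dist_norm)
          moreover have "\<bar>a n w - g w\<bar> < e'" using elim(4) w by (auto simp: dist_real_def)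
          moreover have "H x = a n w" unfolding H w_def[symmetric] using w lattice_floor_in_scaled_lattice by (auto simp: w_def)
          ultimately show ?thesis using False by simp
        qed
        hence "\<bar>H x - g t\<bar> * \<bar>K x\<bar> \<le> (2 * e' + (2 * G + 1) * (if norm (b n *\<^sub>R x) > \<rho> then 1 else 0)) * \<bar>K x\<bar>"
          by (intro mult_right_mono) auto
        thus ?thesis by (simp add: abs_mult[symmetric] algebra_simps split: if_splits)
      qed
      have i1: "integrable lborel (\<lambda>x. if norm (b n *\<^sub>R x) > \<rho> then \<bar>K x\<bar> else 0)"
        by (rule Bochner_Integration.integrable_bound[OF K(1)]) auto
      have i2: "integrable lborel (\<lambda>x. 2 * e' * \<bar>K x\<bar> + (2 * G + 1) * (if norm (b n *\<^sub>R x) > \<rho> then \<bar>K x\<bar> else 0))"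
        using i1 K by (intro Bochner_Integration.integrable_add integrable_mult_right integrable_abs)
      have "(LINT x|lborel. H x * K x) - g t = (LINT x|lborel. H x * K x - g t * K x)"
        using iHK K by simp
      hence "\<bar>(LINT x|lborel. H x * K x) - g t\<bar> = \<bar>LINT x|lborel. H x * K x - g t * K x\<bar>" by simp
      also have "\<dots> \<le> (LINT x|lborel. \<bar>H x * K x - g t * K x\<bar>)" by (rule integral_abs_bound)
      also have "\<dots> \<le> (LINT x|lborel. 2 * e' * \<bar>K x\<bar> + (2 * G + 1) * (if norm (b n *\<^sub>R x) > \<rho> then \<bar>K x\<bar> else 0))"
        using iHK K by (intro integral_mono i2 pt) auto
      also have "\<dots> = 2 * e' * I + (2 * G + 1) * T n"
        using i1 K by (subst Bochner_Integration.integral_add) (auto simp: I_def T_def)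
      also have "\<dots> \<le> e / 4 + e / 4"
        using elim(1) e' e'3 I by (intro add_mono) (auto simp: algebra_simps)
      finally have "\<bar>(LINT x|lborel. H x * K x) - g t\<bar> \<le> e / 4 + e / 4" .
      with 1 2 3 elim(2)
      show "dist (1 / ((real n)\<^sup>2 * (b n)\<^sup>2) * (\<Sum>w\<in>?A. K ((w - t) /\<^sub>R b n) * a n w)) (g t) < e"
        unfolding dist_real_def using e by linarith
    qed
  qed
qed

section \<open>Second-order increments of the field\<close>

definition D2 :: "('i \<Rightarrow> 'w \<Rightarrow> real) \<Rightarrow> (real^2 \<Rightarrow> 'i) \<Rightarrow> real^2 \<Rightarrow> real^2 \<Rightarrow> 'w \<Rightarrow> real" where
  "D2 Z f k w \<omega> = Z (f (w + 2 *\<^sub>R k)) \<omega> - 2 * Z (f (w + k)) \<omega> + Z (f w) \<omega>"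

lemma increment_increment: "increment k (increment k ((\<lambda>x. Z x \<omega>) \<circ> f)) w = D2 Z f k w \<omega>"
proof -
  have eq: "w + k + k = w + 2 *\<^sub>R k" by (simp only: add.assoc scaleR_2)
  show ?thesis unfolding increment_def D2_def o_def eq by simp
qed

text \<open>The covariance of the increments at \<open>u\<close> and \<open>v\<close>, arranged as a
  second difference in s of second differences in t, the shape treated by
  \<open>radial_mixed_difference_bound\<close>.\<close>

definition D2_cov :: "(real \<Rightarrow> real) \<Rightarrow> (real^2 \<Rightarrow> real^2) \<Rightarrow> real^2 \<Rightarrow> real^2 \<Rightarrow> real^2 \<Rightarrow> real" where
  "D2_cov R f k u v = (let F = (\<lambda>s t. R (norm (f (u + s *\<^sub>R k) - f (v + t *\<^sub>R k)))) in
     (F 2 2 - 2 * F 2 1 + F 2 0) - 2 * (F 1 2 - 2 * F 1 1 + F 1 0) + (F 0 2 - 2 * F 0 1 + F 0 0))"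

lemma D2_cov_diag: "D2_cov R f k w w = D2_variance R f k w"
  unfolding D2_cov_def D2_variance_def Let_def
  by (simp add: norm_minus_commute[of "f w"] norm_minus_commute[of "f (w + k)" "f (w + 2 *\<^sub>R k)"])

text \<open>\<open>Z t\<close> need not be centred, so in the normal case the moments are those of
  \<open>Z t \<omega> - \<mu>\<close>, with the constant added back.\<close>

lemma (in prob_space) gaussian_field_all_moments:
  assumes G: "gaussian_field M Z"
  shows "all_moments M (Z t)"
proof -
  have Zt: "Z t \<in> field_span Z" by (rule field_span_base)
  have "gaussian_rv M (Z t)" using G Zt by (rule gaussian_field_span)
  hence [measurable]: "Z t \<in> borel_measurable M" and
    "(\<exists>\<mu>. AE \<omega> in M. Z t \<omega> = \<mu>) \<or> (\<exists>\<mu> \<sigma>. \<sigma> > 0 \<and> distributed M lborel (Z t) (normal_density \<mu> \<sigma>))"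
    by (auto simp: gaussian_rv_def)
  from this(2) show ?thesis
  proof (elim disjE exE conjE)
    fix \<mu> assume AE: "AE \<omega> in M. Z t \<omega> = \<mu>"
    have "integrable M (\<lambda>\<omega>. Z t \<omega> ^ k)" for k
      by (subst integrable_cong_AE[where g = "\<lambda>_. \<mu> ^ k"]) (use AE in auto)
    thus ?thesis by (simp add: all_moments_def)
  next
    fix \<mu> \<sigma> :: real assume \<sigma>: "\<sigma> > 0" and D: "distributed M lborel (Z t) (normal_density \<mu> \<sigma>)"
    have "integrable M (\<lambda>\<omega>. (Z t \<omega> - \<mu>) ^ k)" for k
      using distributed_integrable[OF D, of "\<lambda>x. (x - \<mu>) ^ k"] integrable_normal_moment[OF \<sigma>, of \<mu> k] by simp
    hence "all_moments M (\<lambda>\<omega>. Z t \<omega> - \<mu>)" by (simp add: all_moments_def)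
    from all_moments_add[OF this all_moments_const[of \<mu>]] show ?thesis by simp
  qed
qed

context
  fixes M :: "'w measure" and Z :: "real^2 \<Rightarrow> 'w \<Rightarrow> real" and R :: "real \<Rightarrow> real" and m :: real
  assumes ps: "prob_space M" and G: "gaussian_field M Z"
    and mean: "\<And>t. (LINT \<omega>|M. Z t \<omega>) = m"
    and cv: "\<And>t s. covariance M (Z t) (Z s) = R (norm (t - s))"
begin

interpretation prob_space M by (rule ps)

lemma D2_centered: "D2 Z f k w \<in> centered_span M Z"
proof -
  have 1: "(\<lambda>\<omega>. Z (f (w + 2 *\<^sub>R k)) \<omega> + (-2) * Z (f (w + k)) \<omega>) \<in> field_span Z"
    by (intro field_span_line field_span_base)
  have "(\<lambda>\<omega>. (Z (f (w + 2 *\<^sub>R k)) \<omega> + (-2) * Z (f (w + k)) \<omega>) + 1 * Z (f w) \<omega>) \<in> field_span Z"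
    using field_span_line[OF 1 field_span_base, of 1] .
  moreover have "(\<lambda>\<omega>. (Z (f (w + 2 *\<^sub>R k)) \<omega> + (-2) * Z (f (w + k)) \<omega>) + 1 * Z (f w) \<omega>) = D2 Z f k w"
    by (auto simp: D2_def)
  moreover have "expectation (D2 Z f k w) = 0"
    unfolding D2_def using all_moments_integrable[OF gaussian_field_all_moments[OF G]] by (simp add: mean)
  ultimately show ?thesis by (simp add: centered_span_def)
qed

lemma expectation_second_difference_mult:
  assumes "all_moments M x2" "all_moments M x1" "all_moments M x0" "all_moments M y"
  shows "expectation (\<lambda>\<omega>. (x2 \<omega> - 2 * x1 \<omega> + x0 \<omega>) * y \<omega>) =
    expectation (\<lambda>\<omega>. x2 \<omega> * y \<omega>) - 2 * expectation (\<lambda>\<omega>. x1 \<omega> * y \<omega>) + expectation (\<lambda>\<omega>. x0 \<omega> * y \<omega>)"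
proof -
  have i: "integrable M (\<lambda>\<omega>. x2 \<omega> * y \<omega>)" "integrable M (\<lambda>\<omega>. x1 \<omega> * y \<omega>)" "integrable M (\<lambda>\<omega>. x0 \<omega> * y \<omega>)"
    using assms by (auto intro!: all_moments_integrable all_moments_mult)
  have "expectation (\<lambda>\<omega>. (x2 \<omega> - 2 * x1 \<omega> + x0 \<omega>) * y \<omega>) =
     expectation (\<lambda>\<omega>. x2 \<omega> * y \<omega> - 2 * (x1 \<omega> * y \<omega>) + x0 \<omega> * y \<omega>)"
    by (simp add: algebra_simps)
  thus ?thesis using i by simp
qed

text \<open>Subtracting the mean from the field leaves the increments unchanged, so the bilinear
  expansion produces covariances only.\<close>

lemma expectation_D2_mult:
  "expectation (\<lambda>\<omega>. D2 Z f k u \<omega> * D2 Z f k v \<omega>) = D2_cov R f k u v"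
proof -
  define X where "X t \<omega> = Z t \<omega> - m" for t \<omega>
  have mX: "all_moments M (X t)" for t
    unfolding X_def[abs_def] by (intro all_moments_diff gaussian_field_all_moments[OF G] all_moments_const)
  have cX: "expectation (\<lambda>\<omega>. X t \<omega> * X s \<omega>) = R (norm (t - s))" for s t
    using cv[of t s] unfolding covariance_def mean X_def .
  have D: "D2 Z f k w = (\<lambda>\<omega>. X (f (w + 2 *\<^sub>R k)) \<omega> - 2 * X (f (w + k)) \<omega> + X (f w) \<omega>)" for w
    by (auto simp: D2_def X_def)
  have mD: "all_moments M (D2 Z f k w)" for w
    unfolding D by (intro all_moments_add all_moments_diff all_moments_cmult mX)
  have half: "expectation (\<lambda>\<omega>. X t \<omega> * D2 Z f k v \<omega>) =
     R (norm (t - f (v + 2 *\<^sub>R k))) - 2 * R (norm (t - f (v + k))) + R (norm (t - f v))" for t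
    unfolding mult.commute[of "X t _"] D by (subst expectation_second_difference_mult) (auto simp: mX cX norm_minus_commute)
  have "expectation (\<lambda>\<omega>. D2 Z f k u \<omega> * D2 Z f k v \<omega>) =
     expectation (\<lambda>\<omega>. (X (f (u + 2 *\<^sub>R k)) \<omega> - 2 * X (f (u + k)) \<omega> + X (f u) \<omega>) * D2 Z f k v \<omega>)"
    by (simp add: D[of u])
  also have "\<dots> = expectation (\<lambda>\<omega>. X (f (u + 2 *\<^sub>R k)) \<omega> * D2 Z f k v \<omega>) -
      2 * expectation (\<lambda>\<omega>. X (f (u + k)) \<omega> * D2 Z f k v \<omega>) + expectation (\<lambda>\<omega>. X (f u) \<omega> * D2 Z f k v \<omega>)"
    by (intro expectation_second_difference_mult mX mD)
  finally show ?thesis by (simp add: half D2_cov_def Let_def)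
qed

text \<open>Meant for pairs at distance O(1/n), where the two triples of points may meet and the
  derivatives of \<open>R\<close> may blow up.\<close>

lemma D2_cov_abs_le: "\<bar>D2_cov R f k u v\<bar> \<le> (D2_variance R f k u + D2_variance R f k v) / 2"
proof -
  have mD: "all_moments M (D2 Z f k w)" for w
    using gaussian_space.moments[OF gaussian_space_centered_span[OF G] D2_centered] .
  note i = all_moments_integrable[OF all_moments_mult[OF mD mD]]
  have "\<bar>D2_cov R f k u v\<bar> \<le> expectation (\<lambda>\<omega>. \<bar>D2 Z f k u \<omega> * D2 Z f k v \<omega>\<bar>)"
    unfolding expectation_D2_mult[symmetric] by (rule integral_abs_bound)
  also have "\<dots> \<le> expectation (\<lambda>\<omega>. (D2 Z f k u \<omega> * D2 Z f k u \<omega> + D2 Z f k v \<omega> * D2 Z f k v \<omega>) / 2)"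
  proof (rule integral_mono)
    fix \<omega>
    show "\<bar>D2 Z f k u \<omega> * D2 Z f k v \<omega>\<bar> \<le> (D2 Z f k u \<omega> * D2 Z f k u \<omega> + D2 Z f k v \<omega> * D2 Z f k v \<omega>) / 2"
      using sum_squares_bound[of "\<bar>D2 Z f k u \<omega>\<bar>" "\<bar>D2 Z f k v \<omega>\<bar>"] by (simp add: abs_mult mult.assoc power2_eq_square)
  qed (intro integrable_abs Bochner_Integration.integrable_add integrable_divide i)+
  also have "\<dots> = (D2_variance R f k u + D2_variance R f k v) / 2"
    using i by (simp add: expectation_D2_mult D2_cov_diag)
  finally show ?thesis .
qed

end

text \<open>At distance at least 4 |h| / n, sliding the points along their increments shifts them
  against each other by at most 2 |h| / n and leaves at least half the distance, which the lower
  Lipschitz bound of \<open>f\<close> carries to the image. The mixed difference bound then applies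
  with \<epsilon> = 1 / n.\<close>

lemma D2_cov_far_bound:
  fixes f :: "real^2 \<Rightarrow> real^2"
  assumes f: "Cr_on 2 UNIV f" and det: "\<And>x. det (jacobian f (at x)) \<noteq> 0" and "inj f"
    and "bounded W" and "\<alpha> < 2" and Ck: "Ck_on_real 4 {0<..} R"
    and ev: "\<forall>\<^sub>F t in at_right 0. \<bar>(deriv ^^ 4) R t\<bar> \<le> c0 * t powr (\<alpha> - 4)"
  obtains C where "C > 0" "\<And>n u v. n \<ge> 1 \<Longrightarrow> u \<in> W \<Longrightarrow> v \<in> W \<Longrightarrow> u \<noteq> v \<Longrightarrow> norm (u - v) \<ge> 4 * norm h / real n \<Longrightarrow>
     \<bar>D2_cov R f (h /\<^sub>R real n) u v\<bar> \<le> C * (1 / real n) ^ 3 * norm (u - v) powr (\<alpha> - 4)"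
proof -
  have f1: "Cr_on (Suc 1) UNIV f" using f by (simp add: numeral_2_eq_2)
  have pf: "Cr_on (Suc 0) UNIV (partial i f)" for i using f1 by simp
  obtain D where D: "D > 0" "\<And>w. w \<in> W \<Longrightarrow> norm w \<le> D" using \<open>bounded W\<close> unfolding bounded_pos by auto
  \<comment> \<open>Contains every point w + s h / n with w in \<open>W\<close>, 0 \<le> s \<le> 2
    and n \<ge> 1.\<close>
  define K where "K = cball (0::real^2) (D + 2 * norm h)"
  have K: "compact K" by (simp add: K_def)
  have bounded_image: "\<exists>B. \<forall>x\<in>K. norm (g x) \<le> B" if "continuous_on K g" for g :: "real^2 \<Rightarrow> real^2"
    using compact_imp_bounded[OF compact_continuous_image[OF that K]] unfolding bounded_iff by auto
  have "continuous_on K f" using f1 continuous_on_subset by fastforce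
  then obtain B0 where B0: "\<And>x. x \<in> K \<Longrightarrow> norm (f x) \<le> B0" using bounded_image by metis
  obtain B1 where B1: "\<And>x. x \<in> K \<Longrightarrow> norm (dirder h f x) \<le> B1"
    using bounded_image[OF dirder_continuous[OF f1]] by metis
  \<comment> \<open>The second derivative along \<open>h\<close>, written with iterated
    partials.\<close>
  define f2 where "f2 x = h $ 1 *\<^sub>R dirder h (partial 1 f) x + h $ 2 *\<^sub>R dirder h (partial 2 f) x" for x
  have "continuous_on K f2" unfolding f2_def by (intro continuous_intros dirder_continuous[OF pf])
  then obtain B2 where B2: "\<And>x. x \<in> K \<Longrightarrow> norm (f2 x) \<le> B2" using bounded_image by metis
  define B where "B = max 1 (max B1 B2)"
  define T where "T = 2 * \<bar>B0\<bar> + 1"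
  obtain c where c: "c > 0" "\<And>u v. u \<in> K \<Longrightarrow> v \<in> K \<Longrightarrow> c * norm (u - v) \<le> norm (f u - f v)"
    using bi_lipschitz_lower[OF f1 det \<open>inj f\<close> K] by blast
  have "T > 0" "B > 0" by (auto simp: T_def B_def)
  show thesis
  proof (rule radial_mixed_difference_bound[OF Ck ev \<open>\<alpha> < 2\<close> \<open>T > 0\<close> \<open>B > 0\<close>])
    fix C assume C: "C > 0"
    "\<And>(p :: real \<Rightarrow> real^2) p1 p2 q q1 \<epsilon> r0. \<epsilon> > 0 \<Longrightarrow> r0 > 0 \<Longrightarrow>
      (\<And>s. (p has_vector_derivative p1 s) (at s)) \<Longrightarrow>
      (\<And>s. (p1 has_vector_derivative p2 s) (at s)) \<Longrightarrow>
      (\<And>s. (q has_vector_derivative q1 s) (at s)) \<Longrightarrow>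
      (\<And>s. s \<in> {0..2} \<Longrightarrow> norm (p1 s) \<le> \<epsilon> * B) \<Longrightarrow>
      (\<And>s. s \<in> {0..2} \<Longrightarrow> norm (p2 s) \<le> \<epsilon>\<^sup>2 * B) \<Longrightarrow>
      (\<And>s. s \<in> {0..2} \<Longrightarrow> norm (q1 s) \<le> \<epsilon> * B) \<Longrightarrow>
      (\<And>s t. s \<in> {0..2} \<Longrightarrow> t \<in> {0..2} \<Longrightarrow> r0 \<le> norm (p s - q t) \<and> norm (p s - q t) \<le> T) \<Longrightarrow>
      (let F = (\<lambda>s t. R (norm (p s - q t))) in
       \<bar>(F 2 2 - 2 * F 2 1 + F 2 0) - 2 * (F 1 2 - 2 * F 1 1 + F 1 0) + (F 0 2 - 2 * F 0 1 + F 0 0)\<bar>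
        \<le> C * \<epsilon> ^ 3 * r0 powr (\<alpha> - 4))"
  show thesis
  proof (rule that[of "C * (c / 2) powr (\<alpha> - 4)"])
    fix n :: nat and u v :: "real^2"
    assume n: "n \<ge> 1" and uv: "u \<in> W" "v \<in> W" "u \<noteq> v" and far: "norm (u - v) \<ge> 4 * norm h / real n"
    define k where "k = h /\<^sub>R real n"
    define \<epsilon> where "\<epsilon> = 1 / real n"
    have \<epsilon>: "\<epsilon> > 0" "\<epsilon> \<le> 1" using n by (auto simp: \<epsilon>_def)
    have k: "k = \<epsilon> *\<^sub>R h" by (simp add: k_def \<epsilon>_def divide_inverse)
    have dk: "dirder k F x = \<epsilon> *\<^sub>R dirder h F x" for F :: "real^2 \<Rightarrow> real^2" and x
      by (simp add: k dirder_def algebra_simps)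
    have inK: "w + s *\<^sub>R k \<in> K" if "w \<in> W" "s \<in> {0..2}" for w s
    proof -
      have "norm (s *\<^sub>R k) \<le> 2 * (1 * norm h)"
        unfolding k norm_scaleR abs_mult[symmetric] using that \<epsilon>
        by (intro mult_mono[of "\<bar>s\<bar>" 2] mult_right_mono) auto
      hence "norm (w + s *\<^sub>R k) \<le> D + 2 * norm h" using norm_triangle_ineq[of w "s *\<^sub>R k"] D(2)[OF that(1)] by simp
      thus ?thesis unfolding K_def mem_cball_0 .
    qed
    define p2 where "p2 w s = \<epsilon>\<^sup>2 *\<^sub>R f2 (w + s *\<^sub>R k)" for w s
    have d1: "((\<lambda>s. f (w + s *\<^sub>R k)) has_vector_derivative dirder k f (w + s *\<^sub>R k)) (at s)" for w s
      by (rule Cr_on_line_derivative[OF f1])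
    have d2: "((\<lambda>s. dirder k f (w + s *\<^sub>R k)) has_vector_derivative p2 w s) (at s)" for w s
    proof -
      have "((\<lambda>s. k $ 1 *\<^sub>R partial 1 f (w + s *\<^sub>R k) + k $ 2 *\<^sub>R partial 2 f (w + s *\<^sub>R k)) has_vector_derivative
         k $ 1 *\<^sub>R dirder k (partial 1 f) (w + s *\<^sub>R k) + k $ 2 *\<^sub>R dirder k (partial 2 f) (w + s *\<^sub>R k)) (at s)"
        by (intro has_vector_derivative_add bounded_linear.has_vector_derivative[OF bounded_linear_scaleR_right] Cr_on_line_derivative[OF pf])
      moreover have "k $ 1 *\<^sub>R dirder k (partial 1 f) x + k $ 2 *\<^sub>R dirder k (partial 2 f) x = \<epsilon>\<^sup>2 *\<^sub>R f2 x" for x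
        unfolding dk f2_def by (simp add: k algebra_simps power2_eq_square)
      ultimately show ?thesis by (simp add: dirder_def[of k f] p2_def)
    qed
    define r0 where "r0 = c / 2 * norm (u - v)"
    have "r0 > 0" using c uv by (simp add: r0_def)
    have n1: "norm (dirder k f (w + s *\<^sub>R k)) \<le> \<epsilon> * B" if "w \<in> W" "s \<in> {0..2}" for w s
      unfolding dk using B1[OF inK[OF that]] \<epsilon> by (auto simp: B_def intro!: mult_left_mono)
    have n2: "norm (p2 w s) \<le> \<epsilon>\<^sup>2 * B" if "w \<in> W" "s \<in> {0..2}" for w s
      unfolding p2_def using B2[OF inK[OF that]] \<epsilon> by (auto simp: B_def intro!: mult_left_mono)
    have sep: "r0 \<le> norm (f (u + s *\<^sub>R k) - f (v + t *\<^sub>R k)) \<and> norm (f (u + s *\<^sub>R k) - f (v + t *\<^sub>R k)) \<le> T"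
      if st: "s \<in> {0..2}" "t \<in> {0..2}" for s t
    proof
      have "norm ((s - t) *\<^sub>R k) \<le> 2 * norm k"
        unfolding norm_scaleR using st by (intro mult_right_mono) auto
      also have "norm k = norm h / real n" using n by (simp add: k_def divide_inverse mult.commute)
      finally have "2 * norm ((s - t) *\<^sub>R k) \<le> norm (u - v)" using far by simp
      moreover have "u - v = ((u + s *\<^sub>R k) - (v + t *\<^sub>R k)) - (s - t) *\<^sub>R k" by (simp add: algebra_simps)
      hence "norm (u - v) \<le> norm ((u + s *\<^sub>R k) - (v + t *\<^sub>R k)) + norm ((s - t) *\<^sub>R k)"
        by (metis norm_triangle_ineq4)
      ultimately have "norm (u - v) \<le> 2 * norm ((u + s *\<^sub>R k) - (v + t *\<^sub>R k))" by simp
      hence "c / 2 * norm (u - v) \<le> c / 2 * (2 * norm ((u + s *\<^sub>R k) - (v + t *\<^sub>R k)))"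
        using c by (intro mult_left_mono) auto
      also have "\<dots> = c * norm ((u + s *\<^sub>R k) - (v + t *\<^sub>R k))" by simp
      also have "\<dots> \<le> norm (f (u + s *\<^sub>R k) - f (v + t *\<^sub>R k))" by (intro c inK uv st)
      finally show "r0 \<le> norm (f (u + s *\<^sub>R k) - f (v + t *\<^sub>R k))" by (simp add: r0_def)
      show "norm (f (u + s *\<^sub>R k) - f (v + t *\<^sub>R k)) \<le> T"
        using norm_triangle_ineq4[of "f (u + s *\<^sub>R k)" "f (v + t *\<^sub>R k)"] B0[OF inK[OF uv(1) st(1)]] B0[OF inK[OF uv(2) st(2)]]
        by (simp add: T_def)
    qed
    have "\<bar>D2_cov R f k u v\<bar> \<le> C * \<epsilon> ^ 3 * r0 powr (\<alpha> - 4)"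
      unfolding D2_cov_def
      using C(2)[OF \<epsilon>(1) \<open>r0 > 0\<close> d1 d2 d1 n1[OF uv(1)] n2[OF uv(1)] n1[OF uv(2)] sep] by (simp add: Let_def)
    also have "r0 powr (\<alpha> - 4) = (c / 2) powr (\<alpha> - 4) * norm (u - v) powr (\<alpha> - 4)"
      unfolding r0_def using c by (intro powr_mult)
    finally show "\<bar>D2_cov R f (h /\<^sub>R real n) u v\<bar> \<le> C * (c / 2) powr (\<alpha> - 4) * (1 / real n) ^ 3 * norm (u - v) powr (\<alpha> - 4)"
      by (simp add: k_def \<epsilon>_def mult_ac)
  qed (use C c in auto)
  qed
qed

section \<open>Concentration on a polynomially fine grid\<close>

lemma powr_minus_tendsto_zero:
  assumes "\<beta> > 0" shows "(\<lambda>n. real n powr (- \<beta>)) \<longlonglongrightarrow> 0"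
  using assms by (intro tendsto_neg_powr filterlim_real_sequentially) auto

context
  fixes M :: "'w measure" and Z :: "real^2 \<Rightarrow> 'w \<Rightarrow> real" and R :: "real \<Rightarrow> real" and m \<alpha> \<gamma> c0 :: real
    and f :: "real^2 \<Rightarrow> real^2" and h :: "real^2" and W :: "(real^2) set"
  assumes ps: "prob_space M" and G: "gaussian_field M Z"
    and mean: "\<And>t. (LINT \<omega>|M. Z t \<omega>) = m"
    and cv: "\<And>t s. covariance M (Z t) (Z s) = R (norm (t - s))"
    and \<alpha>: "0 < \<alpha>" "\<alpha> < 2" and \<gamma>: "\<gamma> > 0"
    and R: "(\<lambda>t. R t - (R 0 - t powr \<alpha>)) \<in> o[at_right 0](\<lambda>t. t powr (\<alpha> + \<gamma>))"
    and Ck: "Ck_on_real 4 {0<..} R"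
    and ev4: "\<forall>\<^sub>F t in at_right 0. \<bar>(deriv ^^ 4) R t\<bar> \<le> c0 * t powr (\<alpha> - 4)"
    and f: "Cr_on 2 UNIV f" and det: "\<And>x. det (jacobian f (at x)) \<noteq> 0" and "inj f"
    and h: "h \<noteq> 0" and W: "bounded W"
begin

interpretation gaussian_space M "centered_span M Z"
  by (rule prob_space.gaussian_space_centered_span[OF ps G])

abbreviation (input) "pts n \<equiv> W \<inter> scaled_lattice n"
abbreviation (input) "sc n \<equiv> real n powr \<alpha>"
abbreviation (input) "Dn n \<equiv> D2 Z f (h /\<^sub>R real n)"

lemma f_C1: "Cr_on (Suc 1) UNIV f" using f by (simp add: numeral_2_eq_2)

lemma scaled_variance_limit:
  "uniform_limit W (\<lambda>n w. sc n * D2_variance R f (h /\<^sub>R real n) w)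
      (\<lambda>w. (8 - 2 powr (\<alpha> + 1)) * norm (dirder h f w) powr \<alpha>) sequentially"
  by (rule D2_variance_uniform_limit[OF f_C1 \<open>inj f\<close> W h R \<gamma> \<alpha>(1)])

lemma scaled_variance_bounded:
  obtains V where "V > 0" "\<forall>\<^sub>F n in sequentially. \<forall>w\<in>W. sc n * D2_variance R f (h /\<^sub>R real n) w \<le> V"
proof -
  define g where "g w = (8 - 2 powr (\<alpha> + 1)) * norm (dirder h f w) powr \<alpha>" for w
  have "continuous_on (closure W) g"
    unfolding g_def using \<alpha> by (intro continuous_intros continuous_on_powr' dirder_continuous[OF f_C1]) auto
  hence "bounded (g ` closure W)"
    using W compact_continuous_image compact_imp_bounded by (metis compact_closure)
  then obtain V where "V > 0" "\<forall>x\<in>g ` closure W. norm x \<le> V" unfolding bounded_pos by blast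
  hence V: "V > 0" "\<And>w. w \<in> W \<Longrightarrow> \<bar>g w\<bar> \<le> V" using closure_subset[of W] by auto
  have "\<forall>\<^sub>F n in sequentially. \<forall>w\<in>W. sc n * D2_variance R f (h /\<^sub>R real n) w \<le> V + 1"
    using uniform_limitD[OF scaled_variance_limit zero_less_one]
  proof eventually_elim
    case (elim n)
    show ?case
    proof
      fix w assume w: "w \<in> W"
      show "sc n * D2_variance R f (h /\<^sub>R real n) w \<le> V + 1"
        using elim[rule_format, OF w] V(2)[OF w] unfolding dist_real_def g_def by linarith
    qed
  qed
  thus thesis using V by (intro that[of "V + 1"]) auto
qed

text \<open>Only the growth rate \<open>n\<close> of the row sums is needed, which is why the weak exponent of
  \<open>D2_cov_far_bound\<close> is enough.\<close>

lemma D2_cov_row_sum: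
  obtains C where "C > 0" "\<forall>\<^sub>F n in sequentially. \<forall>u\<in>pts n.
     (\<Sum>v\<in>pts n. sc n * \<bar>D2_cov R f (h /\<^sub>R real n) u v\<bar>) \<le> C * real n"
proof -
  obtain V where V: "V > 0" "\<forall>\<^sub>F n in sequentially. \<forall>w\<in>W. sc n * D2_variance R f (h /\<^sub>R real n) w \<le> V"
    by (rule scaled_variance_bounded)
  obtain C1 where C1: "C1 > 0" "\<And>n u v. n \<ge> 1 \<Longrightarrow> u \<in> W \<Longrightarrow> v \<in> W \<Longrightarrow> u \<noteq> v \<Longrightarrow> norm (u - v) \<ge> 4 * norm h / real n \<Longrightarrow>
     \<bar>D2_cov R f (h /\<^sub>R real n) u v\<bar> \<le> C1 * (1 / real n) ^ 3 * norm (u - v) powr (\<alpha> - 4)"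
    by (rule D2_cov_far_bound[OF f det \<open>inj f\<close> W \<alpha>(2) Ck ev4, of h]) (rule that)
  obtain C2 where C2: "C2 > 0"
    "\<And>n w A. n \<ge> 1 \<Longrightarrow> w \<in> scaled_lattice n \<Longrightarrow> finite A \<Longrightarrow> A \<subseteq> scaled_lattice n - {w} \<Longrightarrow>
       (\<Sum>v\<in>A. norm (w - v) powr (- (4 - \<alpha>))) \<le> C2 * real n powr (4 - \<alpha>)"
    by (rule scaled_lattice_power_sum[of "4 - \<alpha>"]) (use \<alpha> in simp, rule that)
  have C3: "finite (pts n)" if "n \<ge> 1" for n
    by (rule lattice_points_bound[OF W]) (use that in auto)
  \<comment> \<open>Bounds the number of lattice points within 4 |h| / n of a given one,
    independently of n.\<close>
  define N where "N = (8 * norm h + 1)\<^sup>2"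
  have "\<forall>\<^sub>F n in sequentially. n \<ge> (1::nat)" by (rule eventually_ge_at_top)
  hence "\<forall>\<^sub>F n in sequentially. \<forall>u\<in>pts n.
     (\<Sum>v\<in>pts n. sc n * \<bar>D2_cov R f (h /\<^sub>R real n) u v\<bar>) \<le> (N * V + C1 * C2) * real n"
    using V(2)
  proof eventually_elim
    case (elim n)
    hence n: "n \<ge> 1" by simp
    show ?case
    proof
      fix u assume u: "u \<in> pts n"
      let ?c = "\<lambda>v. sc n * \<bar>D2_cov R f (h /\<^sub>R real n) u v\<bar>"
      define near where "near = pts n \<inter> cball u (4 * norm h / real n)"
      have fin: "finite (pts n)" by (rule C3[OF n])
      have near_le: "?c v \<le> V" if "v \<in> pts n" for v
      proof -
        have "?c v \<le> sc n * ((D2_variance R f (h /\<^sub>R real n) u + D2_variance R f (h /\<^sub>R real n) v) / 2)"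
          by (intro mult_left_mono D2_cov_abs_le[OF ps G mean cv]) auto
        also have "\<dots> = (sc n * D2_variance R f (h /\<^sub>R real n) u + sc n * D2_variance R f (h /\<^sub>R real n) v) / 2"
          by (simp add: algebra_simps)
        also have "\<dots> \<le> (V + V) / 2" using elim u that by (intro divide_right_mono add_mono) auto
        finally show ?thesis by simp
      qed
      have "(\<Sum>v\<in>near. ?c v) \<le> (\<Sum>v\<in>near. V)" using near_le by (intro sum_mono) (auto simp: near_def)
      also have "\<dots> = real (card near) * V" by simp
      also have "\<dots> \<le> N * V"
      proof (rule mult_right_mono)
        have r: "4 * norm h / real n \<ge> 0" by simp
        have "real (card near) \<le> real (card (scaled_lattice n \<inter> cball u (4 * norm h / real n)))"
          using card_mono[OF scaled_lattice_cball(1)[OF n r, of u], of near] by (auto simp: near_def)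
        also have "\<dots> \<le> (2 * real n * (4 * norm h / real n) + 1)\<^sup>2" by (rule scaled_lattice_cball(2)[OF n r])
        also have "\<dots> = N" using n by (simp add: N_def)
        finally show "real (card near) \<le> N" .
      qed (use V in simp)
      also have "\<dots> \<le> N * V * real n"
        using n V mult_left_mono[of 1 "real n" "N * V"] by (simp add: N_def)
      finally have 1: "(\<Sum>v\<in>near. ?c v) \<le> N * V * real n" .
      have "(\<Sum>v\<in>pts n - near. ?c v) \<le> (\<Sum>v\<in>pts n - near. sc n * (C1 * (1 / real n) ^ 3) * norm (u - v) powr (- (4 - \<alpha>)))"
      proof (rule sum_mono)
        fix v assume v: "v \<in> pts n - near"
        hence d: "norm (u - v) > 4 * norm h / real n" by (auto simp: near_def dist_norm)
        moreover have "4 * norm h / real n \<ge> 0" by simp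
        ultimately have "norm (u - v) > 0" by linarith
        hence "u \<noteq> v" by auto
        have "?c v \<le> sc n * (C1 * (1 / real n) ^ 3 * norm (u - v) powr (\<alpha> - 4))"
          using u v d \<open>u \<noteq> v\<close> by (intro mult_left_mono C1(2)[OF n]) auto
        thus "?c v \<le> sc n * (C1 * (1 / real n) ^ 3) * norm (u - v) powr (- (4 - \<alpha>))"
          by (simp add: mult.assoc)
      qed
      also have "\<dots> = sc n * (C1 * (1 / real n) ^ 3) * (\<Sum>v\<in>pts n - near. norm (u - v) powr (- (4 - \<alpha>)))"
        by (simp add: sum_distrib_left)
      also have "\<dots> \<le> sc n * (C1 * (1 / real n) ^ 3) * (C2 * real n powr (4 - \<alpha>))"
      proof (intro mult_left_mono C2(2)[OF n])
        have "u \<in> near" using u by (simp add: near_def)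
        thus "pts n - near \<subseteq> scaled_lattice n - {u}" by auto
      qed (use u fin C1 in auto)
      also have "\<dots> = C1 * C2 * ((1 / real n) ^ 3 * (sc n * real n powr (4 - \<alpha>)))" by (simp add: mult_ac)
      \<comment> \<open>The powers of \<alpha> cancel: n^\<alpha> n^(4-\<alpha>) n^(-3) = n.\<close>
      also have "sc n * real n powr (4 - \<alpha>) = real n ^ 4"
        using n by (simp add: powr_add[symmetric])
      also have "(1 / real n) ^ 3 * real n ^ 4 = real n" using n by (simp add: field_simps eval_nat_numeral)
      finally have 2: "(\<Sum>v\<in>pts n - near. ?c v) \<le> C1 * C2 * real n" .
      have "(\<Sum>v\<in>pts n. ?c v) = (\<Sum>v\<in>near. ?c v) + (\<Sum>v\<in>pts n - near. ?c v)"
        using fin by (subst sum.subset_diff[of near "pts n"]) (auto simp: near_def)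
      thus "(\<Sum>v\<in>pts n. ?c v) \<le> (N * V + C1 * C2) * real n" using 1 2 by (simp add: distrib_right)
    qed
  qed
  moreover have "N * V + C1 * C2 > 0" using V C1 C2 by (intro add_nonneg_pos) (auto simp: N_def)
  ultimately show thesis using that by blast
qed

text \<open>The centred estimator for a generic kernel \<open>k\<close>, to be taken as the positive
  and the negative part of \<open>K\<close>; linearity in \<open>k\<close> recombines them.\<close>

definition smoothed_dev :: "(nat \<Rightarrow> real) \<Rightarrow> (real^2 \<Rightarrow> real) \<Rightarrow> nat \<Rightarrow> real^2 \<Rightarrow> 'w \<Rightarrow> real" where
  "smoothed_dev b k n t \<omega> = 1 / ((real n)\<^sup>2 * (b n)\<^sup>2) *
     (\<Sum>w\<in>pts n. k ((w - t) /\<^sub>R b n) * (sc n * (Dn n w \<omega>)\<^sup>2 - sc n * D2_variance R f (h /\<^sub>R real n) w))"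

lemma moments_D2: "all_moments M (Dn n w)"
  by (rule moments[OF D2_centered[OF ps G mean cv]])

lemma all_moments_smoothed_dev: "all_moments M (smoothed_dev b k n t)"
  unfolding smoothed_dev_def[abs_def] by (intro all_moments_intros moments_D2)

lemma expectation_D2_square: "expectation (\<lambda>\<omega>. (Dn n w \<omega>)\<^sup>2) = D2_variance R f (h /\<^sub>R real n) w"
  using expectation_D2_mult[OF ps G mean cv, of f "h /\<^sub>R real n" w w] by (simp add: power2_eq_square D2_cov_diag)

text \<open>Giving \<open>X w\<close> the square root of a_w n^\<alpha> as its factor, with a_w the
  weights, makes the centred quadratic form equal to \<open>smoothed_dev\<close>. Since sqrt (a_u
  a_v) \<le> A, its row sums are at most \<open>A\<close> times those of the scaled
  covariances.\<close>

lemma smoothed_dev_moment: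
  assumes k0: "\<And>x. k x \<ge> 0" and n: "n \<ge> 1" and fin: "finite (pts n)" and b: "b n > 0"
    and A: "\<And>w. w \<in> pts n \<Longrightarrow> k ((w - t) /\<^sub>R b n) / ((real n)\<^sup>2 * (b n)\<^sup>2) \<le> A" and "A > 0"
    and C: "\<And>u. u \<in> pts n \<Longrightarrow> (\<Sum>v\<in>pts n. sc n * \<bar>D2_cov R f (h /\<^sub>R real n) u v\<bar>) \<le> C" and "C > 0"
    and \<tau>: "1 / ((real n)\<^sup>2 * (b n)\<^sup>2) * (\<Sum>w\<in>pts n. k ((w - t) /\<^sub>R b n) * (sc n * D2_variance R f (h /\<^sub>R real n) w)) \<le> \<tau>"
  shows "expectation (\<lambda>\<omega>. smoothed_dev b k n t \<omega> ^ (2 * p)) \<le> (16 * real p ^ 2 * (A * C) * (A * C + \<tau>)) ^ p"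
proof -
  define a where "a w = k ((w - t) /\<^sub>R b n) / ((real n)\<^sup>2 * (b n)\<^sup>2)" for w
  have a: "a w \<ge> 0" for w using k0 by (simp add: a_def)
  define X where "X w \<omega> = sqrt (a w * sc n) * Dn n w \<omega>" for w \<omega>
  have XV: "X w \<in> centered_span M Z" for w
  proof -
    \<comment> \<open>Scalar multiples come from closure under lines, as X + (c - 1) X.\<close>
    have "(\<lambda>\<omega>. Dn n w \<omega> + (sqrt (a w * sc n) - 1) * Dn n w \<omega>) \<in> centered_span M Z"
      by (intro line_closed D2_centered[OF ps G mean cv])
    thus ?thesis unfolding X_def[abs_def] by (simp add: algebra_simps)
  qed
  have q: "quad_form (pts n) X = (\<lambda>\<omega>. \<Sum>w\<in>pts n. a w * (sc n * (Dn n w \<omega>)\<^sup>2))"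
    unfolding quad_form_def X_def using a by (auto simp: power_mult_distrib mult_ac)
  have Eq: "expectation (quad_form (pts n) X) = (\<Sum>w\<in>pts n. a w * (sc n * D2_variance R f (h /\<^sub>R real n) w))"
  proof -
    have i: "integrable M (\<lambda>\<omega>. (Dn n w \<omega>)\<^sup>2)" for w
      by (intro all_moments_integrable all_moments_power moments_D2)
    have "expectation (quad_form (pts n) X) = (\<Sum>w\<in>pts n. expectation (\<lambda>\<omega>. a w * (sc n * (Dn n w \<omega>)\<^sup>2)))"
      unfolding q using i by (intro Bochner_Integration.integral_sum) simp
    thus ?thesis by (simp add: expectation_D2_square)
  qed
  have dev: "quad_dev (pts n) X = smoothed_dev b k n t"
    unfolding quad_dev_def[abs_def] Eq unfolding q smoothed_dev_def[abs_def]
    by (simp add: sum_subtractf[symmetric] sum_distrib_left a_def right_diff_distrib)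
  have cov: "cross_moment X u v = sqrt (a u) * sqrt (a v) * (sc n * D2_cov R f (h /\<^sub>R real n) u v)" for u v
  proof -
    have "cross_moment X u v = expectation (\<lambda>\<omega>. (sqrt (a u * sc n) * sqrt (a v * sc n)) * (Dn n u \<omega> * Dn n v \<omega>))"
      unfolding cross_moment_def X_def by (simp add: mult_ac)
    also have "\<dots> = (sqrt (a u * sc n) * sqrt (a v * sc n)) * D2_cov R f (h /\<^sub>R real n) u v"
      by (simp add: expectation_D2_mult[OF ps G mean cv])
    also have "sqrt (a u * sc n) * sqrt (a v * sc n) = sqrt (a u) * sqrt (a v) * sc n"
      by (simp add: real_sqrt_mult)
    finally show ?thesis by (simp add: mult.assoc)
  qed
  have row: "(\<Sum>v\<in>pts n. \<bar>cross_moment X u v\<bar>) \<le> A * C" if u: "u \<in> pts n" for u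
  proof -
    have "(\<Sum>v\<in>pts n. \<bar>cross_moment X u v\<bar>) \<le> (\<Sum>v\<in>pts n. A * (sc n * \<bar>D2_cov R f (h /\<^sub>R real n) u v\<bar>))"
    proof (rule sum_mono)
      fix v assume v: "v \<in> pts n"
      have "sqrt (a u) * sqrt (a v) \<le> sqrt A * sqrt A"
        using A u v a \<open>A > 0\<close> by (intro mult_mono) (auto simp: a_def)
      also have "\<dots> = A" using \<open>A > 0\<close> by simp
      finally have "sqrt (a u) * sqrt (a v) \<le> A" .
      hence "sqrt (a u) * sqrt (a v) * (sc n * \<bar>D2_cov R f (h /\<^sub>R real n) u v\<bar>) \<le> A * (sc n * \<bar>D2_cov R f (h /\<^sub>R real n) u v\<bar>)"
        by (rule mult_right_mono) auto
      thus "\<bar>cross_moment X u v\<bar> \<le> A * (sc n * \<bar>D2_cov R f (h /\<^sub>R real n) u v\<bar>)"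
        unfolding cov using a by (simp add: abs_mult)
    qed
    also have "\<dots> = A * (\<Sum>v\<in>pts n. sc n * \<bar>D2_cov R f (h /\<^sub>R real n) u v\<bar>)" by (simp add: sum_distrib_left)
    also have "\<dots> \<le> A * C" using C[OF u] \<open>A > 0\<close> by (intro mult_left_mono) auto
    finally show ?thesis .
  qed
  have Et: "expectation (quad_form (pts n) X) \<le> \<tau>"
    unfolding Eq using \<tau> by (simp add: a_def sum_distrib_left)
  show ?thesis
    using quad_dev_moment_bound[OF fin XV row _ Et, of p] \<open>A > 0\<close> \<open>C > 0\<close> unfolding dev by simp
qed

text \<open>Even powers make each grid value controlled by the whole sum, so a vanishing sum means
  uniform smallness on the grid. The budget is n^6 grid points times moments n^(-8), which leaves
  the summable n^(-2).\<close>

lemma smoothed_dev_grid_AE: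
  assumes k0: "\<And>x. k x \<ge> 0" and k: "integrable lborel k" and L: "\<And>x y. \<bar>k x - k y\<bar> \<le> L * norm (x - y)"
    and b: "\<And>n. n \<ge> 1 \<Longrightarrow> b n > 0" "b \<longlonglongrightarrow> 0" and "\<beta> > 0"
    and nb: "\<forall>\<^sub>F n in sequentially. 1 / (real n * b n ^ 3) \<le> c * real n powr (- \<beta>)" and "D > 0"
  shows "\<exists>p>0. AE \<omega> in M. (\<lambda>n. \<Sum>t\<in>scaled_lattice (n ^ 3) \<inter> cball 0 D. smoothed_dev b k n t \<omega> ^ (2 * p)) \<longlonglongrightarrow> 0"
proof -
  obtain V where V: "V > 0" "\<forall>\<^sub>F n in sequentially. \<forall>w\<in>W. sc n * D2_variance R f (h /\<^sub>R real n) w \<le> V"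
    by (rule scaled_variance_bounded)
  obtain C where C: "C > 0" "\<forall>\<^sub>F n in sequentially. \<forall>u\<in>pts n.
     (\<Sum>v\<in>pts n. sc n * \<bar>D2_cov R f (h /\<^sub>R real n) u v\<bar>) \<le> C * real n"
    by (rule D2_cov_row_sum)
  obtain S where S: "S > 0" "\<And>n b t. n \<ge> 1 \<Longrightarrow> b > 0 \<Longrightarrow>
    1 / ((real n)\<^sup>2 * b\<^sup>2) * (\<Sum>w\<in>pts n. k ((w - t) /\<^sub>R b)) \<le> S * (1 + 1 / (real n * b ^ 3))"
    by (rule kernel_sum_bound[OF W k L k0]) (rule that)
  obtain w0 where w0: "w0 > 0" "\<And>w. w \<in> W \<Longrightarrow> norm w \<le> w0" using W unfolding bounded_pos by blast
  have fin: "finite (pts n)" if "n \<ge> 1" for n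
    by (rule lattice_points_bound[OF W]) (use that in auto)
  have "L \<ge> 0" using L[of 0 "axis 1 1"] abs_ge_zero[of "k 0 - k (axis 1 1)"]
    by (simp add: norm_axis_1)
  \<comment> \<open>Kernel values at the lattice points are at most a / b once b < 1:
    \<open>k x \<le> k 0 + L * norm x\<close>, and the arguments have norm at most (w0 + D) / b. The
    summand 1 keeps \<open>a\<close> positive.\<close>
  define a where "a = k 0 + L * (w0 + D) + 1"
  have a: "a > 0" using k0[of 0] \<open>L \<ge> 0\<close> w0 \<open>D > 0\<close> by (simp add: a_def add_nonneg_pos)
  define c' where "c' = \<bar>c\<bar> + 1"
  define \<rho> where "\<rho> = a * C * c'"
  have \<rho>: "\<rho> > 0" using a C by (simp add: \<rho>_def c'_def)
  \<comment> \<open>The factor 2 bounds \<open>1 + 1 / (real n * b n ^ 3)\<close> for large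
    n.\<close>
  define \<tau> where "\<tau> = 2 * V * S"
  have \<tau>: "\<tau> > 0" using V S by (simp add: \<tau>_def)
  \<comment> \<open>Chosen so that \<beta> p \<ge> 8, which turns the factor n^(-\<beta>) per moment
    step into n^(-8).\<close>
  define p where "p = nat \<lceil>8 / \<beta>\<rceil> + 1"
  have p: "p > 0" "\<beta> * real p \<ge> 8"
  proof -
    have "8 / \<beta> \<le> real p" unfolding p_def by linarith
    thus "\<beta> * real p \<ge> 8" using \<open>\<beta> > 0\<close> by (simp add: field_simps)
  qed (simp add: p_def)
  define E0 where "E0 = (16 * real p ^ 2 * \<rho> * (\<rho> + \<tau>)) ^ p"
  define Gr where "Gr n = scaled_lattice (n ^ 3) \<inter> cball (0::real^2) D" for n
  define e where "e n = (2 * D + 1)\<^sup>2 * E0 * real n powr (- 2)" for n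
  have "(\<lambda>n. \<bar>c\<bar> * real n powr (- \<beta>)) \<longlonglongrightarrow> \<bar>c\<bar> * 0"
    by (intro tendsto_mult_left powr_minus_tendsto_zero \<open>\<beta> > 0\<close>)
  hence ev1: "\<forall>\<^sub>F n in sequentially. \<bar>c\<bar> * real n powr (- \<beta>) < 1" by (intro order_tendstoD(2)) auto
  have ev2: "\<forall>\<^sub>F n in sequentially. b n < 1" using b(2) by (intro order_tendstoD(2)) auto
  have ev3: "\<forall>\<^sub>F n in sequentially. n \<ge> (1::nat)" by (rule eventually_ge_at_top)
  have "\<forall>\<^sub>F n in sequentially. expectation (\<lambda>\<omega>. \<Sum>t\<in>Gr n. smoothed_dev b k n t \<omega> ^ (2 * p)) \<le> e n"
    using V(2) C(2) nb ev1 ev2 ev3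
  proof eventually_elim
    case (elim n)
    have n: "n \<ge> 1" and bn: "b n > 0" "b n < 1" using elim b by auto
    have cn: "1 / (real n * b n ^ 3) \<le> c' * real n powr (- \<beta>)"
    proof -
      have "c * real n powr (- \<beta>) \<le> c' * real n powr (- \<beta>)" by (intro mult_right_mono) (auto simp: c'_def)
      thus ?thesis using elim(3) by linarith
    qed
    have cn1: "1 / (real n * b n ^ 3) \<le> 1"
    proof -
      have "c * real n powr (- \<beta>) \<le> \<bar>c\<bar> * real n powr (- \<beta>)" by (intro mult_right_mono) auto
      thus ?thesis using elim(3,4) by linarith
    qed
    define A where "A = a / ((real n)\<^sup>2 * b n ^ 3)"
    have A: "A > 0" using a n bn by (simp add: A_def)
    have AC: "A * (C * real n) = a * C * (1 / (real n * b n ^ 3))"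
      using n bn by (simp add: A_def power2_eq_square)
    have AC1: "A * (C * real n) \<le> \<rho> * real n powr (- \<beta>)"
      unfolding AC \<rho>_def mult.assoc[of "a * C"] using a C by (intro mult_left_mono cn) auto
    have "real n powr (- \<beta>) \<le> 1" using n \<open>\<beta> > 0\<close> powr_mono2'[of "- \<beta>" 1 "real n"] by simp
    hence AC2: "A * (C * real n) \<le> \<rho>"
    proof -
      assume "real n powr (- \<beta>) \<le> 1"
      hence "\<rho> * real n powr (- \<beta>) \<le> \<rho> * 1" using \<rho> by (intro mult_left_mono) auto
      thus ?thesis using AC1 by linarith
    qed
    have mom: "expectation (\<lambda>\<omega>. smoothed_dev b k n t \<omega> ^ (2 * p)) \<le> E0 * real n powr (- 8)" if t: "t \<in> Gr n" for t
    proof -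
      have "expectation (\<lambda>\<omega>. smoothed_dev b k n t \<omega> ^ (2 * p)) \<le>
          (16 * real p ^ 2 * (A * (C * real n)) * (A * (C * real n) + \<tau>)) ^ p"
      proof (rule smoothed_dev_moment[where k = k and b = b and n = n and A = A, OF k0 n fin[OF n] bn(1) _ A])
        fix w assume w: "w \<in> pts n"
        have "norm (w - t) \<le> w0 + D"
          using norm_triangle_ineq4[of w t] w0(2)[of w] w t by (auto simp: Gr_def)
        hence "L * norm ((w - t) /\<^sub>R b n) \<le> L * ((w0 + D) / b n)"
          using bn \<open>L \<ge> 0\<close> by (intro mult_left_mono) (auto simp: divide_inverse mult.commute)
        hence "k ((w - t) /\<^sub>R b n) \<le> k 0 + L * ((w0 + D) / b n)"
          using L[of "(w - t) /\<^sub>R b n" 0] by simp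
        also have "\<dots> \<le> (k 0 + 1) / b n + L * ((w0 + D) / b n)"
        proof -
          have "k 0 * b n \<le> (k 0 + 1) * 1" using k0[of 0] bn by (intro mult_mono) auto
          hence "k 0 \<le> (k 0 + 1) / b n" using bn by (simp add: pos_le_divide_eq)
          thus ?thesis by (rule add_right_mono)
        qed
        also have "\<dots> = a / b n" by (simp add: a_def add_divide_distrib[symmetric] add_ac)
        finally have "k ((w - t) /\<^sub>R b n) / ((real n)\<^sup>2 * (b n)\<^sup>2) \<le> a / b n / ((real n)\<^sup>2 * (b n)\<^sup>2)"
          by (rule divide_right_mono) auto
        thus "k ((w - t) /\<^sub>R b n) / ((real n)\<^sup>2 * (b n)\<^sup>2) \<le> A"
          by (simp add: A_def power2_eq_square power3_eq_cube mult_ac)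
      next
        have "(\<Sum>w\<in>pts n. k ((w - t) /\<^sub>R b n) * (sc n * D2_variance R f (h /\<^sub>R real n) w)) \<le>
           (\<Sum>w\<in>pts n. k ((w - t) /\<^sub>R b n) * V)"
          using elim(1) k0 by (intro sum_mono mult_left_mono) auto
        hence "1 / ((real n)\<^sup>2 * (b n)\<^sup>2) * (\<Sum>w\<in>pts n. k ((w - t) /\<^sub>R b n) * (sc n * D2_variance R f (h /\<^sub>R real n) w)) \<le>
            1 / ((real n)\<^sup>2 * (b n)\<^sup>2) * (\<Sum>w\<in>pts n. k ((w - t) /\<^sub>R b n) * V)"
          by (intro mult_left_mono) auto
        also have "\<dots> = V * (1 / ((real n)\<^sup>2 * (b n)\<^sup>2) * (\<Sum>w\<in>pts n. k ((w - t) /\<^sub>R b n)))"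
          by (simp add: sum_distrib_right[symmetric])
        also have "\<dots> \<le> V * (S * (1 + 1))"
        proof (intro mult_left_mono)
          have "S * (1 + 1 / (real n * b n ^ 3)) \<le> S * (1 + 1)"
            using cn1 S(1) by (intro mult_left_mono) auto
          thus "1 / ((real n)\<^sup>2 * (b n)\<^sup>2) * (\<Sum>w\<in>pts n. k ((w - t) /\<^sub>R b n)) \<le> S * (1 + 1)"
            using S(2)[OF n bn(1), of t] by linarith
        qed (use V in auto)
        also have "\<dots> = \<tau>" by (simp add: \<tau>_def)
        finally show "1 / ((real n)\<^sup>2 * (b n)\<^sup>2) * (\<Sum>w\<in>pts n. k ((w - t) /\<^sub>R b n) * (sc n * D2_variance R f (h /\<^sub>R real n) w)) \<le> \<tau>" .
      next
        show "C * real n > 0" using C n by simp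
      qed (use elim(2) in auto)
      also have "\<dots> \<le> (16 * real p ^ 2 * (\<rho> * real n powr (- \<beta>)) * (\<rho> + \<tau>)) ^ p"
      proof -
        have "16 * real p ^ 2 * (A * (C * real n)) \<le> 16 * real p ^ 2 * (\<rho> * real n powr (- \<beta>))"
          by (intro mult_left_mono AC1) auto
        moreover have "A * (C * real n) + \<tau> \<le> \<rho> + \<tau>" using AC2 by simp
        ultimately show ?thesis
          using A C(1) \<tau> \<rho> by (intro power_mono mult_mono[of "16 * real p ^ 2 * (A * (C * real n))"]) auto
      qed
      also have "\<dots> = E0 * (real n powr (- \<beta>)) ^ p"
        unfolding E0_def by (simp add: power_mult_distrib mult_ac)
      also have "(real n powr (- \<beta>)) ^ p = real n powr (- (\<beta> * real p))"
        using n by (simp add: powr_realpow[symmetric] powr_powr)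
      also have "E0 * real n powr (- (\<beta> * real p)) \<le> E0 * real n powr (- 8)"
        using n p \<rho> \<tau> unfolding E0_def by (intro mult_left_mono powr_mono zero_le_power mult_nonneg_nonneg) auto
      finally show ?thesis .
    qed
    have "expectation (\<lambda>\<omega>. \<Sum>t\<in>Gr n. smoothed_dev b k n t \<omega> ^ (2 * p)) =
       (\<Sum>t\<in>Gr n. expectation (\<lambda>\<omega>. smoothed_dev b k n t \<omega> ^ (2 * p)))"
      by (intro Bochner_Integration.integral_sum all_moments_integrable all_moments_power all_moments_smoothed_dev)
    also have "\<dots> \<le> (\<Sum>t\<in>Gr n. E0 * real n powr (- 8))" by (intro sum_mono mom)
    also have "\<dots> = real (card (Gr n)) * (E0 * real n powr (- 8))" by simp
    also have "\<dots> \<le> ((2 * D + 1)\<^sup>2 * real n powr 6) * (E0 * real n powr (- 8))"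
    proof (rule mult_right_mono)
      have n3: "n ^ 3 \<ge> 1" using n by simp
      have "real (card (Gr n)) \<le> (2 * real (n ^ 3) * D + 1)\<^sup>2"
        unfolding Gr_def using \<open>D > 0\<close> by (intro scaled_lattice_cball n3) auto
      also have "\<dots> \<le> ((2 * D + 1) * real (n ^ 3))\<^sup>2"
        using one_le_power[of "real n" 3] n \<open>D > 0\<close> by (intro power_mono) (auto simp: algebra_simps)
      also have "\<dots> = (2 * D + 1)\<^sup>2 * real n powr 6"
        using n by (simp add: power_mult_distrib power_mult[symmetric])
      finally show "real (card (Gr n)) \<le> (2 * D + 1)\<^sup>2 * real n powr 6" .
    qed (use \<rho> \<tau> in \<open>simp add: E0_def\<close>)
    also have "\<dots> = (2 * D + 1)\<^sup>2 * E0 * (real n powr 6 * real n powr (- 8))" by (simp only: mult_ac)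
    also have "real n powr 6 * real n powr (- 8) = real n powr (- 2)" by (simp only: powr_add[symmetric]) simp
    finally show ?case by (simp add: e_def)
  qed
  moreover have "summable e"
    unfolding e_def by (intro summable_mult) (simp add: summable_real_powr_iff)
  moreover have "integrable M (\<lambda>\<omega>. \<Sum>t\<in>Gr n. smoothed_dev b k n t \<omega> ^ (2 * p))" for n
    by (intro Bochner_Integration.integrable_sum all_moments_integrable all_moments_power all_moments_smoothed_dev)
  moreover have "(\<Sum>t\<in>Gr n. smoothed_dev b k n t \<omega> ^ (2 * p)) \<ge> 0" for n \<omega>
    by (intro sum_nonneg) simp
  ultimately have "AE \<omega> in M. (\<lambda>n. \<Sum>t\<in>Gr n. smoothed_dev b k n t \<omega> ^ (2 * p)) \<longlonglongrightarrow> 0"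
    by (intro AE_tendsto_zero_if_summable_integral[of M _ e]) auto
  thus ?thesis using p(1) unfolding Gr_def by blast
qed

text \<open>Sums over O(n^2) points divided by n^4 have means O(n^(-2)), which are summable. They
  bound the change of the estimator, and of its mean, between a point and its grid
  neighbour.\<close>

lemma square_sum_limits:
  shows "(\<lambda>n. 1 / real n ^ 4 * (\<Sum>w\<in>pts n. sc n * D2_variance R f (h /\<^sub>R real n) w)) \<longlonglongrightarrow> 0"
    and "AE \<omega> in M. (\<lambda>n. 1 / real n ^ 4 * (\<Sum>w\<in>pts n. sc n * (Dn n w \<omega>)\<^sup>2)) \<longlonglongrightarrow> 0"
proof -
  obtain V where V: "V > 0" "\<forall>\<^sub>F n in sequentially. \<forall>w\<in>W. sc n * D2_variance R f (h /\<^sub>R real n) w \<le> V"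
    by (rule scaled_variance_bounded)
  obtain C where C: "C > 0" "\<And>n. n \<ge> 1 \<Longrightarrow> finite (pts n)" "\<And>n. n \<ge> 1 \<Longrightarrow> real (card (pts n)) \<le> C * (real n)\<^sup>2"
    by (rule lattice_points_bound[OF W]) (rule that)
  define F where "F n = 1 / real n ^ 4 * (\<Sum>w\<in>pts n. sc n * D2_variance R f (h /\<^sub>R real n) w)" for n
  define e where "e n = C * V * real n powr (- 2)" for n
  have D2pos: "D2_variance R f (h /\<^sub>R real n) w \<ge> 0" for n w
    unfolding expectation_D2_square[symmetric] by (intro Bochner_Integration.integral_nonneg) simp
  have "\<forall>\<^sub>F n in sequentially. n \<ge> (1::nat)" by (rule eventually_ge_at_top)
  hence le: "\<forall>\<^sub>F n in sequentially. F n \<le> e n"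
    using V(2)
  proof eventually_elim
    case (elim n)
    have "(\<Sum>w\<in>pts n. sc n * D2_variance R f (h /\<^sub>R real n) w) \<le> (\<Sum>w\<in>pts n. V)"
      using elim by (intro sum_mono) auto
    also have "\<dots> = real (card (pts n)) * V" by simp
    also have "\<dots> \<le> C * (real n)\<^sup>2 * V" using elim V by (intro mult_right_mono C) auto
    finally have "F n \<le> 1 / real n ^ 4 * (C * (real n)\<^sup>2 * V)" unfolding F_def by (intro mult_left_mono) auto
    also have "\<dots> = e n" using elim by (simp add: e_def powr_minus field_simps eval_nat_numeral)
    finally show ?case .
  qed
  have se: "summable e" unfolding e_def by (intro summable_mult) (simp add: summable_real_powr_iff)
  have "F n \<ge> 0" for n unfolding F_def using D2pos by (intro mult_nonneg_nonneg sum_nonneg) auto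
  hence "\<forall>\<^sub>F n in sequentially. 0 \<le> F n" by simp
  from tendsto_sandwich[OF this le tendsto_const summable_LIMSEQ_zero[OF se]]
  show "(\<lambda>n. 1 / real n ^ 4 * (\<Sum>w\<in>pts n. sc n * D2_variance R f (h /\<^sub>R real n) w)) \<longlonglongrightarrow> 0"
    by (simp add: F_def)
  have i: "integrable M (\<lambda>\<omega>. (Dn n w \<omega>)\<^sup>2)" for n w
    by (intro all_moments_integrable all_moments_power moments_D2)
  have "expectation (\<lambda>\<omega>. 1 / real n ^ 4 * (\<Sum>w\<in>pts n. sc n * (Dn n w \<omega>)\<^sup>2)) = F n" for n
    using i by (simp add: F_def expectation_D2_square)
  thus "AE \<omega> in M. (\<lambda>n. 1 / real n ^ 4 * (\<Sum>w\<in>pts n. sc n * (Dn n w \<omega>)\<^sup>2)) \<longlonglongrightarrow> 0"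
    using le se i
    by (intro AE_tendsto_zero_if_summable_integral[of M _ e])
       (auto intro!: mult_nonneg_nonneg divide_nonneg_nonneg sum_nonneg)
qed

text \<open>Five errors, each below e/5: the estimator and its mean both move from t to the grid
  point t', the deviations for \<open>Kp\<close> and \<open>Km\<close> at t' are small, and the mean
  at t is close to the limit.\<close>

lemma kernel_estimate_AE:
  assumes "open W" "compact \<Theta>" "\<Theta> \<subseteq> W"
    and K: "integrable lborel K" "(LINT x|lborel. K x) = 1" and L: "\<And>x y. \<bar>K x - K y\<bar> \<le> L * norm (x - y)"
    and b: "\<And>n. n \<ge> 1 \<Longrightarrow> b n > 0" "b \<longlonglongrightarrow> 0" and "\<beta> > 0"
    and nb: "\<forall>\<^sub>F n in sequentially. 1 / (real n * b n ^ 3) \<le> c * real n powr (- \<beta>)"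
  shows "AE \<omega> in M. uniform_limit \<Theta>
    (\<lambda>n t. 1 / ((real n)\<^sup>2 * (b n)\<^sup>2) * (\<Sum>w\<in>pts n. K ((w - t) /\<^sub>R b n) * (sc n * (Dn n w \<omega>)\<^sup>2)))
    (\<lambda>t. (8 - 2 powr (\<alpha> + 1)) * norm (dirder h f t) powr \<alpha>) sequentially"
proof -
  have "L \<ge> 0" using L[of 0 "axis 1 1"] abs_ge_zero[of "K 0 - K (axis 1 1)"]
    by (simp add: norm_axis_1)
  define g where "g t = (8 - 2 powr (\<alpha> + 1)) * norm (dirder h f t) powr \<alpha>" for t
  define Kp where "Kp x = max (K x) 0" for x
  define Km where "Km x = max (- K x) 0" for x
  have KpKm: "K x = Kp x - Km x" for x by (simp add: Kp_def Km_def)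
  have Kp: "Kp x \<ge> 0" "integrable lborel Kp" "\<bar>Kp x - Kp y\<bar> \<le> L * norm (x - y)"
    and Km: "Km x \<ge> 0" "integrable lborel Km" "\<bar>Km x - Km y\<bar> \<le> L * norm (x - y)" for x y
  proof -
    show "Kp x \<ge> 0" "Km x \<ge> 0" by (auto simp: Kp_def Km_def)
    show "integrable lborel Kp" "integrable lborel Km"
      unfolding Kp_def[abs_def] Km_def[abs_def] using K by (auto intro!: integrable_max)
    show "\<bar>Kp x - Kp y\<bar> \<le> L * norm (x - y)" "\<bar>Km x - Km y\<bar> \<le> L * norm (x - y)"
      using L[of x y] by (auto simp: Kp_def Km_def max_def)
  qed
  obtain D0 where D0: "D0 > 0" "\<And>t. t \<in> \<Theta> \<Longrightarrow> norm t \<le> D0"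
    using compact_imp_bounded[OF \<open>compact \<Theta>\<close>] unfolding bounded_pos by blast
  \<comment> \<open>Room for the grid neighbours, which lie within 2 / n^3 \<le> 2 of points of
    \<Theta>.\<close>
  define D where "D = D0 + 2"
  have D: "D > 0" using D0 by (simp add: D_def)
  define Gr where "Gr n = scaled_lattice (n ^ 3) \<inter> cball (0::real^2) D" for n
  obtain p where p: "p > 0" "AE \<omega> in M. (\<lambda>n. \<Sum>t\<in>Gr n. smoothed_dev b Kp n t \<omega> ^ (2 * p)) \<longlonglongrightarrow> 0"
    using smoothed_dev_grid_AE[OF Kp b \<open>\<beta> > 0\<close> nb D] unfolding Gr_def by blast
  obtain q where q: "q > 0" "AE \<omega> in M. (\<lambda>n. \<Sum>t\<in>Gr n. smoothed_dev b Km n t \<omega> ^ (2 * q)) \<longlonglongrightarrow> 0"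
    using smoothed_dev_grid_AE[OF Km b \<open>\<beta> > 0\<close> nb D] unfolding Gr_def by blast
  define B where "B a n t = 1 / ((real n)\<^sup>2 * (b n)\<^sup>2) * (\<Sum>w\<in>pts n. K ((w - t) /\<^sub>R b n) * a w)"
    for a :: "real^2 \<Rightarrow> real" and n t
  define v where "v n w = sc n * D2_variance R f (h /\<^sub>R real n) w" for n w
  define y where "y n \<omega> w = sc n * (Dn n w \<omega>)\<^sup>2" for n \<omega> w
  have nb0: "(\<lambda>n. 1 / (real n * b n ^ 3)) \<longlonglongrightarrow> 0"
  proof (rule tendsto_sandwich[OF _ nb tendsto_const])
    show "\<forall>\<^sub>F n in sequentially. 0 \<le> 1 / (real n * b n ^ 3)"
      using eventually_ge_at_top[of 1] by eventually_elim (use b in \<open>auto intro!: divide_nonneg_nonneg mult_nonneg_nonneg zero_le_power less_imp_le\<close>)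
    show "(\<lambda>n. c * real n powr (- \<beta>)) \<longlonglongrightarrow> 0"
      using tendsto_mult_left[OF powr_minus_tendsto_zero[OF \<open>\<beta> > 0\<close>], of c] by simp
  qed
  have EB: "uniform_limit \<Theta> (\<lambda>n t. B (v n) n t) g sequentially"
    unfolding B_def v_def
  proof (rule kernel_smoothing_uniform_limit[OF W \<open>open W\<close> \<open>compact \<Theta>\<close> \<open>\<Theta> \<subseteq> W\<close> K L _ _ b nb0])
    show "uniform_limit W (\<lambda>n w. sc n * D2_variance R f (h /\<^sub>R real n) w) g sequentially"
      unfolding g_def by (rule scaled_variance_limit)
    show "continuous_on (closure W) g"
      unfolding g_def using \<alpha> by (intro continuous_intros continuous_on_powr' dirder_continuous[OF f_C1]) auto
  qed
  \<comment> \<open>The prefactor 1 / (n^2 b^2) and the kernel difference 2 L / (n^3 b) combine to 1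
    / (n b^3) times 2 L / n^4, and the first of these factors is at most 1 for large n.\<close>
  have lip: "\<bar>B a n t - B a n t'\<bar> \<le> 2 * L * (1 / real n ^ 4 * (\<Sum>w\<in>pts n. a w))"
    if n: "n \<ge> 1" and nb1: "1 / (real n * b n ^ 3) \<le> 1" and tt: "norm (t - t') \<le> 2 / real (n ^ 3)" and a: "\<And>w. a w \<ge> 0"
    for a n t t'
  proof -
    have bn: "b n > 0" using b n by auto
    have "B a n t - B a n t' = 1 / ((real n)\<^sup>2 * (b n)\<^sup>2) * (\<Sum>w\<in>pts n. (K ((w - t) /\<^sub>R b n) - K ((w - t') /\<^sub>R b n)) * a w)"
      unfolding B_def right_diff_distrib[symmetric] sum_subtractf[symmetric] left_diff_distrib ..
    hence "\<bar>B a n t - B a n t'\<bar> = 1 / ((real n)\<^sup>2 * (b n)\<^sup>2) * \<bar>\<Sum>w\<in>pts n. (K ((w - t) /\<^sub>R b n) - K ((w - t') /\<^sub>R b n)) * a w\<bar>"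
      by (simp add: abs_mult)
    also have "\<dots> \<le> 1 / ((real n)\<^sup>2 * (b n)\<^sup>2) * (\<Sum>w\<in>pts n. L * (2 / real (n ^ 3) / b n) * a w)"
    proof (intro mult_left_mono order_trans[OF sum_abs] sum_mono)
      fix w
      have "(w - t) /\<^sub>R b n - (w - t') /\<^sub>R b n = - ((t - t') /\<^sub>R b n)" by (simp add: algebra_simps)
      hence "norm ((w - t) /\<^sub>R b n - (w - t') /\<^sub>R b n) = norm (t - t') / b n"
        using bn by (simp add: divide_inverse mult.commute)
      also have "\<dots> \<le> 2 / real (n ^ 3) / b n" using tt bn by (intro divide_right_mono) auto
      finally have "L * norm ((w - t) /\<^sub>R b n - (w - t') /\<^sub>R b n) \<le> L * (2 / real (n ^ 3) / b n)"
        using \<open>L \<ge> 0\<close> by (rule mult_left_mono)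
      hence "\<bar>K ((w - t) /\<^sub>R b n) - K ((w - t') /\<^sub>R b n)\<bar> \<le> L * (2 / real (n ^ 3) / b n)"
        using L[of "(w - t) /\<^sub>R b n" "(w - t') /\<^sub>R b n"] by linarith
      thus "\<bar>(K ((w - t) /\<^sub>R b n) - K ((w - t') /\<^sub>R b n)) * a w\<bar> \<le> L * (2 / real (n ^ 3) / b n) * a w"
        unfolding abs_mult abs_of_nonneg[OF a] by (rule mult_right_mono[OF _ a])
    qed (use bn in auto)
    also have "\<dots> = 1 / (real n * b n ^ 3) * (2 * L * (1 / real n ^ 4 * (\<Sum>w\<in>pts n. a w)))"
      unfolding sum_distrib_left[symmetric] using n bn by (simp add: field_simps eval_nat_numeral)
    also have "\<dots> \<le> 1 * (2 * L * (1 / real n ^ 4 * (\<Sum>w\<in>pts n. a w)))"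
      using a \<open>L \<ge> 0\<close> by (intro mult_right_mono nb1 mult_nonneg_nonneg sum_nonneg) auto
    finally show ?thesis by simp
  qed
  have y0: "y n \<omega> w \<ge> 0" for n \<omega> w by (simp add: y_def)
  have v0: "v n w \<ge> 0" for n w
    unfolding v_def expectation_D2_square[symmetric] by (intro mult_nonneg_nonneg Bochner_Integration.integral_nonneg) auto
  have dev: "B (y n \<omega>) n t - B (v n) n t = smoothed_dev b Kp n t \<omega> - smoothed_dev b Km n t \<omega>" for n \<omega> t
    unfolding B_def smoothed_dev_def y_def v_def KpKm right_diff_distrib[symmetric] sum_subtractf[symmetric]
    by (intro arg_cong2[where f = "(*)"] refl sum.cong) (simp only: algebra_simps)
  have "AE \<omega> in M. uniform_limit \<Theta> (\<lambda>n t. B (y n \<omega>) n t) g sequentially"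
    using p(2) q(2) square_sum_limits(2)
  proof eventually_elim
    case (elim \<omega>)
    show ?case
    proof (rule uniform_limitI)
      fix e :: real assume e: "e > 0"
      define \<epsilon> where "\<epsilon> = e / 5"
      have \<epsilon>: "\<epsilon> > 0" using e by (simp add: \<epsilon>_def)
      have e1: "\<forall>\<^sub>F n in sequentially. (\<Sum>t\<in>Gr n. smoothed_dev b Kp n t \<omega> ^ (2 * p)) < \<epsilon> ^ (2 * p)"
        using elim(1) \<epsilon> by (intro order_tendstoD(2)) auto
      have e2: "\<forall>\<^sub>F n in sequentially. (\<Sum>t\<in>Gr n. smoothed_dev b Km n t \<omega> ^ (2 * q)) < \<epsilon> ^ (2 * q)"
        using elim(2) \<epsilon> by (intro order_tendstoD(2)) auto
      have "(\<lambda>n. 2 * L * (1 / real n ^ 4 * (\<Sum>w\<in>pts n. y n \<omega> w))) \<longlonglongrightarrow> 2 * L * 0"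
        unfolding y_def by (intro tendsto_mult_left elim(3))
      hence e3: "\<forall>\<^sub>F n in sequentially. 2 * L * (1 / real n ^ 4 * (\<Sum>w\<in>pts n. y n \<omega> w)) < \<epsilon>"
        using \<epsilon> by (intro order_tendstoD(2)) auto
      have "(\<lambda>n. 2 * L * (1 / real n ^ 4 * (\<Sum>w\<in>pts n. v n w))) \<longlonglongrightarrow> 2 * L * 0"
        unfolding v_def by (intro tendsto_mult_left square_sum_limits(1))
      hence e4: "\<forall>\<^sub>F n in sequentially. 2 * L * (1 / real n ^ 4 * (\<Sum>w\<in>pts n. v n w)) < \<epsilon>"
        using \<epsilon> by (intro order_tendstoD(2)) auto
      have e5: "\<forall>\<^sub>F n in sequentially. 1 / (real n * b n ^ 3) < 1" using nb0 by (intro order_tendstoD(2)) auto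
      have e6: "\<forall>\<^sub>F n in sequentially. \<forall>t\<in>\<Theta>. dist (B (v n) n t) (g t) < \<epsilon>" by (rule uniform_limitD[OF EB \<epsilon>])
      have e7: "\<forall>\<^sub>F n in sequentially. n \<ge> (1::nat)" by (rule eventually_ge_at_top)
      show "\<forall>\<^sub>F n in sequentially. \<forall>t\<in>\<Theta>. dist (B (y n \<omega>) n t) (g t) < e"
        using e1 e2 e3 e4 e5 e6 e7
      proof eventually_elim
        case (elim n)
        hence n: "n \<ge> 1" and n3: "n ^ 3 \<ge> 1" by auto
        show ?case
        proof
          fix t assume t: "t \<in> \<Theta>"
          define t' where "t' = lattice_floor (n ^ 3) t"
          have tt: "norm (t' - t) \<le> 2 / real (n ^ 3)" unfolding t'_def by (rule norm_lattice_floor_diff[OF n3])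
          also have "\<dots> \<le> 2" using n by (simp add: divide_le_eq)
          finally have "norm t' \<le> D" using norm_triangle_ineq[of "t' - t" t] D0(2)[OF t] by (simp add: D_def)
          hence t': "t' \<in> Gr n" unfolding Gr_def t'_def using lattice_floor_in_scaled_lattice by simp
          have fG: "finite (Gr n)" unfolding Gr_def using D by (intro scaled_lattice_cball n3) auto
          \<comment> \<open>The even power of one grid value is at most the sum, and taking roots
            gives the bound by \<epsilon>.\<close>
          have root: "\<bar>x t'\<bar> < \<epsilon>" if "(\<Sum>t\<in>Gr n. x t ^ (2 * r)) < \<epsilon> ^ (2 * r)" for x :: "real^2 \<Rightarrow> real" and r
          proof -
            have "x t' ^ (2 * r) \<le> (\<Sum>t\<in>Gr n. x t ^ (2 * r))"
              using fG t' by (intro member_le_sum) auto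
            hence "\<bar>x t'\<bar> ^ (2 * r) < \<epsilon> ^ (2 * r)" using that by (simp add: power_even_abs)
            thus ?thesis by (rule power_less_imp_less_base) (use \<epsilon> in simp)
          qed
          have "\<bar>smoothed_dev b Kp n t' \<omega>\<bar> < \<epsilon>" "\<bar>smoothed_dev b Km n t' \<omega>\<bar> < \<epsilon>"
            by (rule root[OF elim(1)], rule root[OF elim(2)])
          moreover have "\<bar>B (y n \<omega>) n t - B (y n \<omega>) n t'\<bar> < \<epsilon>"
            by (rule le_less_trans[OF lip[OF n less_imp_le[OF elim(5)]] elim(3)])
               (use tt y0 in \<open>auto simp: norm_minus_commute\<close>)
          moreover have "\<bar>B (v n) n t - B (v n) n t'\<bar> < \<epsilon>"
            by (rule le_less_trans[OF lip[OF n less_imp_le[OF elim(5)]] elim(4)])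
               (use tt v0 in \<open>auto simp: norm_minus_commute\<close>)
          moreover have "\<bar>B (v n) n t - g t\<bar> < \<epsilon>" using elim(6) t by (auto simp: dist_real_def)
          ultimately have "\<bar>B (y n \<omega>) n t - g t\<bar> < \<epsilon> + \<epsilon> + \<epsilon> + \<epsilon> + \<epsilon>"
            using dev[of n \<omega> t'] by linarith
          thus "dist (B (y n \<omega>) n t) (g t) < e" by (simp add: dist_real_def \<epsilon>_def)
        qed
      qed
    qed
  qed
  thus ?thesis unfolding B_def y_def g_def .
qed

end

section \<open>From uniform limits to the supremum\<close>

text \<open>In the extended nonnegative reals the supremum exists without a boundedness argument and
  is 0 for empty \<open>S\<close>. The threshold \<open>a\<close> may be infinite, so a finite
  \<open>e\<close> is interposed below it.\<close>

lemma SUP_ennreal_tendsto_zero: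
  fixes F :: "nat \<Rightarrow> 'a \<Rightarrow> real"
  assumes "uniform_limit S F g sequentially"
  shows "(\<lambda>n. SUP t\<in>S. ennreal \<bar>F n t - g t\<bar>) \<longlonglongrightarrow> 0"
proof (rule order_tendstoI)
  fix a :: ennreal assume "a > 0"
  then obtain x where x: "0 < x" "x < a" using dense by blast
  then obtain e where e: "e > 0" "ennreal e < a"
    by (cases x) auto
  show "\<forall>\<^sub>F n in sequentially. (SUP t\<in>S. ennreal \<bar>F n t - g t\<bar>) < a"
    using uniform_limitD[OF assms e(1)]
  proof eventually_elim
    case (elim n)
    have "(SUP t\<in>S. ennreal \<bar>F n t - g t\<bar>) \<le> ennreal e"
      using elim by (intro SUP_least ennreal_leI) (auto simp: dist_real_def less_imp_le)
    thus ?case using e by simp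
  qed
qed simp

theorem theorem1:
  fixes M :: "'w measure"
    and Z :: "real^2 \<Rightarrow> 'w \<Rightarrow> real"
    and R :: "real \<Rightarrow> real"
    and m \<alpha> \<gamma> c0 \<beta> :: real
    and \<Omega> \<Theta> :: "(real^2) set"
    and f :: "real^2 \<Rightarrow> real^2"
    and h :: "real^2"
    and K :: "real^2 \<Rightarrow> real"
    and b :: "nat \<Rightarrow> real"
  assumes "prob_space M"
    and "gaussian_field M Z"
    and "\<And>t. (LINT \<omega>|M. Z t \<omega>) = m"
    and "\<And>t s. covariance M (Z t) (Z s) = R (norm (t - s))"
    and "0 < \<alpha>" and "\<alpha> < 2" and "\<gamma> > 0"
    and "(\<lambda>t. R t - (R 0 - t powr \<alpha>)) \<in> o[at_right 0](\<lambda>t. t powr (\<alpha> + \<gamma>))"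
    and "Ck_on_real 4 {0<..} R"
    and "c0 > 0"
    and "\<forall>\<^sub>F t in at_right 0. \<bar>(deriv ^^ 4) R t\<bar> \<le> c0 * t powr (\<alpha> - 4)"
    and "open \<Omega>" and "connected \<Omega>" and "\<Omega> \<noteq> {}" and "bounded \<Omega>" and "simply_connected \<Omega>"
    and "Cr_diffeo 2 f"
    and "h \<noteq> 0"
    and "Cr_on 2 UNIV K"
    and "\<And>i. bounded (range (partial i K))"
    and "\<And>i j. bounded (range (partial i (partial j K)))"
    and "integrable lborel K" and "(LINT x|lborel. K x) = 1"
    and "integrable lborel (\<lambda>x. norm x * K x)"
    and "\<And>n. n \<ge> 1 \<Longrightarrow> b n > 0"
    and "b \<longlonglongrightarrow> 0"
    and "\<beta> > 0"
    and "(\<lambda>n. 1 / (real n * b n ^ 3)) \<in> O(\<lambda>n. real n powr (- \<beta>))"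
    and "compact \<Theta>" and "\<Theta> \<subseteq> \<Omega>"
  shows "AE \<omega> in M.
    (\<lambda>n. SUP t\<in>\<Theta>. ennreal \<bar>kernel_qv \<alpha> \<Omega> K h ((\<lambda>x. Z x \<omega>) \<circ> f) n (b n) t
                          - (8 - 2 powr (\<alpha> + 1)) * norm (jacobian f (at t) *v h) powr \<alpha>\<bar>)
      \<longlonglongrightarrow> 0"
proof -
  have f: "Cr_on 2 UNIV f" "inj f" and det: "det (jacobian f (at x)) \<noteq> 0" for x
    using \<open>Cr_diffeo 2 f\<close> less_imp_neq[of 0 "det (jacobian f (at x))"] by (auto simp: Cr_diffeo_def)
  obtain L where L: "L > 0" "\<And>x y. \<bar>K x - K y\<bar> \<le> L * norm (x - y)"
    by (rule kernel_lipschitz[of 1 K]) (use assms in \<open>simp_all add: numeral_2_eq_2\<close>)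
  obtain c where "c > 0" and c: "\<forall>\<^sub>F n in sequentially. norm (1 / (real n * b n ^ 3)) \<le> c * norm (real n powr (- \<beta>))"
    using landau_o.bigE[OF \<open>(\<lambda>n. 1 / (real n * b n ^ 3)) \<in> O(\<lambda>n. real n powr (- \<beta>))\<close>] by blast
  have nb: "\<forall>\<^sub>F n in sequentially. 1 / (real n * b n ^ 3) \<le> c * real n powr (- \<beta>)"
    using c by eventually_elim (rule order_trans[OF abs_ge_self], simp)
  have qv: "kernel_qv \<alpha> \<Omega> K h ((\<lambda>x. Z x \<omega>) \<circ> f) n (b n) t = 1 / ((real n)\<^sup>2 * (b n)\<^sup>2) *
      (\<Sum>w\<in>\<Omega> \<inter> scaled_lattice n. K ((w - t) /\<^sub>R b n) * (real n powr \<alpha> * (D2 Z f (h /\<^sub>R real n) w \<omega>)\<^sup>2))" for \<omega> n t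
    unfolding kernel_qv_def increment_increment by (simp add: powr_minus divide_inverse mult_ac)
  have jac: "jacobian f (at t) *v h = dirder h f t" for t
    by (rule jacobian_eq_dirder[of 1]) (use f in \<open>simp add: numeral_2_eq_2\<close>)
  have "AE \<omega> in M. uniform_limit \<Theta> (\<lambda>n t. kernel_qv \<alpha> \<Omega> K h ((\<lambda>x. Z x \<omega>) \<circ> f) n (b n) t)
      (\<lambda>t. (8 - 2 powr (\<alpha> + 1)) * norm (jacobian f (at t) *v h) powr \<alpha>) sequentially"
    unfolding qv jac
    by (rule kernel_estimate_AE[OF assms(1-9) assms(11) f(1) det f(2) \<open>h \<noteq> 0\<close> \<open>bounded \<Omega>\<close> \<open>open \<Omega>\<close>
          \<open>compact \<Theta>\<close> \<open>\<Theta> \<subseteq> \<Omega>\<close> \<open>integrable lborel K\<close> \<open>(LINT x|lborel. K x) = 1\<close> L(2) assms(25-27) nb])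
  thus ?thesis by eventually_elim (rule SUP_ennreal_tendsto_zero)
qed

end
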